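(* Let $p\ge 1$ and let $\gamma_p$ denote the lowest eigenvalue of the self-adjoint operator $H_p u=-u''+|t|^p u$ on $L^2(\mathbb{R})$. For $\lambda\ge 0$ let $L_p(\lambda)$ be the closure in $L^2(\mathbb{R}^2)$ of the operator $$L_p(\lambda)\psi=-\Delta\psi+\bigl(|xy|^p-\lambda(x^2+y^2)^{p/(p+2)}\bigr)\psi$$ defined on $C_0^\infty(\mathbb{R}^2)$. Then for every $\lambda>\gamma_p$ one has $\sigma(L_p(\lambda))=\mathbb{R}$.
   Context: $(x,y)$ are Cartesian coordinates in $\mathbb{R}^2$. The operator on $C_0^\infty(\mathbb{R}^2)$ is essentially self-adjoint, so $L_p(\lambda)$ is self-adjoint. *)

theory Defs
  imports "HOL-Analysis.Analysis"
begin

fun iter_dd :: "'a::euclidean_space list \<Rightarrow> ('a \<Rightarrow> complex) \<Rightarrow> ('a \<Rightarrow> complex)" where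
  "iter_dd [] f = f"
| "iter_dd (b # bs) f = (\<lambda>x. vector_derivative (\<lambda>t. iter_dd bs f (x + t *\<^sub>R b)) (at 0))"

definition smooth_fun :: "('a::euclidean_space \<Rightarrow> complex) \<Rightarrow> bool" where
  "smooth_fun f \<longleftrightarrow> (\<forall>bs. set bs \<subseteq> Basis \<longrightarrow>
      continuous_on UNIV (iter_dd bs f) \<and>
      (\<forall>x b. b \<in> Basis \<longrightarrow> (\<lambda>t. iter_dd bs f (x + t *\<^sub>R b)) differentiable (at (0::real))))"

definition test_funs :: "('a::euclidean_space \<Rightarrow> complex) set" where
  "test_funs = {f. smooth_fun f \<and> compact (closure {x. f x \<noteq> 0})}"

definition laplacian :: "('a::euclidean_space \<Rightarrow> complex) \<Rightarrow> ('a \<Rightarrow> complex)" where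
  "laplacian f = (\<lambda>x. \<Sum>b\<in>Basis. iter_dd [b, b] f x)"

text \<open>Square-integrable functions (representatives of L^2 classes).\<close>
definition L2 :: "('a::euclidean_space \<Rightarrow> complex) set" where
  "L2 = {f. f \<in> borel_measurable lborel \<and> integrable lborel (\<lambda>x. (cmod (f x))\<^sup>2)}"

definition L2norm :: "('a::euclidean_space \<Rightarrow> complex) \<Rightarrow> real" where
  "L2norm f = sqrt (\<integral>x. (cmod (f x))\<^sup>2 \<partial>lborel)"

definition op_closure :: "(('a::euclidean_space \<Rightarrow> complex) \<Rightarrow> ('a \<Rightarrow> complex))
    \<Rightarrow> (('a \<Rightarrow> complex) \<times> ('a \<Rightarrow> complex)) set" where
  "op_closure T = {(u, v). u \<in> L2 \<and> v \<in> L2 \<and>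
      (\<exists>\<phi>. (\<forall>n. \<phi> n \<in> test_funs) \<and>
           (\<lambda>n. L2norm (\<lambda>x. \<phi> n x - u x)) \<longlonglongrightarrow> 0 \<and>
           (\<lambda>n. L2norm (\<lambda>x. T (\<phi> n) x - v x)) \<longlonglongrightarrow> 0)}"

definition op_resolvent_set :: "(('a::euclidean_space \<Rightarrow> complex) \<times> ('a \<Rightarrow> complex)) set \<Rightarrow> complex set" where
  "op_resolvent_set G = {z.
      (\<forall>g\<in>L2. \<exists>(u, v)\<in>G. AE x in lborel. v x - z * u x = g x) \<and>
      (\<exists>C. \<forall>(u, v)\<in>G. L2norm u \<le> C * L2norm (\<lambda>x. v x - z * u x))}"

definition op_spectrum :: "(('a::euclidean_space \<Rightarrow> complex) \<times> ('a \<Rightarrow> complex)) set \<Rightarrow> complex set" where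
  "op_spectrum G = - op_resolvent_set G"

definition op_real_eigenvalues :: "(('a::euclidean_space \<Rightarrow> complex) \<times> ('a \<Rightarrow> complex)) set \<Rightarrow> real set" where
  "op_real_eigenvalues G = {\<mu>. \<exists>u v. (u, v) \<in> G \<and> \<not> (AE x in lborel. u x = 0) \<and>
      (AE x in lborel. v x = complex_of_real \<mu> * u x)}"

definition H_op :: "real \<Rightarrow> (real \<Rightarrow> complex) \<Rightarrow> (real \<Rightarrow> complex)" where
  "H_op p u = (\<lambda>t. - laplacian u t + complex_of_real (\<bar>t\<bar> powr p) * u t)"

definition L_op :: "real \<Rightarrow> real \<Rightarrow> (real \<times> real \<Rightarrow> complex) \<Rightarrow> (real \<times> real \<Rightarrow> complex)" where
  "L_op p lam \<psi> = (\<lambda>z. - laplacian \<psi> z +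
      complex_of_real (\<bar>fst z * snd z\<bar> powr p - lam * ((fst z)\<^sup>2 + (snd z)\<^sup>2) powr (p / (p + 2))) * \<psi> z)"

end

theory Submission
  imports Defs "HOL-Real_Asymp.Real_Asymp"
begin

text \<open>
  With \<open>\<alpha> = p / (p + 2) < 1\<close> the potential is bounded below by \<open>- c (1 + |z|)\<close> to the power
  \<open>2 \<alpha>\<close>. Nonreal \<open>z\<close> belong to the resolvent set because the operator is symmetric and the range of
  \<open>L - z\<close> is dense: a square-integrable \<open>W\<close> orthogonal to this range is mollified, which turns its
  distributional equation into a pointwise one with a locally vanishing error; testing the latter with
  \<open>\<eta>\<^sup>2 cnj W\<close> for a cutoff \<open>\<eta>\<close> at radius \<open>R\<close> bounds the mass of \<open>W\<close> by \<open>R\<close> to the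
  power \<open>\<alpha> - 1\<close>, so \<open>W = 0\<close>.

  A real \<open>\<mu>\<close> is in the spectrum because of a singular sequence. In the variable \<open>t = x\<^sup>\<alpha> y\<close> the
  transversal part of \<open>L\<close> is \<open>x\<close> to the power \<open>2 \<alpha>\<close> times \<open>H\<^sub>p\<close>, so for an approximate
  eigenfunction \<open>h\<close> of \<open>H\<^sub>p\<close> at \<open>\<gamma>\<close> the function \<open>a(x / n) exp(i phase(x)) h(x\<^sup>\<alpha> y)\<close> nearly
  solves \<open>L \<psi> = \<mu> \<psi>\<close> if \<open>phase' = \<kappa> x\<^sup>\<alpha> + \<nu> x\<^sup>-\<^sup>\<alpha>\<close>, \<open>\<kappa>\<^sup>2 = \<lambda> - \<gamma>\<close> and \<open>2 \<kappa> \<nu> = \<mu>\<close>. As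
  the error of \<open>h\<close> gets multiplied by \<open>x\<close> to the power \<open>2 \<alpha>\<close>, \<open>h\<close> has to depend on \<open>n\<close>: a weighted
  energy estimate yields test functions supported in \<open>[- T, T]\<close> with error \<open>exp (- T)\<close>, and
  \<open>T = 2 ln n\<close> is used.
\<close>

section \<open>Partial derivatives and smooth functions\<close>

text \<open>The exponent \<alpha> is forced by scaling: with y = t x^(-\<alpha>) the term -d^2/dy^2
  carries x^(2 \<alpha>) and |x y|^p carries x^(p - \<alpha> p), and these agree iff \<alpha> = p /
  (p + 2). Membership in the graph of a closure only says that test functions converge in norm. It
  gives neither smoothness nor decay of an eigenfunction, and |t|^p itself need not be smooth at 0.
  So the construction in the plane never touches an eigenfunction: it starts from test functions
  that nearly solve the equation, and decay is proved for these with constants independent of T.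
  With T = 2 ln n the amplified error is of order n^(2 \<alpha> - 2), while T enters the other terms
  only through powers of ln n times negative powers of n. The potential is merely continuous, so
  mollification takes the place of elliptic regularity. Its commutator with the potential is small
  only on bounded sets; hence the cutoff radius has to be fixed before the mollification
  radius.\<close>

definition pd :: "'a::euclidean_space \<Rightarrow> ('a \<Rightarrow> complex) \<Rightarrow> ('a \<Rightarrow> complex)" where
  "pd b f = (\<lambda>x. vector_derivative (\<lambda>t. f (x + t *\<^sub>R b)) (at 0))"

text \<open>\<open>vector_derivative\<close> has a value even where no derivative exists, so
  \<open>pd\<close> alone carries no information. This relation also asserts existence, and at every
  point, so that the calculus rules can be stated between functions.\<close>

definition has_pd :: "('a::euclidean_space \<Rightarrow> complex) \<Rightarrow> ('a \<Rightarrow> complex) \<Rightarrow> 'a \<Rightarrow> bool" where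
  "has_pd f f' b \<longleftrightarrow> (\<forall>x. ((\<lambda>t. f (x + t *\<^sub>R b)) has_vector_derivative f' x) (at 0))"

declare iter_dd.simps(2) [simp del]

lemma iter_dd_Cons [simp]: "iter_dd (b # bs) f = pd b (iter_dd bs f)"
  by (simp add: iter_dd.simps pd_def)

lemma laplacian_eq: "laplacian f = (\<lambda>x. \<Sum>b\<in>Basis. pd b (pd b f) x)"
  by (simp add: laplacian_def)

lemma has_pd_imp_pd: "has_pd f f' b \<Longrightarrow> pd b f = f'"
  by (auto simp: has_pd_def pd_def fun_eq_iff intro: vector_derivative_at)

text \<open>Moving the base point along the line reduces the parameter \<open>s\<close> to the
  parameter 0.\<close>

lemma has_pd_at:
  assumes "has_pd f f' b"
  shows "((\<lambda>t. f (x + t *\<^sub>R b)) has_vector_derivative f' (x + s *\<^sub>R b)) (at s)"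
proof -
  have 1: "((\<lambda>t. t - s) has_vector_derivative 1) (at s)"
    by (auto intro!: derivative_eq_intros)
  have 2: "((\<lambda>t. f ((x + s *\<^sub>R b) + t *\<^sub>R b)) has_vector_derivative f' (x + s *\<^sub>R b)) (at (s - s))"
    using assms by (simp add: has_pd_def)
  show ?thesis
    using vector_diff_chain_at[OF 1 2] by (simp add: o_def algebra_simps)
qed

section \<open>Calculus rules for partial derivatives\<close>

lemma has_pd_const: "has_pd (\<lambda>x. c) (\<lambda>x. 0) b"
  by (simp add: has_pd_def)

lemma has_pd_add: "has_pd f f' b \<Longrightarrow> has_pd g g' b \<Longrightarrow> has_pd (\<lambda>x. f x + g x) (\<lambda>x. f' x + g' x) b"
  by (auto simp: has_pd_def intro!: derivative_intros)

lemma has_pd_mult: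
  "has_pd f f' b \<Longrightarrow> has_pd g g' b \<Longrightarrow> has_pd (\<lambda>x. f x * g x) (\<lambda>x. f x * g' x + f' x * g x) b"
  by (auto simp: has_pd_def intro!: derivative_eq_intros)

lemma has_pd_cmult: "has_pd f f' b \<Longrightarrow> has_pd (\<lambda>x. c * f x) (\<lambda>x. c * f' x) b"
  using has_pd_mult[OF has_pd_const, of f f' b c] by simp

lemma has_pd_uminus: "has_pd f f' b \<Longrightarrow> has_pd (\<lambda>x. - f x) (\<lambda>x. - f' x) b"
  using has_pd_cmult[of f f' b "-1"] by simp

lemma has_pd_cnj: "has_pd f f' b \<Longrightarrow> has_pd (\<lambda>x. cnj (f x)) (\<lambda>x. cnj (f' x)) b"
  by (auto simp: has_pd_def intro!: has_vector_derivative_cnj)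

lemma has_pd_reflect:
  assumes "has_pd f f' b"
  shows "has_pd (\<lambda>y. f (a - y)) (\<lambda>y. - f' (a - y)) b"
  unfolding has_pd_def
proof
  fix y
  have 1: "((\<lambda>t. - t) has_vector_derivative -1) (at (0::real))"
    by (auto intro!: derivative_eq_intros)
  have 2: "((\<lambda>t. f ((a - y) + t *\<^sub>R b)) has_vector_derivative f' (a - y)) (at (- 0))"
    using assms by (simp add: has_pd_def)
  show "((\<lambda>t. f (a - (y + t *\<^sub>R b))) has_vector_derivative - f' (a - y)) (at 0)"
    using vector_diff_chain_at[OF 1 2] by (simp add: o_def algebra_simps)
qed

text \<open>Smoothness is a greatest fixed point: if the continuous functions in \<open>S\<close>
  have their partial derivatives in \<open>S\<close> again, then \<open>iter_dd\<close> never leaves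
  \<open>S\<close>. Choosing a suitable \<open>S\<close> avoids every induction over lists of
  directions below.\<close>

lemma smooth_fun_coinduct:
  assumes "f \<in> S"
    and "\<And>g. g \<in> S \<Longrightarrow> continuous_on UNIV g"
    and "\<And>g b. g \<in> S \<Longrightarrow> b \<in> Basis \<Longrightarrow> \<exists>g'\<in>S. has_pd g g' b"
  shows "smooth_fun f"
proof -
  have S: "iter_dd bs f \<in> S" if "set bs \<subseteq> Basis" for bs
    using that
  proof (induction bs)
    case (Cons b bs)
    then have "iter_dd bs f \<in> S" "b \<in> Basis" by auto
    then obtain g' where "g' \<in> S" "has_pd (iter_dd bs f) g' b"
      using assms(3) by blast
    then show ?case using has_pd_imp_pd by auto
  qed (use assms(1) in simp)
  show ?thesis
    unfolding smooth_fun_def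
  proof (intro allI impI conjI)
    fix bs :: "'a list" assume bs: "set bs \<subseteq> Basis"
    show "continuous_on UNIV (iter_dd bs f)" using S[OF bs] assms(2) by blast
    fix x b :: 'a assume "b \<in> Basis"
    then obtain g' where "has_pd (iter_dd bs f) g' b"
      using S[OF bs] assms(3) by blast
    then show "(\<lambda>t. iter_dd bs f (x + t *\<^sub>R b)) differentiable (at (0::real))"
      unfolding has_pd_def by (meson differentiableI_vector)
  qed
qed

lemma smooth_fun_continuous: "smooth_fun f \<Longrightarrow> continuous_on UNIV f"
  unfolding smooth_fun_def by (drule spec[of _ "[]"]) simp

lemma smooth_fun_has_pd: "smooth_fun f \<Longrightarrow> b \<in> Basis \<Longrightarrow> has_pd f (pd b f) b"
  unfolding smooth_fun_def has_pd_def pd_def vector_derivative_works[symmetric]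
  by (drule spec[of _ "[]"]) simp

lemma smooth_fun_pd:
  assumes "smooth_fun f" "b \<in> Basis"
  shows "smooth_fun (pd b f)"
proof -
  have "iter_dd bs (pd b f) = iter_dd (bs @ [b]) f" for bs
    by (induction bs) auto
  then show ?thesis using assms unfolding smooth_fun_def by simp
qed

text \<open>Serves to prove smoothness of concrete functions: the derivatives of bumps and waves are
  not of the same shape again, but they are polynomials in finitely many such shapes.\<close>

inductive_set fun_alg :: "('a \<Rightarrow> complex) set \<Rightarrow> ('a \<Rightarrow> complex) set" for G where
  gen: "g \<in> G \<Longrightarrow> g \<in> fun_alg G"
| const: "(\<lambda>x. c) \<in> fun_alg G"
| add: "f \<in> fun_alg G \<Longrightarrow> g \<in> fun_alg G \<Longrightarrow> (\<lambda>x. f x + g x) \<in> fun_alg G"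
| mult: "f \<in> fun_alg G \<Longrightarrow> g \<in> fun_alg G \<Longrightarrow> (\<lambda>x. f x * g x) \<in> fun_alg G"

text \<open>By the sum and Leibniz rules the whole algebra is closed under differentiation once the
  derivatives of the generators lie in it, so it qualifies as the class \<open>S\<close> of
  \<open>smooth_fun_coinduct\<close>.\<close>

lemma smooth_fun_alg:
  assumes "f \<in> fun_alg G"
    and cont: "\<And>g. g \<in> G \<Longrightarrow> continuous_on UNIV g"
    and der: "\<And>g b. g \<in> G \<Longrightarrow> b \<in> Basis \<Longrightarrow> \<exists>g'\<in>fun_alg G. has_pd g g' b"
  shows "smooth_fun f"
proof (rule smooth_fun_coinduct[OF assms(1)])
  show "continuous_on UNIV g" if "g \<in> fun_alg G" for g
    using that
  proof induction
    case (gen g) then show ?case by (rule cont)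
  qed (auto intro!: continuous_intros)
  show "\<exists>g'\<in>fun_alg G. has_pd g g' b" if "g \<in> fun_alg G" "b \<in> Basis" for g b
    using that
  proof induction
    case (add f g)
    then obtain f' g' where *: "f' \<in> fun_alg G" "g' \<in> fun_alg G" "has_pd f f' b" "has_pd g g' b"
      by blast
    show ?case
      by (rule bexI, rule has_pd_add[OF *(3,4)]) (intro fun_alg.add *)
  next
    case (mult f g)
    then obtain f' g' where *: "f' \<in> fun_alg G" "g' \<in> fun_alg G" "has_pd f f' b" "has_pd g g' b"
      by blast
    show ?case
      by (rule bexI, rule has_pd_mult[OF *(3,4)])
        (intro fun_alg.add fun_alg.mult * mult.hyps)
  next
    case (const c)
    show ?case by (rule bexI, rule has_pd_const) (rule fun_alg.const)
  qed (use der in blast)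
qed

section \<open>Closure properties of smooth functions\<close>

lemma fun_alg_smooth:
  assumes "f \<in> fun_alg (Collect smooth_fun)"
  shows "smooth_fun f"
  by (rule smooth_fun_alg[OF assms])
    (auto intro: smooth_fun_continuous smooth_fun_has_pd smooth_fun_pd fun_alg.gen)

lemma smooth_fun_const: "smooth_fun (\<lambda>x. c)"
  by (intro fun_alg_smooth fun_alg.intros)

lemma smooth_fun_add: "smooth_fun f \<Longrightarrow> smooth_fun g \<Longrightarrow> smooth_fun (\<lambda>x. f x + g x)"
  by (intro fun_alg_smooth fun_alg.add fun_alg.gen) auto

lemma smooth_fun_mult: "smooth_fun f \<Longrightarrow> smooth_fun g \<Longrightarrow> smooth_fun (\<lambda>x. f x * g x)"
  by (intro fun_alg_smooth fun_alg.mult fun_alg.gen) auto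

lemma smooth_fun_reflect:
  assumes "smooth_fun f"
  shows "smooth_fun (\<lambda>y. f (a - y))"
proof -
  \<comment> \<open>The factor \<open>c\<close> absorbs the sign that each derivative of a reflected
    function produces.\<close>
  define S where "S = {g. \<exists>c k. smooth_fun k \<and> g = (\<lambda>y. c * k (a - y))}"
  have SI: "(\<lambda>y. c * k (a - y)) \<in> S" if "smooth_fun k" for c k
    unfolding S_def using that by (intro CollectI exI[of _ c] exI[of _ k]) simp
  show ?thesis
  proof (rule smooth_fun_coinduct[of _ S])
    show "(\<lambda>y. f (a - y)) \<in> S"
      using SI[OF assms, of 1] by simp
  next
    fix g assume "g \<in> S"
    then obtain c k where k: "g = (\<lambda>y. c * k (a - y))" "smooth_fun k"
      unfolding S_def by blast
    show "continuous_on UNIV g"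
      unfolding k(1)
      by (intro continuous_on_mult continuous_on_const
          continuous_on_compose2[OF smooth_fun_continuous[OF k(2)]] continuous_on_diff continuous_on_id) auto
    fix b :: 'a assume b: "b \<in> Basis"
    have "has_pd g (\<lambda>y. (- c) * pd b k (a - y)) b"
      using has_pd_cmult[OF has_pd_reflect[OF smooth_fun_has_pd[OF k(2) b]], of c a] by (simp add: k(1))
    then show "\<exists>g'\<in>S. has_pd g g' b"
      by (intro bexI[where x="\<lambda>y. - c * pd b k (a - y)"] SI[OF smooth_fun_pd[OF k(2) b]])
  qed
qed

section \<open>Test functions\<close>

lemma test_funs_iff: "f \<in> test_funs \<longleftrightarrow> smooth_fun f \<and> (\<exists>r. \<forall>x. norm x > r \<longrightarrow> f x = 0)"
proof -
  have "compact (closure {x. f x \<noteq> 0}) \<longleftrightarrow> (\<exists>r. \<forall>x. norm x > r \<longrightarrow> f x = 0)"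
    unfolding compact_closure bounded_iff by (metis (mono_tags, lifting) mem_Collect_eq not_le)
  then show ?thesis by (auto simp: test_funs_def)
qed

text \<open>With the constant 0 this says that supports do not grow under differentiation; with the
  constant 1 it later confines the derivatives of a plateau function to its flanks.\<close>

lemma has_pd_locally_const:
  assumes "has_pd f f' b" "open S" "x \<in> S" "\<And>y. y \<in> S \<Longrightarrow> f y = c"
  shows "f' x = 0"
proof -
  have "((\<lambda>t. x + t *\<^sub>R b) \<longlongrightarrow> x + 0 *\<^sub>R b) (nhds 0)"
    by (intro tendsto_intros filterlim_ident)
  then have "\<forall>\<^sub>F t in nhds 0. x + t *\<^sub>R b \<in> S"
    using assms(2,3) by (intro topological_tendstoD) auto
  then have ev: "\<forall>\<^sub>F t in nhds 0. f (x + t *\<^sub>R b) = c"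
    by (rule eventually_mono) (rule assms(4))
  have "((\<lambda>t. f (x + t *\<^sub>R b)) has_vector_derivative f' x) (at 0)"
    using assms(1) by (simp add: has_pd_def)
  moreover have "((\<lambda>t. f (x + t *\<^sub>R b)) has_vector_derivative 0) (at 0)"
    by (subst has_vector_derivative_cong_ev[where g="\<lambda>_. c"])
      (use ev eventually_nhds_x_imp_x[OF ev] in auto)
  ultimately show ?thesis by (rule vector_derivative_unique_at)
qed

lemma has_pd_support:
  assumes "has_pd f f' b" "\<And>x. norm x > r \<Longrightarrow> f x = 0" "norm x > r"
  shows "f' x = 0"
proof (rule has_pd_locally_const[OF assms(1)])
  show "open {x :: 'a. norm x > r}" by (intro open_Collect_less continuous_intros)
qed (use assms in auto)

lemma test_funsD:
  assumes "f \<in> test_funs"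
  shows test_funs_smooth: "smooth_fun f"
    and test_funs_continuous: "continuous_on UNIV f"
    and test_funs_has_pd: "b \<in> Basis \<Longrightarrow> has_pd f (pd b f) b"
  using assms smooth_fun_continuous smooth_fun_has_pd unfolding test_funs_iff by blast+

lemma test_funs_support:
  assumes "f \<in> test_funs"
  obtains r where "r > 0" "\<And>x. norm x > r \<Longrightarrow> f x = 0"
proof -
  obtain r where "\<forall>x. norm x > r \<longrightarrow> f x = 0" using assms unfolding test_funs_iff by blast
  then show ?thesis by (intro that[of "max r 1"]) auto
qed

lemma test_funs_pd:
  assumes "f \<in> test_funs" "b \<in> Basis"
  shows "pd b f \<in> test_funs"
proof -
  obtain r where "\<And>x. norm x > r \<Longrightarrow> f x = 0" "smooth_fun f"
    using assms(1) unfolding test_funs_iff by blast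
  then have "\<forall>x. norm x > r \<longrightarrow> pd b f x = 0"
    using has_pd_support[OF smooth_fun_has_pd[OF _ assms(2)]] by blast
  then show ?thesis
    using smooth_fun_pd[OF \<open>smooth_fun f\<close> assms(2)] unfolding test_funs_iff by blast
qed

lemma test_funs_mult:
  assumes "f \<in> test_funs" "smooth_fun g"
  shows "(\<lambda>x. f x * g x) \<in> test_funs" "(\<lambda>x. g x * f x) \<in> test_funs"
  using assms smooth_fun_mult[of f g] smooth_fun_mult[of g f]
  unfolding test_funs_iff by (metis mem_Collect_eq mult_zero_left mult_zero_right)+

lemma test_funs_cmult: "f \<in> test_funs \<Longrightarrow> (\<lambda>x. c * f x) \<in> test_funs"
  using test_funs_mult(2)[OF _ smooth_fun_const] by blast

lemma test_funs_add:
  assumes "f \<in> test_funs" "g \<in> test_funs"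
  shows "(\<lambda>x. f x + g x) \<in> test_funs"
proof -
  obtain r s where "\<And>x. norm x > r \<Longrightarrow> f x = 0" "\<And>x. norm x > s \<Longrightarrow> g x = 0"
    using assms unfolding test_funs_iff by blast
  then have "\<forall>x. norm x > max r s \<longrightarrow> f x + g x = 0" by auto
  then show ?thesis using assms smooth_fun_add unfolding test_funs_iff by blast
qed

lemma test_funs_diff:
  assumes "f \<in> test_funs" "g \<in> test_funs"
  shows "(\<lambda>x. f x - g x) \<in> test_funs"
  using test_funs_add[OF assms(1) test_funs_cmult[OF assms(2), of "-1"]] by simp

lemma test_funs_reflect:
  assumes "f \<in> test_funs"
  shows "(\<lambda>y. f (a - y)) \<in> test_funs"
proof -
  obtain r where r: "\<And>x. norm x > r \<Longrightarrow> f x = 0" using assms unfolding test_funs_iff by blast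
  have "f (a - y) = 0" if "norm y > r + norm a" for y
    using that norm_triangle_ineq2[of y a] by (intro r) (simp add: norm_minus_commute)
  then show ?thesis
    using smooth_fun_reflect[OF test_funs_smooth[OF assms]] unfolding test_funs_iff by blast
qed

section \<open>Linearity, reflection and support of the Laplacian\<close>

lemma pd_cmult: "smooth_fun f \<Longrightarrow> b \<in> Basis \<Longrightarrow> pd b (\<lambda>x. c * f x) = (\<lambda>x. c * pd b f x)"
  by (rule has_pd_imp_pd[OF has_pd_cmult[OF smooth_fun_has_pd]])

lemma pd_add:
  "smooth_fun f \<Longrightarrow> smooth_fun g \<Longrightarrow> b \<in> Basis \<Longrightarrow> pd b (\<lambda>x. f x + g x) = (\<lambda>x. pd b f x + pd b g x)"
  by (rule has_pd_imp_pd[OF has_pd_add[OF smooth_fun_has_pd smooth_fun_has_pd]])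

lemma pd_mult:
  "smooth_fun f \<Longrightarrow> smooth_fun g \<Longrightarrow> b \<in> Basis \<Longrightarrow>
    pd b (\<lambda>x. f x * g x) = (\<lambda>x. f x * pd b g x + pd b f x * g x)"
  by (rule has_pd_imp_pd[OF has_pd_mult[OF smooth_fun_has_pd smooth_fun_has_pd]])

lemma laplacian_cmult:
  assumes "smooth_fun f"
  shows "laplacian (\<lambda>x. c * f x) = (\<lambda>x. c * laplacian f x)"
proof -
  have "pd b (pd b (\<lambda>x. c * f x)) = (\<lambda>x. c * pd b (pd b f) x)" if b: "b \<in> Basis" for b
    using b by (simp add: pd_cmult smooth_fun_pd assms)
  then show ?thesis by (auto simp: laplacian_eq sum_distrib_left)
qed

lemma laplacian_add:
  assumes "smooth_fun f" "smooth_fun g"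
  shows "laplacian (\<lambda>x. f x + g x) = (\<lambda>x. laplacian f x + laplacian g x)"
proof -
  have "pd b (pd b (\<lambda>x. f x + g x)) = (\<lambda>x. pd b (pd b f) x + pd b (pd b g) x)" if b: "b \<in> Basis" for b
    using b by (simp add: pd_add smooth_fun_pd assms)
  then show ?thesis by (auto simp: laplacian_eq sum.distrib)
qed

lemma laplacian_reflect:
  assumes "smooth_fun f"
  shows "laplacian (\<lambda>y. f (a - y)) = (\<lambda>y. laplacian f (a - y))"
proof -
  have "pd b (pd b (\<lambda>y. f (a - y))) = (\<lambda>y. pd b (pd b f) (a - y))" if b: "b \<in> Basis" for b
  proof -
    have "has_pd (\<lambda>y. - pd b f (a - y)) (\<lambda>y. - (- pd b (pd b f) (a - y))) b"
      by (intro has_pd_uminus has_pd_reflect smooth_fun_has_pd smooth_fun_pd assms b)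
    then show ?thesis
      by (simp add: has_pd_imp_pd[OF has_pd_reflect[OF smooth_fun_has_pd[OF assms b]]] has_pd_imp_pd)
  qed
  then show ?thesis by (auto simp: laplacian_eq)
qed

lemma continuous_on_laplacian:
  assumes "smooth_fun f"
  shows "continuous_on UNIV (laplacian f)"
  unfolding laplacian_eq
  by (intro continuous_intros smooth_fun_continuous smooth_fun_pd assms)

lemma laplacian_support:
  assumes "smooth_fun f" "\<And>x. norm x > r \<Longrightarrow> f x = 0" "norm x > r"
  shows "laplacian f x = 0"
proof -
  have "pd b (pd b f) x = 0" if b: "b \<in> Basis" for b
    by (rule has_pd_support[OF smooth_fun_has_pd[OF smooth_fun_pd[OF assms(1) b] b] _ assms(3)])
      (rule has_pd_support[OF smooth_fun_has_pd[OF assms(1) b] assms(2)])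
  then show ?thesis by (simp add: laplacian_eq)
qed

subsection \<open>Existence of bump functions\<close>

text \<open>The polynomial factor makes the family closed under differentiation. With s = 1/t, the
  derivative of q(s) exp(-s) in t is s^2 (q - q')(s) exp(-s), which explains the polynomial
  \<open>[:0, 0, 1:] * (q - pderiv q)\<close> below.\<close>

definition flat_exp :: "real poly \<Rightarrow> real \<Rightarrow> real" where
  "flat_exp q t = (if t > 0 then poly q (1 / t) * exp (- 1 / t) else 0)"

lemma flat_exp_tendsto_0: "((\<lambda>t. poly q (1 / t) * exp (- 1 / t)) \<longlongrightarrow> 0) (at_right (0::real))"
proof -
  have *: "((\<lambda>s. poly q s * exp (- s)) \<longlongrightarrow> 0) at_top" for q :: "real poly"
  proof -
    have "((\<lambda>s. \<Sum>i\<le>degree q. coeff q i * (s ^ i * exp (- s))) \<longlongrightarrow> (\<Sum>i\<le>degree q. coeff q i * 0)) at_top"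
      by (intro tendsto_sum tendsto_mult tendsto_const)
        (use tendsto_power_div_exp_0 in \<open>simp add: exp_minus divide_inverse\<close>)
    then show ?thesis by (simp add: poly_altdef sum_distrib_right mult.assoc)
  qed
  show ?thesis
    using filterlim_compose[OF * filterlim_inverse_at_top_right] by (simp add: divide_inverse)
qed

lemma flat_exp_deriv:
  "(flat_exp q has_real_derivative flat_exp ([:0, 0, 1:] * (q - pderiv q)) t) (at t)"
proof -
  consider "t > 0" | "t < 0" | "t = 0" by linarith
  then show ?thesis
  proof cases
    case 1
    have "((\<lambda>t. poly q (1 / t) * exp (- 1 / t)) has_real_derivative
        flat_exp ([:0, 0, 1:] * (q - pderiv q)) t) (at t)"
      using 1 unfolding flat_exp_def
      by (auto intro!: derivative_eq_intros DERIV_chain2[OF poly_DERIV] simp: field_simps power2_eq_square)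
    then show ?thesis
    proof (rule has_field_derivative_transform_within_open)
      show "open {0::real<..}" by simp
    qed (use 1 in \<open>auto simp: flat_exp_def\<close>)
  next
    case 2
    have "((\<lambda>t. 0) has_real_derivative flat_exp ([:0, 0, 1:] * (q - pderiv q)) t) (at t)"
      using 2 by (auto simp: flat_exp_def)
    then show ?thesis
    proof (rule has_field_derivative_transform_within_open)
      show "open {..<0::real}" by simp
    qed (use 2 in \<open>auto simp: flat_exp_def\<close>)
  next
    case 3
    \<comment> \<open>For h > 0 the difference quotient at 0 belongs to the same family, with the
      polynomial \<open>[:0, 1:] * q\<close>, so its limit is already known.\<close>
    have "((\<lambda>h. flat_exp q h / h) \<longlongrightarrow> 0) (at_right 0)"
      by (rule Lim_transform_eventually[OF flat_exp_tendsto_0[of "[:0, 1:] * q"]])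
        (auto simp: flat_exp_def eventually_at_filter field_simps)
    moreover have "((\<lambda>h. flat_exp q h / h) \<longlongrightarrow> 0) (at_left 0)"
      by (rule Lim_transform_eventually[OF tendsto_const])
        (auto simp: flat_exp_def eventually_at_filter)
    ultimately have "((\<lambda>h. flat_exp q h / h) \<longlongrightarrow> 0) (at 0)"
      by (simp add: filterlim_at_split)
    then show ?thesis
      using 3 by (simp add: has_field_derivative_iff flat_exp_def)
  qed
qed

lemma continuous_flat_exp: "continuous_on UNIV (flat_exp q)"
  using flat_exp_deriv by (metis DERIV_isCont continuous_at_imp_continuous_on)

text \<open>The squared distance, unlike the distance, is smooth at the centre
  \<open>a\<close>.\<close>

definition bump :: "'a::euclidean_space \<Rightarrow> real \<Rightarrow> 'a \<Rightarrow> real" where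
  "bump a r x = flat_exp 1 (r\<^sup>2 - (norm (x - a))\<^sup>2)"

lemma smooth_bump: "smooth_fun (\<lambda>x. complex_of_real (bump a r x))"
proof -
  let ?F = "\<lambda>q x. complex_of_real (flat_exp q (r\<^sup>2 - (norm (x - a))\<^sup>2))"
  let ?c = "\<lambda>b x. complex_of_real ((x - a) \<bullet> b)"
  \<comment> \<open>Differentiating the squared distance releases a coordinate of
    \<open>x - a\<close>, so the coordinates have to be generators too; their own derivatives are
    constants.\<close>
  let ?G = "range ?F \<union> range ?c"
  have dF: "has_pd (?F q) (\<lambda>x. (- 2) * (?c b x * ?F ([:0, 0, 1:] * (q - pderiv q)) x)) b" for q b
    unfolding has_pd_def
  proof
    fix x
    have "((\<lambda>t. (norm (x + t *\<^sub>R b - a))\<^sup>2) has_real_derivative 2 * ((x - a) \<bullet> b)) (at 0)"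
      unfolding power2_norm_eq_inner
      by (auto intro!: derivative_eq_intros simp: inner_commute has_real_derivative_iff_has_vector_derivative algebra_simps)
    then have "((\<lambda>t. r\<^sup>2 - (norm (x + t *\<^sub>R b - a))\<^sup>2) has_real_derivative - (2 * ((x - a) \<bullet> b))) (at 0)"
      using DERIV_diff[OF DERIV_const] by fastforce
    from has_vector_derivative_of_real[OF DERIV_chain2[OF flat_exp_deriv this]]
    show "((\<lambda>t. ?F q (x + t *\<^sub>R b)) has_vector_derivative
        (- 2) * (?c b x * ?F ([:0, 0, 1:] * (q - pderiv q)) x)) (at 0)"
      by (simp add: ac_simps del: inner_diff_left)
  qed
  have dc: "has_pd (?c b') (\<lambda>x. complex_of_real (b \<bullet> b')) b" for b b'
    unfolding has_pd_def
  proof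
    fix x
    have "((\<lambda>t. (x + t *\<^sub>R b - a) \<bullet> b') has_real_derivative (b \<bullet> b')) (at 0)"
      unfolding inner_diff_left inner_add_left inner_scaleR_left
      by (auto intro!: derivative_eq_intros)
    from has_vector_derivative_of_real[OF this]
    show "((\<lambda>t. ?c b' (x + t *\<^sub>R b)) has_vector_derivative complex_of_real (b \<bullet> b')) (at 0)" .
  qed
  show ?thesis
  proof (rule smooth_fun_alg[of _ ?G])
    show "(\<lambda>x. complex_of_real (bump a r x)) \<in> fun_alg ?G"
      by (rule fun_alg.gen) (auto simp: bump_def)
    show "continuous_on UNIV g" if "g \<in> ?G" for g
      using that
      by (auto intro!: continuous_intros continuous_on_compose2[OF continuous_flat_exp])
    show "\<exists>g'\<in>fun_alg ?G. has_pd g g' b" if "g \<in> ?G" "b \<in> Basis" for g b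
      using that(1)
    proof
      assume "g \<in> range ?F"
      then obtain q where g: "g = ?F q" by auto
      show ?thesis unfolding g
        by (rule bexI, rule dF, intro fun_alg.const fun_alg.mult) (auto intro: fun_alg.gen)
    next
      assume "g \<in> range ?c"
      then obtain b' where g: "g = ?c b'" by auto
      show ?thesis unfolding g
        by (rule bexI, rule dc) (rule fun_alg.const)
    qed
  qed
qed

lemma bump_nonneg: "bump a r x \<ge> 0"
  by (simp add: bump_def flat_exp_def)

lemma bump_pos_iff: "r > 0 \<Longrightarrow> bump a r x > 0 \<longleftrightarrow> norm (x - a) < r"
  using power_strict_mono[of "norm (x - a)" r 2] power2_less_imp_less[of "norm (x - a)" r]
  by (auto simp: bump_def flat_exp_def)

lemma bump_eq_0_iff: "r > 0 \<Longrightarrow> bump a r x = 0 \<longleftrightarrow> norm (x - a) \<ge> r"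
  using bump_pos_iff[of r a x] bump_nonneg[of a r x] by linarith

lemma test_funs_bump:
  assumes "r > 0"
  shows "(\<lambda>x. complex_of_real (bump a r x)) \<in> test_funs"
proof -
  have "bump a r x = 0" if "norm x > r + norm a" for x
    using that norm_triangle_ineq2[of x a] assms by (simp add: bump_eq_0_iff)
  then have "\<forall>x. norm x > r + norm a \<longrightarrow> complex_of_real (bump a r x) = 0" by simp
  then show ?thesis using smooth_bump unfolding test_funs_iff by blast
qed

section \<open>Integration by parts and convolution\<close>

lemma continuous_imp_borel_measurable_lborel:
  "continuous_on UNIV f \<Longrightarrow> f \<in> borel_measurable lborel"
  for f :: "'a::euclidean_space \<Rightarrow> 'b::topological_space"
  by (simp add: borel_measurable_continuous_onI)

lemma integrable_bounded_support:
  fixes f :: "'a::euclidean_space \<Rightarrow> 'b::{banach, second_countable_topology}"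
  assumes "continuous_on UNIV f" "\<And>x. norm x > r \<Longrightarrow> f x = 0"
  shows "integrable lborel f"
proof -
  have "integrable lborel (\<lambda>x. indicator (cball 0 r) x *\<^sub>R f x)"
    by (rule borel_integrable_compact) (auto intro: continuous_on_subset[OF assms(1)])
  moreover have "(\<lambda>x. indicator (cball 0 r) x *\<^sub>R f x) = f"
    using assms(2) by (auto simp: indicator_def fun_eq_iff)
  ultimately show ?thesis by simp
qed

lemma bounded_support_imp_bounded:
  fixes f :: "'a::euclidean_space \<Rightarrow> 'b::real_normed_vector"
  assumes "continuous_on UNIV f" "\<And>x. norm x > r \<Longrightarrow> f x = 0"
  obtains B where "B \<ge> 0" "\<And>x. norm (f x) \<le> B"
proof -
  have "bounded (f ` cball 0 r)"
    by (intro compact_imp_bounded compact_continuous_image continuous_on_subset[OF assms(1)]) auto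
  then obtain B where B: "\<And>x. norm x \<le> r \<Longrightarrow> norm (f x) \<le> B"
    unfolding bounded_iff by (metis image_eqI mem_cball_0)
  have "norm (f x) \<le> max B 0" for x
    using B[of x] assms(2)[of x] by (cases "norm x \<le> r") auto
  then show ?thesis by (intro that[of "max B 0"]) auto
qed

section \<open>Differentiation under the integral sign\<close>

lemma has_vector_derivative_at_0_iff:
  fixes F :: "real \<Rightarrow> complex"
  shows "(F has_vector_derivative D) (at 0) \<longleftrightarrow> ((\<lambda>h. (F h - F 0) /\<^sub>R h) \<longlongrightarrow> D) (at 0)"
proof -
  have "(F has_vector_derivative D) (at 0) \<longleftrightarrow> ((\<lambda>h. norm (F h - F 0 - h *\<^sub>R D) / norm h) \<longlongrightarrow> 0) (at 0)"
    by (simp add: has_vector_derivative_def has_derivative_at bounded_linear_scaleR_left)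
  also have "\<dots> \<longleftrightarrow> ((\<lambda>h. norm ((F h - F 0) /\<^sub>R h - D)) \<longlongrightarrow> 0) (at 0)"
  proof (rule tendsto_cong)
    have "norm (F h - F 0 - h *\<^sub>R D) / norm h = norm ((F h - F 0) /\<^sub>R h - D)" if "h \<noteq> 0" for h
    proof -
      have "(F h - F 0) /\<^sub>R h - D = (F h - F 0 - h *\<^sub>R D) /\<^sub>R h"
        using that by (simp add: scaleR_diff_right)
      then show ?thesis by (simp add: divide_inverse abs_inverse)
    qed
    then show "\<forall>\<^sub>F h in at 0. norm (F h - F 0 - h *\<^sub>R D) / norm h = norm ((F h - F 0) /\<^sub>R h - D)"
      by (auto simp: eventually_at_filter)
  qed
  also have "\<dots> \<longleftrightarrow> ((\<lambda>h. (F h - F 0) /\<^sub>R h) \<longlongrightarrow> D) (at 0)"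
    by (simp add: tendsto_norm_zero_iff LIM_zero_iff)
  finally show ?thesis .
qed

text \<open>The mean value inequality turns the bound on \<open>K'\<close> into the majorant
  \<open>g\<close> for all difference quotients with step below 1, and dominated convergence along
  an arbitrary null sequence of steps does the rest.\<close>

lemma has_vector_derivative_lebesgue_integral:
  fixes K :: "'b \<Rightarrow> real \<Rightarrow> complex"
  assumes int: "\<And>t. \<bar>t\<bar> < 1 \<Longrightarrow> integrable M (\<lambda>x. K x t)"
    and der: "\<And>x t. \<bar>t\<bar> < 1 \<Longrightarrow> (K x has_vector_derivative K' x t) (at t)"
    and bd: "\<And>x t. \<bar>t\<bar> < 1 \<Longrightarrow> norm (K' x t) \<le> g x"
    and g: "integrable M g" and meas: "(\<lambda>x. K' x 0) \<in> borel_measurable M"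
  shows "((\<lambda>t. \<integral>x. K x t \<partial>M) has_vector_derivative (\<integral>x. K' x 0 \<partial>M)) (at 0)"
  unfolding has_vector_derivative_at_0_iff tendsto_at_iff_sequentially
proof (intro allI impI)
  fix X :: "nat \<Rightarrow> real"
  assume X: "\<forall>i. X i \<in> UNIV - {0}" and lim: "X \<longlonglongrightarrow> 0"
  have lip: "norm (K x t - K x 0) \<le> g x * \<bar>t\<bar>" if "\<bar>t\<bar> < 1" for x t
  proof -
    have "norm (K x t - K x 0) \<le> g x * norm (t - 0)"
    proof (rule differentiable_bound[of "{-1<..<1}" "K x" "\<lambda>t h. h *\<^sub>R K' x t"])
      show "(K x has_derivative (\<lambda>h. h *\<^sub>R K' x s)) (at s within {-1<..<1})" if "s \<in> {-1<..<1}" for s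
        using der[of s x] that by (auto simp: has_vector_derivative_def intro: has_derivative_at_withinI)
      show "onorm (\<lambda>h. h *\<^sub>R K' x s) \<le> g x" if "s \<in> {-1<..<1}" for s
        using bd[of s x] that by (subst onorm_scaleR_left) (auto simp: onorm_id bounded_linear_ident)
    qed (use that in auto)
    then show ?thesis by simp
  qed
  have "\<forall>\<^sub>F i in sequentially. \<bar>X i\<bar> < 1"
    using tendsto_rabs[OF lim] by (intro order_tendstoD) auto
  then obtain N where N: "\<And>i. i \<ge> N \<Longrightarrow> \<bar>X i\<bar> < 1"
    by (auto simp: eventually_sequentially)
  \<comment> \<open>Dropping the first \<open>N\<close> steps makes the majorant valid for every
    index; \<open>LIMSEQ_offset\<close> restores them at the end.\<close>
  define Y where "Y i = X (i + N)" for i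
  have Y: "\<bar>Y i\<bar> < 1" "Y i \<noteq> 0" for i using N X by (auto simp: Y_def)
  have limY: "Y \<longlonglongrightarrow> 0" unfolding Y_def by (rule LIMSEQ_ignore_initial_segment[OF lim])
  have "(\<lambda>i. \<integral>x. (K x (Y i) - K x 0) /\<^sub>R Y i \<partial>M) \<longlonglongrightarrow> (\<integral>x. K' x 0 \<partial>M)"
  proof (rule integral_dominated_convergence[where w=g])
    show "AE x in M. (\<lambda>i. (K x (Y i) - K x 0) /\<^sub>R Y i) \<longlonglongrightarrow> K' x 0"
    proof (rule AE_I2)
      fix x
      have "((\<lambda>h. (K x h - K x 0) /\<^sub>R h) \<longlongrightarrow> K' x 0) (at 0)"
        using der[of 0 x] by (simp add: has_vector_derivative_at_0_iff)
      then show "(\<lambda>i. (K x (Y i) - K x 0) /\<^sub>R Y i) \<longlonglongrightarrow> K' x 0"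
        unfolding tendsto_at_iff_sequentially o_def using Y(2) limY by auto
    qed
    show "AE x in M. norm ((K x (Y i) - K x 0) /\<^sub>R Y i) \<le> g x" for i
    proof (rule AE_I2)
      fix x
      show "norm ((K x (Y i) - K x 0) /\<^sub>R Y i) \<le> g x"
        using lip[OF Y(1), of x i] Y(2)[of i]
        by (simp add: divide_inverse[symmetric] mult.commute[of "inverse _"] pos_divide_le_eq)
    qed
    show "(\<lambda>x. (K x (Y i) - K x 0) /\<^sub>R Y i) \<in> borel_measurable M" for i
      using int[OF Y(1)] int[of 0] by (intro borel_measurable_scaleR borel_measurable_diff) auto
  qed (use g meas in auto)
  moreover have "(\<integral>x. (K x (Y i) - K x 0) /\<^sub>R Y i \<partial>M) = ((\<integral>x. K x (Y i) \<partial>M) - (\<integral>x. K x 0 \<partial>M)) /\<^sub>R Y i" for i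
    using int[OF Y(1)] int[of 0] by simp
  ultimately have "(\<lambda>i. ((\<integral>x. K x (Y i) \<partial>M) - (\<integral>x. K x 0 \<partial>M)) /\<^sub>R Y i) \<longlonglongrightarrow> (\<integral>x. K' x 0 \<partial>M)"
    by (simp only:)
  then show "((\<lambda>h. ((\<integral>x. K x h \<partial>M) - (\<integral>x. K x 0 \<partial>M)) /\<^sub>R h) \<circ> X) \<longlonglongrightarrow> (\<integral>x. K' x 0 \<partial>M)"
    unfolding Y_def o_def by (rule LIMSEQ_offset)
qed

lemma lborel_integral_translate:
  fixes f :: "'a::euclidean_space \<Rightarrow> 'b::{banach, second_countable_topology}"
  assumes "f \<in> borel_measurable borel"
  shows "(\<integral>x. f (x + c) \<partial>lborel) = (\<integral>x. f x \<partial>lborel)"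
proof -
  have "(\<integral>x. f x \<partial>lborel) = (\<integral>x. f x \<partial>distr lborel borel ((+) c))"
    by (simp add: lborel_distr_plus)
  also have "\<dots> = (\<integral>x. f (c + x) \<partial>lborel)"
    by (rule integral_distr) (use assms in auto)
  finally show ?thesis by (simp add: add.commute)
qed

text \<open>The integral of a translate is constant; differentiate it under the integral sign.\<close>
lemma integral_pd_eq_0:
  assumes F: "has_pd F F' b" "continuous_on UNIV F" "continuous_on UNIV F'"
    and r: "\<And>x. norm x > r \<Longrightarrow> F x = 0"
  shows "(\<integral>x. F' x \<partial>lborel) = 0"
proof -
  have r': "norm x > r \<Longrightarrow> F' x = 0" for x using has_pd_support[OF F(1) r] by blast
  obtain B where B: "B \<ge> 0" "\<And>x. norm (F' x) \<le> B"
    using bounded_support_imp_bounded[OF F(3) r'] by metis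
  have cont: "continuous_on UNIV (\<lambda>x. G (x + c))" if "continuous_on UNIV G" for G :: "'a \<Rightarrow> complex" and c
    by (rule continuous_on_compose2[OF that]) (auto intro!: continuous_intros)
  have nt: "norm (x + t *\<^sub>R b) > r" if "norm x > r + norm b" "\<bar>t\<bar> < 1" for x t
  proof -
    have "norm (t *\<^sub>R b) \<le> norm b" using that(2) by (simp add: mult_left_le_one_le)
    then show ?thesis using norm_diff_ineq[of x "t *\<^sub>R b"] that(1) by linarith
  qed
  have "((\<lambda>t. \<integral>x. F (x + t *\<^sub>R b) \<partial>lborel) has_vector_derivative (\<integral>x. F' (x + 0 *\<^sub>R b) \<partial>lborel)) (at 0)"
  proof (rule has_vector_derivative_lebesgue_integral[where g="\<lambda>x. B * indicat_real (cball 0 (r + norm b)) x"])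
    show "integrable lborel (\<lambda>x. F (x + t *\<^sub>R b))" if "\<bar>t\<bar> < 1" for t
      by (rule integrable_bounded_support[OF cont[OF F(2)], where r="r + norm b"]) (use r nt that in auto)
    show "norm (F' (x + t *\<^sub>R b)) \<le> B * indicat_real (cball 0 (r + norm b)) x" if "\<bar>t\<bar> < 1" for x t
      using r'[OF nt[OF _ that], of x] B by (auto simp: indicator_def not_le)
    show "(\<lambda>x. F' (x + 0 *\<^sub>R b)) \<in> borel_measurable lborel"
      using continuous_imp_borel_measurable_lborel[OF F(3)] by simp
    show "integrable lborel (\<lambda>x. B * indicat_real (cball 0 (r + norm b)) x)"
      by (intro integrable_mult_right integrable_real_indicator) (use emeasure_bounded_finite[OF bounded_cball, of 0 "r + norm b"] in auto)
  qed (use has_pd_at[OF F(1)] in auto)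
  moreover have "(\<integral>x. F (x + t *\<^sub>R b) \<partial>lborel) = (\<integral>x. F x \<partial>lborel)" for t
    using F(2) by (intro lborel_integral_translate borel_measurable_continuous_onI)
  ultimately have "((\<lambda>t. \<integral>x. F x \<partial>lborel) has_vector_derivative (\<integral>x. F' x \<partial>lborel)) (at 0)"
    by simp
  moreover have "((\<lambda>t::real. \<integral>x. F x \<partial>lborel) has_vector_derivative 0) (at 0)"
    by simp
  ultimately show ?thesis by (rule vector_derivative_unique_at)
qed

section \<open>Convolution of a locally integrable function with a test function\<close>

definition locally_integrable :: "('a::euclidean_space \<Rightarrow> complex) \<Rightarrow> bool" where
  "locally_integrable f \<longleftrightarrow> f \<in> borel_measurable lborel \<and>
    (\<forall>r. integrable lborel (\<lambda>x. indicat_real (cball 0 r) x * norm (f x)))"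

definition conv :: "('a::euclidean_space \<Rightarrow> complex) \<Rightarrow> ('a \<Rightarrow> complex) \<Rightarrow> ('a \<Rightarrow> complex)" where
  "conv f k x = (\<integral>y. f y * k (x - y) \<partial>lborel)"

lemma conv_bound_integrable:
  "locally_integrable f \<Longrightarrow> integrable lborel (\<lambda>y. B * (indicat_real (cball 0 R) y * norm (f y)))"
  unfolding locally_integrable_def by auto

context
  fixes f :: "'a::euclidean_space \<Rightarrow> complex" and k :: "'a \<Rightarrow> complex" and r :: real
  assumes f: "locally_integrable f"
    and k: "continuous_on UNIV k" "\<And>x. norm x > r \<Longrightarrow> k x = 0"
begin

lemma measurable_conv_integrand: "(\<lambda>y. f y * k (x - y)) \<in> borel_measurable lborel"
proof -
  have "continuous_on UNIV (\<lambda>y. k (x - y))"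
    by (rule continuous_on_compose2[OF k(1)]) (auto intro!: continuous_intros)
  then show ?thesis
    using f continuous_imp_borel_measurable_lborel unfolding locally_integrable_def
    by (intro borel_measurable_times) blast+
qed

text \<open>As long as \<open>x\<close> stays in the ball of radius \<open>R\<close>, the kernel
  only sees \<open>y\<close> in the ball of radius \<open>R + r\<close>. This one integrable
  majorant serves integrability, continuity and differentiation of the convolution.\<close>

lemma conv_integrand_bound:
  assumes "\<And>x. norm (k x) \<le> B" "norm x \<le> R"
  shows "norm (f y * k (x - y)) \<le> B * (indicat_real (cball 0 (R + r)) y * norm (f y))"
proof (cases "norm y \<le> R + r")
  case True
  then show ?thesis using assms(1)[of "x - y"] by (simp add: norm_mult mult.commute[of B] mult_left_mono)
next
  case False
  then have "norm (x - y) > r"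
    using norm_triangle_ineq2[of y x] assms(2) by (simp add: norm_minus_commute)
  then show ?thesis using k(2) False by simp
qed

lemma integrable_conv_integrand: "integrable lborel (\<lambda>y. f y * k (x - y))"
proof -
  obtain B where B: "B \<ge> 0" "\<And>x. norm (k x) \<le> B"
    using bounded_support_imp_bounded[OF k] by metis
  show ?thesis
    by (rule Bochner_Integration.integrable_bound[OF conv_bound_integrable[OF f, of B "norm x + r"] measurable_conv_integrand])
      (rule AE_I2, rule order_trans[OF conv_integrand_bound[OF B(2) order_refl]], simp add: abs_mult B(1))
qed

lemma continuous_on_conv: "continuous_on UNIV (conv f k)"
proof -
  obtain B where B: "B \<ge> 0" "\<And>x. norm (k x) \<le> B"
    using bounded_support_imp_bounded[OF k] by metis
  show ?thesis
    unfolding continuous_on_sequentially conv_def o_def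
  proof (intro allI impI ballI, elim conjE)
    fix X :: "nat \<Rightarrow> 'a" and a :: 'a
    assume X: "X \<longlonglongrightarrow> a"
    obtain R where R: "\<And>n. norm (X n) \<le> R"
      using convergent_imp_bounded[OF X] unfolding bounded_iff by auto
    show "(\<lambda>n. \<integral>y. f y * k (X n - y) \<partial>lborel) \<longlonglongrightarrow> (\<integral>y. f y * k (a - y) \<partial>lborel)"
    proof (rule integral_dominated_convergence[OF _ _ conv_bound_integrable[OF f]])
      show "AE y in lborel. (\<lambda>n. f y * k (X n - y)) \<longlonglongrightarrow> f y * k (a - y)"
        by (intro AE_I2 tendsto_mult tendsto_const continuous_on_tendsto_compose[OF k(1)] tendsto_diff X) auto
      show "AE y in lborel. norm (f y * k (X n - y)) \<le> B * (indicat_real (cball 0 (R + r)) y * norm (f y))" for n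
        using conv_integrand_bound[OF B(2) R] by auto
    qed (rule measurable_conv_integrand)+
  qed
qed

end

text \<open>The variable occurs only in the kernel, so every derivative falls on \<open>k\<close>
  and local integrability is all that is asked of \<open>f\<close>.\<close>

lemma has_pd_conv:
  assumes f: "locally_integrable f"
    and k: "has_pd k k' b" "continuous_on UNIV k" "continuous_on UNIV k'" "\<And>x. norm x > r \<Longrightarrow> k x = 0"
  shows "has_pd (conv f k) (conv f k') b"
  unfolding has_pd_def conv_def
proof
  fix x
  have k': "k' x = 0" if "norm x > r" for x
    by (rule has_pd_support[OF k(1)]) (use k(4) that in auto)
  obtain B where B: "B \<ge> 0" "\<And>x. norm (k' x) \<le> B"
    using bounded_support_imp_bounded[OF k(3) k'] by metis
  have "((\<lambda>t. \<integral>y. f y * k (x + t *\<^sub>R b - y) \<partial>lborel) has_vector_derivative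
     (\<integral>y. f y * k' (x + 0 *\<^sub>R b - y) \<partial>lborel)) (at 0)"
  proof (rule has_vector_derivative_lebesgue_integral)
    show "integrable lborel (\<lambda>y. f y * k (x + t *\<^sub>R b - y))" for t
      by (rule integrable_conv_integrand[OF f k(2,4)])
    show "norm (f y * k' (x + t *\<^sub>R b - y)) \<le> B * (indicat_real (cball 0 ((norm x + norm b) + r)) y * norm (f y))"
      if "\<bar>t\<bar> < 1" for y t
    proof (rule conv_integrand_bound[OF f k(3) k' B(2)])
      have "norm (t *\<^sub>R b) \<le> norm b" using that by (simp add: mult_left_le_one_le)
      then show "norm (x + t *\<^sub>R b) \<le> norm x + norm b" using norm_triangle_ineq[of x "t *\<^sub>R b"] by linarith
    qed
    show "integrable lborel (\<lambda>y. B * (indicat_real (cball 0 ((norm x + norm b) + r)) y * norm (f y)))"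
      by (rule conv_bound_integrable[OF f])
    show "(\<lambda>y. f y * k' (x + 0 *\<^sub>R b - y)) \<in> borel_measurable lborel"
      by (rule measurable_conv_integrand[OF f k(3) k'])
    show "((\<lambda>t. f y * k (x + t *\<^sub>R b - y)) has_vector_derivative f y * k' (x + t *\<^sub>R b - y)) (at t)" for y t
      using has_pd_at[OF k(1), of "x - y" t]
      by (intro has_vector_derivative_mult_right) (simp add: algebra_simps)
  qed
  then show "((\<lambda>t. \<integral>y. f y * k (x + t *\<^sub>R b - y) \<partial>lborel) has_vector_derivative
     (\<integral>y. f y * k' (x - y) \<partial>lborel)) (at 0)" by simp
qed

lemma has_pd_conv_test:
  assumes "locally_integrable f" "k \<in> test_funs" "b \<in> Basis"
  shows "has_pd (conv f k) (conv f (pd b k)) b"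
proof -
  obtain r where "\<And>x. norm x > r \<Longrightarrow> k x = 0" using assms(2) unfolding test_funs_iff by blast
  then show ?thesis
    by (rule has_pd_conv[OF assms(1) test_funs_has_pd[OF assms(2,3)] test_funs_continuous[OF assms(2)]
          test_funs_continuous[OF test_funs_pd[OF assms(2,3)]]])
qed

lemma continuous_on_conv_test:
  assumes "locally_integrable f" "k \<in> test_funs"
  shows "continuous_on UNIV (conv f k)"
proof -
  obtain r where "\<And>x. norm x > r \<Longrightarrow> k x = 0" using assms(2) unfolding test_funs_iff by blast
  then show ?thesis by (rule continuous_on_conv[OF assms(1) test_funs_continuous[OF assms(2)]])
qed

lemma smooth_fun_conv:
  assumes "locally_integrable f" "k \<in> test_funs"
  shows "smooth_fun (conv f k)"
proof (rule smooth_fun_coinduct[of _ "conv f ` test_funs"])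
  show "conv f k \<in> conv f ` test_funs" using assms(2) by simp
  show "continuous_on UNIV g" if "g \<in> conv f ` test_funs" for g
    using that continuous_on_conv_test[OF assms(1)] by auto
  show "\<exists>g'\<in>conv f ` test_funs. has_pd g g' b" if "g \<in> conv f ` test_funs" "b \<in> Basis" for g b
    using that has_pd_conv_test[OF assms(1)] test_funs_pd by blast
qed

lemma pd_conv:
  assumes "locally_integrable f" "k \<in> test_funs" "b \<in> Basis"
  shows "pd b (conv f k) = conv f (pd b k)"
  by (rule has_pd_imp_pd[OF has_pd_conv_test[OF assms]])

lemma integrable_conv_test:
  assumes "locally_integrable f" "k \<in> test_funs"
  shows "integrable lborel (\<lambda>y. f y * k (x - y))"
proof -
  obtain r where "\<And>x. norm x > r \<Longrightarrow> k x = 0" using assms(2) unfolding test_funs_iff by blast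
  then show ?thesis by (rule integrable_conv_integrand[OF assms(1) test_funs_continuous[OF assms(2)]])
qed

lemma laplacian_conv:
  assumes "locally_integrable f" "k \<in> test_funs"
  shows "laplacian (conv f k) = conv f (laplacian k)"
proof -
  have "laplacian (conv f k) x = conv f (laplacian k) x" for x
  proof -
    have "laplacian (conv f k) x = (\<Sum>b\<in>Basis. conv f (pd b (pd b k)) x)"
      unfolding laplacian_eq using assms by (intro sum.cong) (auto simp: pd_conv test_funs_pd)
    also have "\<dots> = conv f (laplacian k) x"
      unfolding conv_def laplacian_eq sum_distrib_left
      by (rule Bochner_Integration.integral_sum[symmetric])
        (intro integrable_conv_test test_funs_pd assms)
    finally show ?thesis .
  qed
  then show ?thesis by auto
qed

section \<open>Square-integrable functions\<close>

lemma L2_iff: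
  "f \<in> L2 \<longleftrightarrow> f \<in> borel_measurable lborel \<and> integrable lborel (\<lambda>x. (cmod (f x))\<^sup>2)"
  by (simp add: L2_def)

lemma L2_measurable: "f \<in> L2 \<Longrightarrow> f \<in> borel_measurable lborel"
  by (simp add: L2_def)

lemma L2_integrable: "f \<in> L2 \<Longrightarrow> integrable lborel (\<lambda>x. (cmod (f x))\<^sup>2)"
  by (simp add: L2_def)

lemma L2norm_sq: "(L2norm f)\<^sup>2 = (\<integral>x. (cmod (f x))\<^sup>2 \<partial>lborel)"
  by (simp add: L2norm_def)

lemma L2norm_nonneg [simp]: "L2norm f \<ge> 0"
  by (simp add: L2norm_def)

lemma L2norm_cmult: "L2norm (\<lambda>x. c * f x) = cmod c * L2norm f"
  by (simp add: L2norm_def norm_mult power_mult_distrib real_sqrt_mult)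

lemma L2norm_commute: "L2norm (\<lambda>x. f x - g x) = L2norm (\<lambda>x. g x - f x)"
  by (simp add: L2norm_def norm_minus_commute)

lemma L2_dominated:
  assumes "g \<in> L2" "f \<in> borel_measurable lborel" "\<And>x. cmod (f x) \<le> C * cmod (g x)"
  shows "f \<in> L2"
  unfolding L2_iff
proof
  show "integrable lborel (\<lambda>x. (cmod (f x))\<^sup>2)"
  proof (rule Bochner_Integration.integrable_bound[where f="\<lambda>x. C\<^sup>2 * (cmod (g x))\<^sup>2"])
    show "integrable lborel (\<lambda>x. C\<^sup>2 * (cmod (g x))\<^sup>2)"
      using L2_integrable[OF assms(1)] by auto
    show "AE x in lborel. norm ((cmod (f x))\<^sup>2) \<le> norm (C\<^sup>2 * (cmod (g x))\<^sup>2)"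
      using power_mono[OF assms(3) norm_ge_zero, of _ 2] by (simp add: power_mult_distrib)
  qed (use assms(2) in measurable)
qed (rule assms(2))

lemma L2_cmult: "f \<in> L2 \<Longrightarrow> (\<lambda>x. c * f x) \<in> L2"
  by (rule L2_dominated[where C="cmod c"]) (auto simp: norm_mult dest: L2_measurable)

lemma L2_cnj: "f \<in> L2 \<Longrightarrow> (\<lambda>x. cnj (f x)) \<in> L2"
  unfolding L2_iff by (auto intro!: borel_measurable_continuous_on[where f=cnj] continuous_intros)

lemma L2_add:
  assumes "f \<in> L2" "g \<in> L2"
  shows "(\<lambda>x. f x + g x) \<in> L2"
  unfolding L2_iff
proof
  note [measurable] = L2_measurable[OF assms(1)] L2_measurable[OF assms(2)]
  show "(\<lambda>x. f x + g x) \<in> borel_measurable lborel" by measurable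
  show "integrable lborel (\<lambda>x. (cmod (f x + g x))\<^sup>2)"
  proof (rule Bochner_Integration.integrable_bound[where f="\<lambda>x. 2 * (cmod (f x))\<^sup>2 + 2 * (cmod (g x))\<^sup>2"])
    show "integrable lborel (\<lambda>x. 2 * (cmod (f x))\<^sup>2 + 2 * (cmod (g x))\<^sup>2)"
      using L2_integrable[OF assms(1)] L2_integrable[OF assms(2)] by auto
    have "(cmod (a + b))\<^sup>2 \<le> 2 * (cmod a)\<^sup>2 + 2 * (cmod b)\<^sup>2" for a b
      using power_mono[OF norm_triangle_ineq[of a b] norm_ge_zero, of 2]
        zero_le_power2[of "cmod a - cmod b"] by (simp add: power2_eq_square algebra_simps)
    then show "AE x in lborel. norm ((cmod (f x + g x))\<^sup>2) \<le> norm (2 * (cmod (f x))\<^sup>2 + 2 * (cmod (g x))\<^sup>2)"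
      by simp
  qed measurable
qed

lemma L2_diff: "f \<in> L2 \<Longrightarrow> g \<in> L2 \<Longrightarrow> (\<lambda>x. f x - g x) \<in> L2"
  using L2_add[of f "\<lambda>x. (-1) * g x"] L2_cmult[of g "-1"] by simp

lemma L2_mult_integrable:
  assumes "f \<in> L2" "g \<in> L2"
  shows "integrable lborel (\<lambda>x. cmod (f x) * cmod (g x))" "integrable lborel (\<lambda>x. f x * g x)"
proof -
  note [measurable] = L2_measurable[OF assms(1)] L2_measurable[OF assms(2)]
  have i: "integrable lborel (\<lambda>x. (cmod (f x))\<^sup>2 + (cmod (g x))\<^sup>2)"
    using L2_integrable[OF assms(1)] L2_integrable[OF assms(2)] by auto
  have le: "cmod a * cmod b \<le> (cmod a)\<^sup>2 + (cmod b)\<^sup>2" for a b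
  proof -
    have "0 \<le> cmod a * cmod b" by simp
    then show ?thesis using sum_squares_bound[of "cmod a" "cmod b"] by linarith
  qed
  show "integrable lborel (\<lambda>x. cmod (f x) * cmod (g x))" "integrable lborel (\<lambda>x. f x * g x)"
    by (rule Bochner_Integration.integrable_bound[OF i], use le in \<open>auto simp: norm_mult\<close>)+
qed

lemma L2_Cauchy_Schwarz:
  assumes "f \<in> L2" "g \<in> L2"
  shows "(\<integral>x. cmod (f x) * cmod (g x) \<partial>lborel) \<le> L2norm f * L2norm g"
proof -
  define F G I where "F = (\<integral>x. (cmod (f x))\<^sup>2 \<partial>lborel)" and "G = (\<integral>x. (cmod (g x))\<^sup>2 \<partial>lborel)"
    and "I = (\<integral>x. cmod (f x) * cmod (g x) \<partial>lborel)"
  note int = L2_integrable[OF assms(1)] L2_integrable[OF assms(2)] L2_mult_integrable(1)[OF assms]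
  have q: "0 \<le> t\<^sup>2 * F - 2 * t * I + G" for t
  proof -
    have "0 \<le> (\<integral>x. (t * cmod (f x) - cmod (g x))\<^sup>2 \<partial>lborel)"
      by simp
    also have "\<dots> = (\<integral>x. t\<^sup>2 * (cmod (f x))\<^sup>2 - 2 * t * (cmod (f x) * cmod (g x)) + (cmod (g x))\<^sup>2 \<partial>lborel)"
      by (rule Bochner_Integration.integral_cong) (auto simp: power2_eq_square algebra_simps)
    also have "\<dots> = t\<^sup>2 * F - 2 * t * I + G"
      using int by (simp add: F_def G_def I_def)
    finally show ?thesis .
  qed
  have FG: "F \<ge> 0" "G \<ge> 0" "I \<ge> 0" by (auto simp: F_def G_def I_def)
  have "I\<^sup>2 \<le> F * G"
  \<comment> \<open>For F > 0 the quadratic in \<open>t\<close> is evaluated at its minimiser I / F.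
    For F = 0 it is affine, and a positive slope is refuted by t = (G + 1) / I, where the value
    would be - G - 2.\<close>
  proof (cases "F = 0")
    case True
    have "I = 0"
    proof (rule ccontr)
      assume "I \<noteq> 0"
      then have "I > 0" using FG by simp
      then have "2 * ((G + 1) / I) * I = 2 * (G + 1)" by simp
      then show False using q[of "(G + 1) / I"] True FG by simp
    qed
    then show ?thesis using True by simp
  next
    case False
    then have "F > 0" using FG by simp
    then show ?thesis using q[of "I / F"] by (simp add: field_simps power2_eq_square)
  qed
  then have "I \<le> sqrt (F * G)" using real_le_rsqrt by blast
  then show ?thesis by (simp add: L2norm_def F_def G_def I_def real_sqrt_mult)
qed

lemma L2norm_triangle:
  assumes "f \<in> L2" "g \<in> L2"
  shows "L2norm (\<lambda>x. f x + g x) \<le> L2norm f + L2norm g"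
proof (rule power2_le_imp_le)
  note int = L2_integrable[OF assms(1)] L2_integrable[OF assms(2)] L2_mult_integrable(1)[OF assms]
  have "(L2norm (\<lambda>x. f x + g x))\<^sup>2 \<le>
      (\<integral>x. (cmod (f x))\<^sup>2 + 2 * (cmod (f x) * cmod (g x)) + (cmod (g x))\<^sup>2 \<partial>lborel)"
    unfolding L2norm_sq
  proof (rule integral_mono)
    show "(cmod (f x + g x))\<^sup>2 \<le> (cmod (f x))\<^sup>2 + 2 * (cmod (f x) * cmod (g x)) + (cmod (g x))\<^sup>2" for x
      using power_mono[OF norm_triangle_ineq[of "f x" "g x"] norm_ge_zero, of 2]
      by (simp add: power2_eq_square algebra_simps)
  qed (use int L2_integrable[OF L2_add[OF assms]] in auto)
  also have "\<dots> = (L2norm f)\<^sup>2 + 2 * (\<integral>x. cmod (f x) * cmod (g x) \<partial>lborel) + (L2norm g)\<^sup>2"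
    using int by (simp add: L2norm_sq)
  also have "\<dots> \<le> (L2norm f + L2norm g)\<^sup>2"
    using L2_Cauchy_Schwarz[OF assms] by (simp add: power2_sum)
  finally show "(L2norm (\<lambda>x. f x + g x))\<^sup>2 \<le> (L2norm f + L2norm g)\<^sup>2" .
qed simp

lemma L2norm_triangle_diff:
  assumes "f \<in> L2" "g \<in> L2" "h \<in> L2"
  shows "L2norm (\<lambda>x. f x - h x) \<le> L2norm (\<lambda>x. f x - g x) + L2norm (\<lambda>x. g x - h x)"
  using L2norm_triangle[OF L2_diff[OF assms(1,2)] L2_diff[OF assms(2,3)]] by simp

lemma L2norm_diff_abs_le:
  assumes "f \<in> L2" "g \<in> L2"
  shows "\<bar>L2norm f - L2norm g\<bar> \<le> L2norm (\<lambda>x. f x - g x)"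
  using L2norm_triangle[OF assms(2) L2_diff[OF assms]] L2norm_triangle[OF assms(1) L2_diff[OF assms(2,1)]]
  by (simp add: L2norm_commute[of g f])

lemma L2norm_tendsto:
  assumes "\<And>n. f n \<in> L2" "u \<in> L2" "(\<lambda>n. L2norm (\<lambda>x. f n x - u x)) \<longlonglongrightarrow> 0"
  shows "(\<lambda>n. L2norm (f n)) \<longlonglongrightarrow> L2norm u"
proof (rule LIM_zero_cancel, rule Lim_null_comparison[OF _ assms(3)])
  show "\<forall>\<^sub>F n in sequentially. norm (L2norm (f n) - L2norm u) \<le> L2norm (\<lambda>x. f n x - u x)"
    using L2norm_diff_abs_le[OF assms(1,2)] by auto
qed

lemma L2norm_mono:
  assumes "g \<in> L2" "f \<in> borel_measurable lborel" "\<And>x. cmod (f x) \<le> cmod (g x)"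
  shows "L2norm f \<le> L2norm g"
  unfolding L2norm_def real_sqrt_le_iff
proof (rule integral_mono)
  have "f \<in> L2" by (rule L2_dominated[OF assms(1,2), of 1]) (use assms(3) in simp)
  then show "integrable lborel (\<lambda>x. (cmod (f x))\<^sup>2)" by (rule L2_integrable)
qed (use assms L2_integrable in \<open>auto intro: power_mono\<close>)

lemma L2norm_eq_0_imp_AE:
  assumes "f \<in> L2" "L2norm f = 0"
  shows "AE x in lborel. f x = 0"
proof -
  have "(\<integral>x. (cmod (f x))\<^sup>2 \<partial>lborel) = 0" using assms(2) by (simp add: L2norm_def)
  then show ?thesis
    using integral_nonneg_eq_0_iff_AE[OF L2_integrable[OF assms(1)]] by auto
qed

lemma L2norm_cong_AE:
  assumes "f \<in> borel_measurable lborel" "g \<in> borel_measurable lborel" "AE x in lborel. f x = g x"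
  shows "L2norm f = L2norm g"
  unfolding L2norm_def using assms by (auto intro!: integral_cong_AE)

lemma L2_bounded_support:
  assumes "continuous_on UNIV f" "\<And>x. norm x > r \<Longrightarrow> f x = 0"
  shows "f \<in> L2"
  unfolding L2_iff
proof
  show "integrable lborel (\<lambda>x. (cmod (f x))\<^sup>2)"
  proof -
    have "integrable lborel (\<lambda>x. indicator (cball 0 r) x *\<^sub>R (cmod (f x))\<^sup>2)"
      by (rule borel_integrable_compact) (auto intro!: continuous_intros continuous_on_subset[OF assms(1)])
    moreover have "(\<lambda>x. indicator (cball 0 r) x *\<^sub>R (cmod (f x))\<^sup>2) = (\<lambda>x. (cmod (f x))\<^sup>2)"
      using assms(2) by (auto simp: indicator_def fun_eq_iff)
    ultimately show ?thesis by simp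
  qed
qed (rule continuous_imp_borel_measurable_lborel[OF assms(1)])

subsection \<open>Completeness\<close>

text \<open>The squared increments have integral at most 16^(-n). Weighting them by 4^n keeps the
  integrals summable, so the weighted series is finite almost everywhere, and this forces increments
  of size 2^(-n) there.\<close>

lemma L2_fast_Cauchy_AE_convergent:
  assumes f: "\<And>n. f n \<in> L2" and fast: "\<And>n. L2norm (\<lambda>x. f (Suc n) x - f n x) \<le> (1/4) ^ n"
  shows "AE x in lborel. convergent (\<lambda>n. f n x)"
proof -
  define d where "d n x = 4 ^ n * (cmod (f (Suc n) x - f n x))\<^sup>2" for n x
  have [measurable]: "f n \<in> borel_measurable lborel" for n by (rule L2_measurable[OF f])
  have "(\<integral>\<^sup>+x. ennreal (d n x) \<partial>lborel) \<le> ennreal ((1/4) ^ n)" for n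
  proof -
    have "integrable lborel (d n)"
      unfolding d_def using L2_integrable[OF L2_diff[OF f f]] by auto
    then have "(\<integral>\<^sup>+x. ennreal (d n x) \<partial>lborel) = ennreal (\<integral>x. d n x \<partial>lborel)"
      by (rule nn_integral_eq_integral) (simp add: d_def)
    also have "(\<integral>x. d n x \<partial>lborel) = 4 ^ n * (L2norm (\<lambda>x. f (Suc n) x - f n x))\<^sup>2"
      by (simp add: d_def L2norm_sq)
    also have "\<dots> \<le> 4 ^ n * ((1/4) ^ n)\<^sup>2"
      using fast by (intro mult_left_mono power_mono) auto
    also have "\<dots> = (1/4) ^ n" by (simp add: power2_eq_square power_divide)
    finally show ?thesis by (simp add: ennreal_leI)
  qed
  then have "(\<Sum>n. \<integral>\<^sup>+x. ennreal (d n x) \<partial>lborel) \<le> (\<Sum>n. ennreal ((1/4) ^ n))"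
    by (intro suminf_le) auto
  also have "\<dots> < \<infinity>"
    by (subst suminf_ennreal2) auto
  finally have "(\<integral>\<^sup>+x. (\<Sum>n. ennreal (d n x)) \<partial>lborel) \<noteq> \<infinity>"
    by (subst nn_integral_suminf) (auto simp: d_def)
  then have "AE x in lborel. (\<Sum>n. ennreal (d n x)) \<noteq> \<infinity>"
    by (intro nn_integral_noteq_infinite) (auto simp: d_def)
  then show ?thesis
  proof eventually_elim
    case (elim x)
    then obtain C where C: "C \<ge> 0" "(\<Sum>n. ennreal (d n x)) = ennreal C"
      by (cases "\<Sum>n. ennreal (d n x)") auto
    have "norm (f (Suc n) x - f n x) \<le> sqrt C * (1/2) ^ n" for n
    proof -
      have "ennreal (d n x) \<le> (\<Sum>n. ennreal (d n x))"
        using sum_le_suminf[of "\<lambda>n. ennreal (d n x)" "{n}"] by simp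
      then have "d n x \<le> C" using C by simp
      then have "sqrt (d n x) \<le> sqrt C" by simp
      moreover have "sqrt (d n x) = 2 ^ n * norm (f (Suc n) x - f n x)"
        by (simp add: d_def real_sqrt_mult real_sqrt_power)
      ultimately show ?thesis by (simp add: field_simps power_divide)
    qed
    moreover have "summable (\<lambda>n. sqrt C * (1/2) ^ n)"
      by (intro summable_mult) simp
    ultimately have "summable (\<lambda>n. f (Suc n) x - f n x)"
      by (rule summable_comparison_test'[rotated])
    then obtain s where "(\<lambda>n. \<Sum>i<n. f (Suc i) x - f i x) \<longlonglongrightarrow> s"
      unfolding summable_def sums_def by blast
    then have "(\<lambda>n. (f n x - f 0 x) + f 0 x) \<longlonglongrightarrow> s + f 0 x"
      unfolding sum_lessThan_telescope[of "\<lambda>i. f i x"] by (intro tendsto_add tendsto_const)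
    then show ?case unfolding convergent_def by auto
  qed
qed

lemma L2_complete:
  assumes f: "\<And>n. f n \<in> L2"
    and Cauchy: "\<And>e. e > 0 \<Longrightarrow> \<exists>N. \<forall>m\<ge>N. \<forall>n\<ge>N. L2norm (\<lambda>x. f m x - f n x) \<le> e"
  obtains u where "u \<in> L2" "(\<lambda>n. L2norm (\<lambda>x. f n x - u x)) \<longlonglongrightarrow> 0"
proof -
  have "\<forall>j. \<exists>N. \<forall>m\<ge>N. \<forall>n\<ge>N. L2norm (\<lambda>x. f m x - f n x) \<le> (1/4) ^ j"
    using Cauchy by simp
  from choice[OF this] obtain N
    where "\<forall>j. \<forall>m\<ge>N j. \<forall>n\<ge>N j. L2norm (\<lambda>x. f m x - f n x) \<le> (1/4) ^ j" by (rule exE)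
  then have N: "L2norm (\<lambda>x. f m x - f n x) \<le> (1/4) ^ j" if "m \<ge> N j" "n \<ge> N j" for j m n
    using that by simp
  \<comment> \<open>The sum makes \<open>k\<close> monotone and at least \<open>N j\<close>; the
    summand \<open>j\<close> makes it unbounded.\<close>
  define k where "k j = (\<Sum>i\<le>j. N i) + j" for j :: nat
  have k: "k j \<ge> N j" "k (Suc j) \<ge> k j" "k j \<ge> j" for j
    by (auto simp: k_def member_le_sum trans_le_add1)
  define u where "u x = lim (\<lambda>j. f (k j) x)" for x
  have [measurable]: "f n \<in> borel_measurable lborel" for n by (rule L2_measurable[OF f])
  have [measurable]: "u \<in> borel_measurable lborel" unfolding u_def by measurable
  have "AE x in lborel. convergent (\<lambda>j. f (k j) x)"
    by (rule L2_fast_Cauchy_AE_convergent[of "\<lambda>j. f (k j)"], rule f, rule N[OF order_trans[OF k(1) k(2)] k(1)])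
  then have lim: "AE x in lborel. (\<lambda>j. f (k j) x) \<longlonglongrightarrow> u x"
    by eventually_elim (simp add: u_def convergent_LIMSEQ_iff)
  \<comment> \<open>Fatou along the subsequence with \<open>m\<close> held fixed: the Cauchy bound
    of the full sequence survives as a bound for the distance to the limit.\<close>
  have fu: "(\<lambda>x. f m x - u x) \<in> L2 \<and> L2norm (\<lambda>x. f m x - u x) \<le> e"
    if e: "e > 0" and M: "\<forall>m\<ge>M. \<forall>n\<ge>M. L2norm (\<lambda>x. f m x - f n x) \<le> e" "m \<ge> M" for e M m
  proof -
    have "(\<integral>\<^sup>+x. ennreal ((cmod (f m x - u x))\<^sup>2) \<partial>lborel)
        = (\<integral>\<^sup>+x. liminf (\<lambda>j. ennreal ((cmod (f m x - f (k j) x))\<^sup>2)) \<partial>lborel)"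
    proof (rule nn_integral_cong_AE, use lim in eventually_elim)
      case (elim x)
      have "(\<lambda>j. ennreal ((cmod (f m x - f (k j) x))\<^sup>2)) \<longlonglongrightarrow> ennreal ((cmod (f m x - u x))\<^sup>2)"
        by (intro tendsto_ennrealI tendsto_intros elim)
      then show ?case by (rule lim_imp_Liminf[OF sequentially_bot, symmetric])
    qed
    also have "\<dots> \<le> liminf (\<lambda>j. \<integral>\<^sup>+x. ennreal ((cmod (f m x - f (k j) x))\<^sup>2) \<partial>lborel)"
      by (rule nn_integral_liminf) measurable
    also have "\<dots> \<le> liminf (\<lambda>j. ennreal (e\<^sup>2))"
    proof (rule Liminf_mono, rule eventually_sequentiallyI[of M])
      fix j assume "j \<ge> M"
      then have "k j \<ge> M" using k(3) order_trans by blast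
      then have "L2norm (\<lambda>x. f m x - f (k j) x) \<le> e" using M by blast
      then have "(L2norm (\<lambda>x. f m x - f (k j) x))\<^sup>2 \<le> e\<^sup>2" by (intro power_mono) auto
      then show "(\<integral>\<^sup>+x. ennreal ((cmod (f m x - f (k j) x))\<^sup>2) \<partial>lborel) \<le> ennreal (e\<^sup>2)"
        by (subst nn_integral_eq_integral) (auto simp: L2norm_sq intro!: L2_integrable L2_diff f)
    qed
    also have "\<dots> = ennreal (e\<^sup>2)" by (simp add: Liminf_const)
    finally have le: "(\<integral>\<^sup>+x. ennreal ((cmod (f m x - u x))\<^sup>2) \<partial>lborel) \<le> ennreal (e\<^sup>2)" .
    then have "integrable lborel (\<lambda>x. (cmod (f m x - u x))\<^sup>2)"
      by (intro integrableI_bounded) (use le_less_trans[OF le] in simp_all)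
    then have L2: "(\<lambda>x. f m x - u x) \<in> L2" unfolding L2_iff by simp
    have "ennreal ((L2norm (\<lambda>x. f m x - u x))\<^sup>2) \<le> ennreal (e\<^sup>2)"
      using le unfolding L2norm_sq by (subst (asm) nn_integral_eq_integral) (auto intro: L2_integrable[OF L2])
    then have "(L2norm (\<lambda>x. f m x - u x))\<^sup>2 \<le> e\<^sup>2" by simp
    then have "L2norm (\<lambda>x. f m x - u x) \<le> e" by (rule power2_le_imp_le) (use e in simp)
    then show ?thesis using L2 by simp
  qed
  obtain M where "\<forall>m\<ge>M. \<forall>n\<ge>M. L2norm (\<lambda>x. f m x - f n x) \<le> 1" using Cauchy[of 1] by auto
  then have "(\<lambda>x. f M x - u x) \<in> L2" using fu[of 1 M M] by simp
  from L2_diff[OF f[of M] this] have u: "u \<in> L2" by simp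
  have "(\<lambda>n. L2norm (\<lambda>x. f n x - u x)) \<longlonglongrightarrow> 0"
  proof (rule LIMSEQ_I)
    fix e :: real assume "e > 0"
    then obtain M where "\<forall>m\<ge>M. \<forall>n\<ge>M. L2norm (\<lambda>x. f m x - f n x) \<le> e/2" using Cauchy[of "e/2"] by auto
    then have "\<forall>n\<ge>M. L2norm (\<lambda>x. f n x - u x) \<le> e/2" using fu[of "e/2" M] \<open>e > 0\<close> by simp
    then show "\<exists>M. \<forall>n\<ge>M. norm (L2norm (\<lambda>x. f n x - u x) - 0) < e"
      using \<open>e > 0\<close> by (intro exI[of _ M]) (auto intro: le_less_trans)
  qed
  then show ?thesis using that u by blast
qed

subsection \<open>Orthogonal projection\<close>

lemma cmod_diff_sq: "(cmod (a - b))\<^sup>2 = (cmod a)\<^sup>2 - 2 * Re (a * cnj b) + (cmod b)\<^sup>2"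
  by (simp add: cmod_power2) (simp add: power2_eq_square algebra_simps)

lemma L2norm_diff_sq:
  assumes "f \<in> L2" "g \<in> L2"
  shows "(L2norm (\<lambda>x. f x - g x))\<^sup>2 = (L2norm f)\<^sup>2 - 2 * Re (\<integral>x. f x * cnj (g x) \<partial>lborel) + (L2norm g)\<^sup>2"
proof -
  define P where "P x = f x * cnj (g x)" for x
  have P: "integrable lborel P"
    unfolding P_def by (rule L2_mult_integrable(2)[OF assms(1) L2_cnj[OF assms(2)]])
  have "(L2norm (\<lambda>x. f x - g x))\<^sup>2 = (\<integral>x. (cmod (f x))\<^sup>2 - 2 * Re (P x) + (cmod (g x))\<^sup>2 \<partial>lborel)"
    unfolding L2norm_sq cmod_diff_sq P_def ..
  also have "\<dots> = (L2norm f)\<^sup>2 - 2 * Re (\<integral>x. P x \<partial>lborel) + (L2norm g)\<^sup>2"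
    using P L2_integrable[OF assms(1)] L2_integrable[OF assms(2)] by (simp add: L2norm_sq)
  finally show ?thesis by (simp add: P_def)
qed

text \<open>\<open>M\<close> will be the range of an operator on test functions and is not closed.
  The projection onto its closure is therefore delivered together with a sequence from
  \<open>M\<close>, whose preimages are needed later.\<close>

lemma L2_orthogonal_projection:
  assumes M: "M \<subseteq> L2" "M \<noteq> {}" "\<And>f g. f \<in> M \<Longrightarrow> g \<in> M \<Longrightarrow> (\<lambda>x. f x + g x) \<in> M"
      "\<And>f c. f \<in> M \<Longrightarrow> (\<lambda>x. c * f x) \<in> M"
    and g: "g \<in> L2"
  obtains m v where "\<And>n. m n \<in> M" "v \<in> L2" "(\<lambda>n. L2norm (\<lambda>x. m n x - v x)) \<longlonglongrightarrow> 0"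
    "\<And>h. h \<in> M \<Longrightarrow> (\<integral>x. (g x - v x) * cnj (h x) \<partial>lborel) = 0"
proof -
  define d where "d = (INF h\<in>M. (L2norm (\<lambda>x. g x - h x))\<^sup>2)"
  have ML2: "h \<in> L2" if "h \<in> M" for h using that M(1) by blast
  have bdd: "bdd_below ((\<lambda>h. (L2norm (\<lambda>x. g x - h x))\<^sup>2) ` M)"
    by (rule bdd_belowI[of _ 0]) auto
  have d_le: "d \<le> (L2norm (\<lambda>x. g x - h x))\<^sup>2" if "h \<in> M" for h
    unfolding d_def by (rule cINF_lower[OF bdd that])
  have "\<exists>h\<in>M. (L2norm (\<lambda>x. g x - h x))\<^sup>2 < d + e" if "e > 0" for e
    using cINF_less_iff[OF M(2) bdd, of "d + e"] that unfolding d_def by auto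
  then have "\<forall>n. \<exists>h\<in>M. (L2norm (\<lambda>x. g x - h x))\<^sup>2 < d + 1 / Suc n" by simp
  then obtain m where m: "\<And>n. m n \<in> M" "\<And>n. (L2norm (\<lambda>x. g x - m n x))\<^sup>2 < d + 1 / Suc n"
    by metis
  \<comment> \<open>Parallelogram law: the midpoint \<open>h\<close> of two nearly optimal elements
    lies in \<open>M\<close>, so its distance to \<open>g\<close> cannot beat \<open>d\<close>, and
    the two elements must be close.\<close>
  have par: "(L2norm (\<lambda>x. m i x - m j x))\<^sup>2 \<le> 2 / Suc i + 2 / Suc j" for i j
  proof -
    define h where "h = (\<lambda>x. (1/2) * (m i x + m j x))"
    have h: "h \<in> M" unfolding h_def by (rule M(4)[OF M(3)[OF m(1) m(1)]])
    have L: "(\<lambda>x. g x - m i x) \<in> L2" "(\<lambda>x. g x - m j x) \<in> L2" "(\<lambda>x. m i x - m j x) \<in> L2" "(\<lambda>x. g x - h x) \<in> L2"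
      by (intro L2_diff ML2 g m(1) h)+
    have eq: "(cmod (m i x - m j x))\<^sup>2 =
        2 * (cmod (g x - m i x))\<^sup>2 + 2 * (cmod (g x - m j x))\<^sup>2 - 4 * (cmod (g x - h x))\<^sup>2" for x
      unfolding h_def cmod_power2 by (simp add: power2_eq_square field_simps)
    have "(L2norm (\<lambda>x. m i x - m j x))\<^sup>2 =
        2 * (L2norm (\<lambda>x. g x - m i x))\<^sup>2 + 2 * (L2norm (\<lambda>x. g x - m j x))\<^sup>2 - 4 * (L2norm (\<lambda>x. g x - h x))\<^sup>2"
      unfolding L2norm_sq eq using L[THEN L2_integrable] by simp
    then show ?thesis using m(2)[of i] m(2)[of j] d_le[OF h] by simp
  qed
  have C: "\<exists>N. \<forall>a\<ge>N. \<forall>b\<ge>N. L2norm (\<lambda>x. m a x - m b x) \<le> e" if e: "e > 0" for e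
  proof -
    obtain N where N: "real N > 4 / e\<^sup>2" using reals_Archimedean2 by blast
    have "L2norm (\<lambda>x. m a x - m b x) \<le> e" if "a \<ge> N" "b \<ge> N" for a b
    proof (rule power2_le_imp_le)
      have "N > 0" using N e by (metis divide_pos_pos of_nat_0_less_iff order_less_trans zero_less_numeral zero_less_power)
      have "2 / real (Suc a) \<le> 2 / N" "2 / real (Suc b) \<le> 2 / N"
        using that \<open>N > 0\<close> by (auto intro!: divide_left_mono)
      moreover have "4 / real N \<le> e\<^sup>2" using N e \<open>N > 0\<close> by (simp add: field_simps)
      ultimately show "(L2norm (\<lambda>x. m a x - m b x))\<^sup>2 \<le> e\<^sup>2" using par[of a b] by simp
    qed (use e in simp)
    then show ?thesis by blast
  qed
  obtain v where v: "v \<in> L2" "(\<lambda>n. L2norm (\<lambda>x. m n x - v x)) \<longlonglongrightarrow> 0"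
    by (rule L2_complete[of m, OF ML2[OF m(1)] C])
  have "(\<integral>x. (g x - v x) * cnj (h x) \<partial>lborel) = 0" if h: "h \<in> M" for h
  proof -
    define w where "w = (\<lambda>x. g x - v x)"
    define I where "I = (\<integral>x. w x * cnj (h x) \<partial>lborel)"
    have wL: "w \<in> L2" unfolding w_def by (rule L2_diff[OF g v(1)])
    have lim: "(\<lambda>n. L2norm (\<lambda>x. g x - (m n x + f x))) \<longlonglongrightarrow> L2norm (\<lambda>x. w x - f x)" if "f \<in> L2" for f
    proof (rule L2norm_tendsto)
      show "(\<lambda>x. g x - (m n x + f x)) \<in> L2" for n by (rule L2_diff[OF g L2_add[OF ML2[OF m(1)] that]])
      show "(\<lambda>x. w x - f x) \<in> L2" by (rule L2_diff[OF wL that])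
      have "L2norm (\<lambda>x. g x - (m n x + f x) - (w x - f x)) = L2norm (\<lambda>x. m n x - v x)" for n
        using L2norm_commute[of "m n" v] by (simp add: w_def algebra_simps)
      then show "(\<lambda>n. L2norm (\<lambda>x. g x - (m n x + f x) - (w x - f x))) \<longlonglongrightarrow> 0" using v(2) by simp
    qed
    have ge: "d \<le> (L2norm (\<lambda>x. w x - f x))\<^sup>2" if "f \<in> M" for f
    proof (rule tendsto_lowerbound[OF tendsto_power[OF lim[OF ML2[OF that]]]])
      show "\<forall>\<^sub>F n in sequentially. d \<le> (L2norm (\<lambda>x. g x - (m n x + f x)))\<^sup>2"
        using d_le M(3)[OF m(1) that] by simp
    qed simp
    have wd: "(L2norm w)\<^sup>2 \<le> d"
    proof -
      have a: "(\<lambda>n. (L2norm (\<lambda>x. g x - (m n x + 0)))\<^sup>2) \<longlonglongrightarrow> (L2norm (\<lambda>x. w x - 0))\<^sup>2"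
        using L2_cmult[OF g, of 0] by (intro tendsto_power lim) simp
      have b: "(\<lambda>n. d + 1 / real (Suc n)) \<longlonglongrightarrow> d + 0"
        by (intro tendsto_add tendsto_const LIMSEQ_Suc lim_1_over_n)
      show ?thesis
        using LIMSEQ_le[OF a b] m(2) by (simp add: less_imp_le)
    qed
    \<comment> \<open>First variation at the minimiser: moving by \<open>s * I\<close> in the
      direction \<open>h\<close> lowers the squared distance by 2 s |I|^2 to first order and raises
      it only to second order in \<open>s\<close>.\<close>
    have s: "2 * (cmod I)\<^sup>2 \<le> s * ((cmod I)\<^sup>2 * (L2norm h)\<^sup>2)" if "s > 0" for s :: real
    proof -
      let ?c = "of_real s * I"
      have "(L2norm w)\<^sup>2 \<le> (L2norm (\<lambda>x. w x - ?c * h x))\<^sup>2"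
        using wd ge[OF M(4)[OF h, of ?c]] by linarith
      also have "\<dots> = (L2norm w)\<^sup>2 - 2 * Re (\<integral>x. w x * cnj (?c * h x) \<partial>lborel) + (L2norm (\<lambda>x. ?c * h x))\<^sup>2"
        by (rule L2norm_diff_sq[OF wL L2_cmult[OF ML2[OF h]]])
      also have "(\<integral>x. w x * cnj (?c * h x) \<partial>lborel) = (\<integral>x. cnj ?c * (w x * cnj (h x)) \<partial>lborel)"
        by (simp add: mult_ac)
      also have "\<dots> = cnj ?c * I" by (simp add: I_def)
      also have "Re (cnj ?c * I) = s * (cmod I)\<^sup>2"
        by (simp add: cmod_power2) (simp add: power2_eq_square algebra_simps)
      also have "L2norm (\<lambda>x. ?c * h x) = (s * cmod I) * L2norm h"
        using that by (simp add: L2norm_cmult norm_mult)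
      finally have "s * (2 * (cmod I)\<^sup>2) \<le> s * (s * ((cmod I)\<^sup>2 * (L2norm h)\<^sup>2))"
        by (simp add: power2_eq_square algebra_simps)
      then show ?thesis using that by simp
    qed
    have "2 * (cmod I)\<^sup>2 \<le> 0"
    proof (rule tendsto_lowerbound)
      show "((\<lambda>s. s * ((cmod I)\<^sup>2 * (L2norm h)\<^sup>2)) \<longlongrightarrow> 0) (at_right 0)"
        by (auto intro!: tendsto_eq_intros)
      show "\<forall>\<^sub>F s in at_right 0. 2 * (cmod I)\<^sup>2 \<le> s * ((cmod I)\<^sup>2 * (L2norm h)\<^sup>2)"
        using s by (auto simp: eventually_at_right_less eventually_at_filter)
    qed simp
    then show ?thesis by (simp add: I_def w_def)
  qed
  then show ?thesis using that m(1) v by blast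
qed

section \<open>Schroedinger operators with continuous potential\<close>

text \<open>Common form of the one-dimensional operator \<open>H_op\<close> and the planar
  \<open>L_op\<close>, so that one energy identity serves both.\<close>

definition S_op :: "('a::euclidean_space \<Rightarrow> real) \<Rightarrow> ('a \<Rightarrow> complex) \<Rightarrow> ('a \<Rightarrow> complex)" where
  "S_op V f = (\<lambda>x. - laplacian f x + complex_of_real (V x) * f x)"

lemma test_funs_L2: "f \<in> test_funs \<Longrightarrow> f \<in> L2"
  using L2_bounded_support test_funs_continuous test_funs_support by metis

lemma S_op_L2:
  assumes "continuous_on UNIV V" "f \<in> test_funs"
  shows "S_op V f \<in> L2"
proof -
  obtain r where r: "\<And>x. norm x > r \<Longrightarrow> f x = 0" using test_funs_support[OF assms(2)] by metis
  show ?thesis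
    unfolding S_op_def
  proof (rule L2_bounded_support)
    show "continuous_on UNIV (\<lambda>x. - laplacian f x + complex_of_real (V x) * f x)"
      by (intro continuous_intros continuous_on_laplacian test_funs_smooth test_funs_continuous assms)
    show "- laplacian f x + complex_of_real (V x) * f x = 0" if "norm x > r" for x
      using r[OF that] laplacian_support[OF test_funs_smooth[OF assms(2)] r that] by simp
  qed
qed

lemma S_op_add:
  "smooth_fun f \<Longrightarrow> smooth_fun g \<Longrightarrow> S_op V (\<lambda>x. f x + g x) = (\<lambda>x. S_op V f x + S_op V g x)"
  by (simp add: S_op_def laplacian_add algebra_simps)

lemma S_op_cmult: "smooth_fun f \<Longrightarrow> S_op V (\<lambda>x. c * f x) = (\<lambda>x. c * S_op V f x)"
  by (simp add: S_op_def laplacian_cmult algebra_simps)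

lemma op_closure_S_op_test:
  assumes "continuous_on UNIV V" "f \<in> test_funs"
  shows "(f, S_op V f) \<in> op_closure (S_op V)"
  unfolding op_closure_def
  using assms test_funs_L2 S_op_L2 by (auto intro!: exI[of _ "\<lambda>_. f"] simp: L2norm_def)

text \<open>The factor \<open>G\<close> is asked to be only once continuously differentiable,
  because in the applications it contains the square of a cutoff or weight. Its bounded support
  removes the boundary terms.\<close>

lemma integral_laplacian_mult:
  assumes f: "smooth_fun f"
    and G: "\<And>b. b \<in> Basis \<Longrightarrow> has_pd G (G' b) b" "continuous_on UNIV G"
      "\<And>b. b \<in> Basis \<Longrightarrow> continuous_on UNIV (G' b)" "\<And>x. norm x > r \<Longrightarrow> G x = 0"
  shows "(\<integral>x. laplacian f x * G x \<partial>lborel) = - (\<Sum>b\<in>Basis. \<integral>x. pd b f x * G' b x \<partial>lborel)"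
proof -
  have int: "integrable lborel (\<lambda>x. pd b f x * G' b x)" "integrable lborel (\<lambda>x. pd b (pd b f) x * G x)"
    if b: "b \<in> Basis" for b
  proof -
    have "G' b x = 0" if "norm x > r" for x
      using has_pd_support[OF G(1)[OF b] G(4)] that by blast
    then show "integrable lborel (\<lambda>x. pd b f x * G' b x)"
      by (intro integrable_bounded_support[where r=r] continuous_intros smooth_fun_continuous smooth_fun_pd f b G) auto
    show "integrable lborel (\<lambda>x. pd b (pd b f) x * G x)"
      by (intro integrable_bounded_support[where r=r] continuous_intros smooth_fun_continuous smooth_fun_pd f b G)
        (use G(4) in auto)
  qed
  have "(\<integral>x. pd b (pd b f) x * G x \<partial>lborel) = - (\<integral>x. pd b f x * G' b x \<partial>lborel)" if b: "b \<in> Basis" for b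
  proof -
    have "(\<integral>x. pd b f x * G' b x + pd b (pd b f) x * G x \<partial>lborel) = 0"
    proof (rule integral_pd_eq_0[where r=r])
      show "has_pd (\<lambda>x. pd b f x * G x) (\<lambda>x. pd b f x * G' b x + pd b (pd b f) x * G x) b"
        by (intro has_pd_mult smooth_fun_has_pd smooth_fun_pd f b G)
      show "continuous_on UNIV (\<lambda>x. pd b f x * G x)"
        "continuous_on UNIV (\<lambda>x. pd b f x * G' b x + pd b (pd b f) x * G x)"
        by (intro continuous_on_mult continuous_on_add G(2) G(3)[OF b]
            smooth_fun_continuous[OF smooth_fun_pd[OF f b]]
            smooth_fun_continuous[OF smooth_fun_pd[OF smooth_fun_pd[OF f b] b]])+
    qed (use G(4) in simp)
    then show ?thesis using int[OF b] by (simp add: eq_neg_iff_add_eq_0 add.commute)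
  qed
  moreover have "(\<integral>x. laplacian f x * G x \<partial>lborel) = (\<Sum>b\<in>Basis. \<integral>x. pd b (pd b f) x * G x \<partial>lborel)"
    unfolding laplacian_eq sum_distrib_right
    by (rule Bochner_Integration.integral_sum) (use int in auto)
  ultimately show ?thesis by (simp add: sum_negf)
qed

section \<open>The weighted energy identity and dissipativity\<close>

lemma two_mult_le_weighted_squares:
  fixes a b s :: real
  assumes "s > 0"
  shows "2 * a * b \<le> s * a\<^sup>2 + b\<^sup>2 / s"
proof -
  have "0 \<le> (s * a - b)\<^sup>2 / s" using assms by simp
  also have "(s * a - b)\<^sup>2 / s = s * a\<^sup>2 - 2 * a * b + b\<^sup>2 / s"
    using assms by (simp add: power2_eq_square field_simps)
  finally show ?thesis by simp
qed

text \<open>Both the cutoff argument behind essential self-adjointness and the exponential decay of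
  eigenfunctions come from testing with \<open>\<eta>\<^sup>2 cnj f\<close>; only \<open>\<eta>\<^sup>2\<close>
  has to be differentiable.\<close>
lemma energy_identity:
  fixes f :: "'a::euclidean_space \<Rightarrow> complex" and \<eta> D :: "'a \<Rightarrow> real"
  assumes f: "smooth_fun f" and V: "continuous_on UNIV V"
    and \<eta>: "continuous_on UNIV \<eta>" "\<And>x. \<eta> x \<ge> 0"
    and w': "\<And>b. b \<in> Basis \<Longrightarrow> has_pd (\<lambda>x. of_real ((\<eta> x)\<^sup>2)) (\<lambda>x. of_real (w' b x)) b"
      "\<And>b. b \<in> Basis \<Longrightarrow> continuous_on UNIV (w' b)"
      "\<And>b x. b \<in> Basis \<Longrightarrow> \<bar>w' b x\<bar> \<le> 2 * (\<eta> x * D x)"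
    and supp: "(\<forall>x. norm x > r \<longrightarrow> \<eta> x = 0) \<or> (\<forall>x. norm x > r \<longrightarrow> f x = 0)"
    and D: "integrable lborel (\<lambda>x. (D x * cmod (f x))\<^sup>2)"
    and A_def: "A = (\<Sum>b\<in>Basis. \<integral>x. (\<eta> x * cmod (pd b f x))\<^sup>2 \<partial>lborel)"
  obtains X where
    "of_real A + (\<integral>x. (of_real (V x) - z) * of_real ((\<eta> x * cmod (f x))\<^sup>2) \<partial>lborel) + X
      = (\<integral>x. (S_op V f x - z * f x) * (of_real ((\<eta> x)\<^sup>2) * cnj (f x)) \<partial>lborel)"
    "\<And>s. s > 0 \<Longrightarrow> cmod X \<le> s * A + DIM('a) / s * (\<integral>x. (D x * cmod (f x))\<^sup>2 \<partial>lborel)"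
proof -
  define G where "G x = complex_of_real ((\<eta> x)\<^sup>2) * cnj (f x)" for x
  define G' where "G' b x = of_real ((\<eta> x)\<^sup>2) * cnj (pd b f x) + of_real (w' b x) * cnj (f x)" for b x
  \<comment> \<open>The cross term, in which the derivative falls on the weight.\<close>
  define X where "X = (\<Sum>b\<in>Basis. \<integral>x. pd b f x * (of_real (w' b x) * cnj (f x)) \<partial>lborel)"
  have w'0: "w' b x = 0" if "\<eta> x = 0" "b \<in> Basis" for b x
    using w'(3)[OF that(2), of x] that(1) by simp
  have pf: "pd b f x = 0" if "\<forall>x. norm x > r \<longrightarrow> f x = 0" "norm x > r" "b \<in> Basis" for b x
    using has_pd_support[OF smooth_fun_has_pd[OF f that(3)] _ that(2)] that(1) by blast
  have cf: "continuous_on UNIV f" using f smooth_fun_continuous by blast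
  have cpf: "continuous_on UNIV (pd b f)" if "b \<in> Basis" for b
    using f smooth_fun_continuous smooth_fun_pd that by blast
  have G: "has_pd G (G' b) b" if "b \<in> Basis" for b
    unfolding G_def G'_def by (intro has_pd_mult w' has_pd_cnj smooth_fun_has_pd f that)
  have G0: "G x = 0" if "norm x > r" for x using supp that by (auto simp: G_def)
  have cG: "continuous_on UNIV G" unfolding G_def by (intro continuous_intros \<eta> cf)
  have cG': "continuous_on UNIV (G' b)" if "b \<in> Basis" for b
    unfolding G'_def using that by (intro continuous_intros \<eta> cf cpf w')
  have i1: "integrable lborel (\<lambda>x. (\<eta> x * cmod (pd b f x))\<^sup>2)" if b: "b \<in> Basis" for b
    by (rule integrable_bounded_support[where r=r])
      (use supp b pf in \<open>auto intro!: continuous_intros \<eta> cpf\<close>)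
  have i2: "integrable lborel (\<lambda>x. pd b f x * (of_real (w' b x) * cnj (f x)))" if b: "b \<in> Basis" for b
    by (rule integrable_bounded_support[where r=r])
      (use supp b w'0 in \<open>auto intro!: continuous_intros cf cpf w'\<close>)
  have i3: "integrable lborel (\<lambda>x. (of_real (V x) - z) * of_real ((\<eta> x * cmod (f x))\<^sup>2))"
    by (rule integrable_bounded_support[where r=r]) (use supp in \<open>auto intro!: continuous_intros cf \<eta> V\<close>)
  have i4: "integrable lborel (\<lambda>x. laplacian f x * G x)"
    by (rule integrable_bounded_support[where r=r])
      (use G0 in \<open>auto intro!: continuous_intros continuous_on_laplacian f cG\<close>)
  have eq: "pd b f x * G' b x = of_real ((\<eta> x * cmod (pd b f x))\<^sup>2) + pd b f x * (of_real (w' b x) * cnj (f x))" for b x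
    unfolding G'_def power_mult_distrib of_real_mult complex_norm_square by (simp add: algebra_simps)
  have "(\<integral>x. laplacian f x * G x \<partial>lborel) = - (\<Sum>b\<in>Basis. \<integral>x. pd b f x * G' b x \<partial>lborel)"
    by (rule integral_laplacian_mult[OF f G cG cG' G0])
  also have "(\<Sum>b\<in>Basis. \<integral>x. pd b f x * G' b x \<partial>lborel) = of_real A + X"
    unfolding eq A_def X_def of_real_sum using i1 i2 by (simp add: sum.distrib[symmetric] del: of_real_power of_real_mult)
  finally have lap: "(\<integral>x. laplacian f x * G x \<partial>lborel) = - (of_real A + X)" .
  have "(S_op V f x - z * f x) * (of_real ((\<eta> x)\<^sup>2) * cnj (f x)) =
      (of_real (V x) - z) * of_real ((\<eta> x * cmod (f x))\<^sup>2) - laplacian f x * G x" for x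
    unfolding S_op_def G_def power_mult_distrib of_real_mult complex_norm_square by (simp add: algebra_simps)
  then have "(\<integral>x. (S_op V f x - z * f x) * (of_real ((\<eta> x)\<^sup>2) * cnj (f x)) \<partial>lborel) =
      (\<integral>x. (of_real (V x) - z) * of_real ((\<eta> x * cmod (f x))\<^sup>2) \<partial>lborel) + (of_real A + X)"
    using i3 i4 lap by simp
  moreover have "cmod X \<le> s * A + DIM('a) / s * (\<integral>x. (D x * cmod (f x))\<^sup>2 \<partial>lborel)" if s: "s > 0" for s
  proof -
    have "cmod X \<le> (\<Sum>b\<in>Basis. cmod (\<integral>x. pd b f x * (of_real (w' b x) * cnj (f x)) \<partial>lborel))"
      unfolding X_def by (rule norm_sum)
    also have "\<dots> \<le> (\<Sum>b\<in>(Basis::'a set). s * (\<integral>x. (\<eta> x * cmod (pd b f x))\<^sup>2 \<partial>lborel) + (\<integral>x. (D x * cmod (f x))\<^sup>2 \<partial>lborel) / s)"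
    proof (rule sum_mono)
      fix b :: 'a assume b: "b \<in> Basis"
      \<comment> \<open>The bound on \<open>w'\<close> supplies one factor \<open>\<eta>\<close> for
        the gradient and one factor \<open>D\<close> for \<open>f\<close>; the inequality with
        weights \<open>s\<close> and 1 / s then separates the two.\<close>
      have le: "cmod (pd b f x * (of_real (w' b x) * cnj (f x))) \<le>
          s * (\<eta> x * cmod (pd b f x))\<^sup>2 + (D x * cmod (f x))\<^sup>2 / s" for x
      proof -
        have "cmod (pd b f x * (of_real (w' b x) * cnj (f x))) = \<bar>w' b x\<bar> * (cmod (pd b f x) * cmod (f x))"
          by (simp add: norm_mult)
        also have "\<dots> \<le> 2 * (\<eta> x * D x) * (cmod (pd b f x) * cmod (f x))"
          using w'(3)[OF b] by (intro mult_right_mono) auto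
        also have "\<dots> = 2 * (\<eta> x * cmod (pd b f x)) * (D x * cmod (f x))"
          by (simp add: mult_ac)
        also have "\<dots> \<le> s * (\<eta> x * cmod (pd b f x))\<^sup>2 + (D x * cmod (f x))\<^sup>2 / s"
          by (rule two_mult_le_weighted_squares[OF s])
        finally show ?thesis .
      qed
      have "cmod (\<integral>x. pd b f x * (of_real (w' b x) * cnj (f x)) \<partial>lborel) \<le>
          (\<integral>x. cmod (pd b f x * (of_real (w' b x) * cnj (f x))) \<partial>lborel)"
        by (rule integral_norm_bound)
      also have "\<dots> \<le> (\<integral>x. s * (\<eta> x * cmod (pd b f x))\<^sup>2 + (D x * cmod (f x))\<^sup>2 / s \<partial>lborel)"
        using i1[OF b] i2[OF b] D by (intro integral_mono le) auto
      also have "\<dots> = s * (\<integral>x. (\<eta> x * cmod (pd b f x))\<^sup>2 \<partial>lborel) + (\<integral>x. (D x * cmod (f x))\<^sup>2 \<partial>lborel) / s"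
        using i1[OF b] D by simp
      finally show "cmod (\<integral>x. pd b f x * (of_real (w' b x) * cnj (f x)) \<partial>lborel) \<le>
          s * (\<integral>x. (\<eta> x * cmod (pd b f x))\<^sup>2 \<partial>lborel) + (\<integral>x. (D x * cmod (f x))\<^sup>2 \<partial>lborel) / s" .
    qed
    also have "\<dots> = s * A + DIM('a) / s * (\<integral>x. (D x * cmod (f x))\<^sup>2 \<partial>lborel)"
      by (simp add: A_def sum.distrib sum_distrib_left)
    finally show ?thesis .
  qed
  ultimately show ?thesis by (intro that[of X]) (simp_all add: algebra_simps)
qed

text \<open>Take the weight 1 in the energy identity. Then \<open>D\<close> = 0 and the cross term
  is at most \<open>s * A\<close> for every \<open>s > 0\<close>, hence 0, so the pairing of
  \<open>S_op V f - z f\<close> with \<open>f\<close> has imaginary part - Im z times the squared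
  norm. Cauchy-Schwarz finishes.\<close>

lemma S_op_dissipative:
  assumes V: "continuous_on UNIV V" and f: "f \<in> test_funs"
  shows "\<bar>Im z\<bar> * L2norm f \<le> L2norm (\<lambda>x. S_op V f x - z * f x)"
proof -
  obtain r where r: "\<And>x. norm x > r \<Longrightarrow> f x = 0" using test_funs_support[OF f] by metis
  define A where "A = (\<Sum>b\<in>Basis. \<integral>x. (1 * cmod (pd b f x))\<^sup>2 \<partial>lborel)"
  have f2: "f \<in> L2" using f by (rule test_funs_L2)
  have F2: "(\<lambda>x. S_op V f x - z * f x) \<in> L2" by (intro L2_diff L2_cmult f2 S_op_L2 V f)
  obtain X where X: "of_real A + (\<integral>x. (of_real (V x) - z) * of_real ((1 * cmod (f x))\<^sup>2) \<partial>lborel) + X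
      = (\<integral>x. (S_op V f x - z * f x) * (of_real (1\<^sup>2) * cnj (f x)) \<partial>lborel)"
    "\<And>s. s > 0 \<Longrightarrow> cmod X \<le> s * A + DIM('a) / s * (\<integral>x. (0 * cmod (f x))\<^sup>2 \<partial>lborel)"
    by (rule energy_identity[OF test_funs_smooth[OF f] V, of "\<lambda>_. 1" "\<lambda>_ _. 0" "\<lambda>_. 0" r A z])
      (use r has_pd_const in \<open>auto simp: A_def\<close>)
  have "cmod X \<le> 0"
  proof (rule tendsto_lowerbound)
    show "((\<lambda>s. s * A) \<longlongrightarrow> 0) (at_right 0)" by (auto intro!: tendsto_eq_intros)
    show "\<forall>\<^sub>F s in at_right 0. cmod X \<le> s * A" using X(2) by (auto simp: eventually_at_filter)
  qed simp
  then have "X = 0" by simp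
  have i: "integrable lborel (\<lambda>x. of_real (V x) * complex_of_real ((cmod (f x))\<^sup>2))"
    by (rule integrable_bounded_support[where r=r])
      (use r in \<open>auto intro!: continuous_intros V test_funs_continuous[OF f]\<close>)
  have "(\<integral>x. (of_real (V x) - z) * of_real ((cmod (f x))\<^sup>2) \<partial>lborel) =
      (\<integral>x. of_real (V x) * complex_of_real ((cmod (f x))\<^sup>2) - z * complex_of_real ((cmod (f x))\<^sup>2) \<partial>lborel)"
    by (simp add: algebra_simps)
  also have "\<dots> = (\<integral>x. of_real (V x * (cmod (f x))\<^sup>2) \<partial>lborel) - z * of_real ((L2norm f)\<^sup>2)"
    using i L2_integrable[OF f2] by (simp add: L2norm_sq del: of_real_power)
  also have "\<dots> = of_real (\<integral>x. V x * (cmod (f x))\<^sup>2 \<partial>lborel) - z * of_real ((L2norm f)\<^sup>2)"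
    by (simp only: integral_complex_of_real)
  finally have "(\<integral>x. (S_op V f x - z * f x) * cnj (f x) \<partial>lborel) =
      of_real (A + (\<integral>x. V x * (cmod (f x))\<^sup>2 \<partial>lborel)) - z * of_real ((L2norm f)\<^sup>2)"
    using X(1) \<open>X = 0\<close> by (simp add: add_diff_eq)
  then have "\<bar>Im z\<bar> * (L2norm f)\<^sup>2 = \<bar>Im (\<integral>x. (S_op V f x - z * f x) * cnj (f x) \<partial>lborel)\<bar>"
    by (simp add: abs_mult)
  also have "\<dots> \<le> cmod (\<integral>x. (S_op V f x - z * f x) * cnj (f x) \<partial>lborel)"
    by (rule abs_Im_le_cmod)
  also have "\<dots> \<le> (\<integral>x. cmod ((S_op V f x - z * f x) * cnj (f x)) \<partial>lborel)"
    by (rule integral_norm_bound)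
  also have "\<dots> \<le> L2norm (\<lambda>x. S_op V f x - z * f x) * L2norm f"
    using L2_Cauchy_Schwarz[OF F2 f2] by (simp add: norm_mult)
  finally have "(\<bar>Im z\<bar> * L2norm f) * L2norm f \<le> L2norm (\<lambda>x. S_op V f x - z * f x) * L2norm f"
    by (simp add: power2_eq_square mult_ac)
  then show ?thesis
    by (cases "L2norm f = 0") (auto simp: order.strict_iff_order mult_le_cancel_right)
qed

section \<open>Mollification\<close>

lemma L2_locally_integrable:
  assumes "f \<in> L2"
  shows "locally_integrable f"
  unfolding locally_integrable_def
proof (intro conjI allI)
  show "f \<in> borel_measurable lborel" by (rule L2_measurable[OF assms])
  note [measurable] = this
  fix r
  have i: "integrable lborel (\<lambda>x. indicat_real (cball 0 r) x + (cmod (f x))\<^sup>2)"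
    using emeasure_bounded_finite[OF bounded_cball, of "0::'a" r] L2_integrable[OF assms]
    by (intro Bochner_Integration.integrable_add integrable_real_indicator) auto
  have le: "t \<le> 1 + t\<^sup>2" for t :: real
    using zero_le_power2[of "t - 1/2"] by (simp add: power2_eq_square algebra_simps)
  show "integrable lborel (\<lambda>x. indicat_real (cball 0 r) x * cmod (f x))"
    by (rule Bochner_Integration.integrable_bound[OF i]) (use le in \<open>auto simp: indicator_def\<close>)
qed

definition mollifier :: "real \<Rightarrow> 'a::euclidean_space \<Rightarrow> real" where
  "mollifier e x = bump 0 e x / (\<integral>y. bump (0::'a) e y \<partial>lborel)"

lemma continuous_bump: "continuous_on UNIV (bump a r)"
  unfolding bump_def[abs_def]
  by (rule continuous_on_compose2[OF continuous_flat_exp]) (auto intro!: continuous_intros)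

lemma bump_integrable:
  fixes a :: "'a::euclidean_space"
  assumes "r > 0"
  shows "integrable lborel (bump a r)"
proof (rule integrable_bounded_support[OF continuous_bump])
  fix x :: 'a assume "norm x > r + norm a"
  then show "bump a r x = 0"
    using norm_triangle_ineq2[of x a] assms by (simp add: bump_eq_0_iff)
qed

lemma bump_integral_pos:
  assumes "r > 0"
  shows "(\<integral>x. bump (a::'a::euclidean_space) r x \<partial>lborel) > 0"
proof -
  have "(\<integral>x. bump a r x \<partial>lborel) \<noteq> 0"
  proof
    assume "(\<integral>x. bump a r x \<partial>lborel) = 0"
    then have "AE x in lborel. bump a r x = 0"
      using integral_nonneg_eq_0_iff_AE[OF bump_integrable[OF assms, of a] AE_I2] bump_nonneg by blast
    then have "AE x in lborel. x \<notin> ball a r"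
      by (rule AE_mp) (auto simp: bump_eq_0_iff[OF assms] dist_norm norm_minus_commute)
    then have "ball a r \<in> null_sets lborel"
      by (subst (asm) AE_iff_null_sets[symmetric]) auto
    then have "negligible (ball a r)"
      using negligible_iff_null_sets null_sets_completionI by blast
    then show False using open_not_negligible[of "ball a r"] assms by auto
  qed
  moreover have "(\<integral>x. bump a r x \<partial>lborel) \<ge> 0" by (simp add: bump_nonneg)
  ultimately show ?thesis by simp
qed

section \<open>Elementary properties of the mollifier\<close>

context
  fixes e :: real
  assumes e: "e > 0"
begin

lemma mollifier_nonneg: "mollifier e x \<ge> 0"
  by (simp add: mollifier_def bump_nonneg)

lemma mollifier_eq_0: "norm x \<ge> e \<Longrightarrow> mollifier e x = 0"
  using e by (simp add: mollifier_def bump_eq_0_iff)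

lemma mollifier_minus_commute: "mollifier e (x - y) = mollifier e (y - x)"
  by (simp add: mollifier_def bump_def norm_minus_commute)

lemma test_funs_mollifier: "(\<lambda>x. complex_of_real (mollifier e x)) \<in> test_funs"
  using test_funs_cmult[OF test_funs_bump[OF e, of 0], of "inverse (of_real (\<integral>y. bump (0::'a) e y \<partial>lborel))"]
  by (simp add: mollifier_def[abs_def] divide_inverse mult.commute)

lemma continuous_mollifier: "continuous_on UNIV (mollifier e :: 'a::euclidean_space \<Rightarrow> real)"
  unfolding mollifier_def[abs_def] using bump_integral_pos[OF e, of "0::'a"]
  by (intro continuous_intros continuous_bump) auto

lemma measurable_mollifier [measurable]: "mollifier e \<in> borel_measurable borel"
  by (rule borel_measurable_continuous_onI[OF continuous_mollifier])

lemma integral_mollifier: "(\<integral>x. mollifier e (x :: 'a::euclidean_space) \<partial>lborel) = 1"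
  using bump_integral_pos[OF e, of "0::'a"] by (simp add: mollifier_def)

lemma integral_mollifier_translate:
  "(\<integral>x. mollifier e (x - y) \<partial>lborel) = 1" "(\<integral>y. mollifier e (x - y) \<partial>lborel) = 1"
  for x y :: "'a::euclidean_space"
proof -
  show *: "(\<integral>x. mollifier e (x - y) \<partial>lborel) = 1" for y :: 'a
    using lborel_integral_translate[of "mollifier e" "- y"] integral_mollifier[where 'a='a] by simp
  show "(\<integral>y. mollifier e (x - y) \<partial>lborel) = 1"
    using *[of x] mollifier_minus_commute[of x] by simp
qed

lemma integrable_mollifier_translate:
  "integrable lborel (\<lambda>x. mollifier e (x - y))" "integrable lborel (\<lambda>y. mollifier e (x - y))"
  using integral_mollifier_translate(1)[of y] integral_mollifier_translate(2)[of x]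
    not_integrable_integral_eq by fastforce+

text \<open>Tonelli, followed by the unit mass of the mollifier in \<open>x\<close>.\<close>

lemma mollify_nn_integral:
  assumes [measurable]: "f \<in> borel_measurable lborel"
  shows "(\<integral>\<^sup>+x. \<integral>\<^sup>+y. ennreal (f y * mollifier e (x - y)) \<partial>lborel \<partial>lborel) \<le> (\<integral>\<^sup>+y. ennreal (f y) \<partial>(lborel :: 'a::euclidean_space measure))"
proof -
  have "(\<integral>\<^sup>+x. \<integral>\<^sup>+y. ennreal (f y * mollifier e (x - y)) \<partial>lborel \<partial>lborel)
      = (\<integral>\<^sup>+y. \<integral>\<^sup>+x. ennreal (f y * mollifier e (x - y)) \<partial>lborel \<partial>lborel)"
    by (rule lborel_pair.Fubini'[symmetric]) measurable
  also have "\<dots> \<le> (\<integral>\<^sup>+y. ennreal (f y) \<partial>lborel)"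
  proof (rule nn_integral_mono)
    fix y
    have "(\<integral>\<^sup>+x. ennreal (f y * mollifier e (x - y)) \<partial>lborel) = (\<integral>\<^sup>+x. ennreal (f y) * ennreal (mollifier e (x - y)) \<partial>lborel)"
      by (simp add: ennreal_mult'' mollifier_nonneg)
    also have "\<dots> = ennreal (f y) * (\<integral>\<^sup>+x. ennreal (mollifier e (x - y)) \<partial>lborel)"
      by (rule nn_integral_cmult) measurable
    also have "(\<integral>\<^sup>+x. ennreal (mollifier e (x - y)) \<partial>lborel) = 1"
      by (subst nn_integral_eq_integral)
        (auto simp: integrable_mollifier_translate mollifier_nonneg integral_mollifier_translate)
    finally show "(\<integral>\<^sup>+x. ennreal (f y * mollifier e (x - y)) \<partial>lborel) \<le> ennreal (f y)" by simp
  qed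
  finally show ?thesis .
qed

abbreviation mollify :: "('a::euclidean_space \<Rightarrow> complex) \<Rightarrow> 'a \<Rightarrow> complex" where
  "mollify f \<equiv> conv f (\<lambda>x. of_real (mollifier e x))"

lemma mollify_abs_le:
  assumes "locally_integrable f"
  shows "cmod (mollify f x) \<le> (\<integral>y. cmod (f y) * mollifier e (x - y) \<partial>lborel)"
proof -
  have "cmod (mollify f x) \<le> (\<integral>y. cmod (f y * of_real (mollifier e (x - y))) \<partial>lborel)"
    unfolding conv_def by (rule integral_norm_bound)
  then show ?thesis by (simp add: norm_mult mollifier_nonneg)
qed

text \<open>Jensen's inequality for the probability density \<open>mollifier e (x - y)\<close>,
  obtained from Cauchy-Schwarz by giving a square root of the density to each factor.\<close>

lemma mollify_sq_le:
  fixes f :: "'a::euclidean_space \<Rightarrow> complex"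
  assumes f: "f \<in> L2"
  shows "(cmod (mollify f x))\<^sup>2 \<le> (\<integral>y. (cmod (f y))\<^sup>2 * mollifier e (x - y) \<partial>lborel)"
    and "integrable lborel (\<lambda>y. (cmod (f y))\<^sup>2 * mollifier e (x - y))"
proof -
  note [measurable] = L2_measurable[OF f]
  have "\<And>x::'a. norm x > e \<Longrightarrow> mollifier e x = 0" by (simp add: mollifier_eq_0)
  then obtain B where B: "B \<ge> 0" "\<And>x::'a. norm (mollifier e x) \<le> B"
    using bounded_support_imp_bounded[OF continuous_mollifier] by blast
  show i: "integrable lborel (\<lambda>y. (cmod (f y))\<^sup>2 * mollifier e (x - y))"
    by (rule Bochner_Integration.integrable_bound[where f="\<lambda>y. B * (cmod (f y))\<^sup>2"])
      (use L2_integrable[OF f] B in \<open>auto simp: abs_mult mult.commute[of B] intro!: mult_left_mono\<close>)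
  define g where "g y = complex_of_real (cmod (f y) * sqrt (mollifier e (x - y)))" for y
  define h where "h y = complex_of_real (sqrt (mollifier e (x - y)))" for y
  have g: "g \<in> L2" unfolding L2_iff g_def using i by (auto simp: norm_mult power_mult_distrib mollifier_nonneg)
  have h: "h \<in> L2" unfolding L2_iff h_def
    using integrable_mollifier_translate(2)[of x] by (auto simp: mollifier_nonneg)
  have "cmod (mollify f x) \<le> (\<integral>y. cmod (f y) * mollifier e (x - y) \<partial>lborel)"
    by (rule mollify_abs_le[OF L2_locally_integrable[OF f]])
  also have "\<dots> = (\<integral>y. cmod (g y) * cmod (h y) \<partial>lborel)"
    by (simp add: g_def h_def norm_mult mollifier_nonneg mult.assoc)
  also have "\<dots> \<le> L2norm g * L2norm h" by (rule L2_Cauchy_Schwarz[OF g h])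
  also have "L2norm h = 1"
    by (simp add: L2norm_def h_def mollifier_nonneg integral_mollifier_translate)
  finally have "(cmod (mollify f x))\<^sup>2 \<le> (L2norm g)\<^sup>2"
    by (intro power_mono) auto
  also have "(L2norm g)\<^sup>2 = (\<integral>y. (cmod (f y))\<^sup>2 * mollifier e (x - y) \<partial>lborel)"
    unfolding L2norm_sq by (simp add: g_def norm_mult power_mult_distrib mollifier_nonneg)
  finally show "(cmod (mollify f x))\<^sup>2 \<le> (\<integral>y. (cmod (f y))\<^sup>2 * mollifier e (x - y) \<partial>lborel)" .
qed

lemma mollify_continuous: "locally_integrable f \<Longrightarrow> continuous_on UNIV (mollify f)"
  by (rule continuous_on_conv_test[OF _ test_funs_mollifier])

lemma mollify_L2:
  assumes f: "f \<in> L2"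
  shows "mollify f \<in> L2" "L2norm (mollify f) \<le> L2norm f"
proof -
  note [measurable] = L2_measurable[OF f]
  have m: "mollify f \<in> borel_measurable lborel"
    by (intro continuous_imp_borel_measurable_lborel mollify_continuous L2_locally_integrable f)
  have "(\<integral>\<^sup>+x. ennreal ((cmod (mollify f x))\<^sup>2) \<partial>lborel) \<le>
      (\<integral>\<^sup>+x. \<integral>\<^sup>+y. ennreal ((cmod (f y))\<^sup>2 * mollifier e (x - y)) \<partial>lborel \<partial>lborel)"
  proof (rule nn_integral_mono)
    fix x
    show "ennreal ((cmod (mollify f x))\<^sup>2) \<le> (\<integral>\<^sup>+y. ennreal ((cmod (f y))\<^sup>2 * mollifier e (x - y)) \<partial>lborel)"
      using mollify_sq_le[OF f, of x]
      by (subst nn_integral_eq_integral) (auto simp: mollifier_nonneg intro!: ennreal_leI)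
  qed
  also have "\<dots> \<le> (\<integral>\<^sup>+y. ennreal ((cmod (f y))\<^sup>2) \<partial>lborel)"
    by (rule mollify_nn_integral) measurable
  also have "\<dots> = ennreal ((L2norm f)\<^sup>2)"
    by (subst nn_integral_eq_integral) (auto simp: L2norm_sq L2_integrable[OF f])
  finally have le: "(\<integral>\<^sup>+x. ennreal ((cmod (mollify f x))\<^sup>2) \<partial>lborel) \<le> ennreal ((L2norm f)\<^sup>2)" .
  then have "integrable lborel (\<lambda>x. (cmod (mollify f x))\<^sup>2)"
    using m by (intro integrableI_bounded) (use le_less_trans[OF le] in simp_all)
  then show L: "mollify f \<in> L2" using m by (simp add: L2_iff)
  have "ennreal ((L2norm (mollify f))\<^sup>2) \<le> ennreal ((L2norm f)\<^sup>2)"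
    using le unfolding L2norm_sq[of "mollify f"]
    by (subst (asm) nn_integral_eq_integral) (auto simp: L2_integrable[OF L])
  then have "(L2norm (mollify f))\<^sup>2 \<le> (L2norm f)\<^sup>2" by simp
  then show "L2norm (mollify f) \<le> L2norm f" by (rule power2_le_imp_le) simp
qed

text \<open>Fubini moves the averaging from \<open>f\<close> to the indicator of \<open>S\<close>,
  where its limit can be computed by hand.\<close>

lemma mollify_set_integral:
  fixes f :: "'a::euclidean_space \<Rightarrow> complex"
  assumes f: "locally_integrable f" and S: "bounded S" "S \<in> sets borel"
  shows "(\<integral>x. indicator S x *\<^sub>R mollify f x \<partial>lborel) =
    (\<integral>y. f y * of_real (\<integral>x. indicator S x * mollifier e (x - y) \<partial>lborel) \<partial>lborel)"
proof -
  have [measurable]: "f \<in> borel_measurable lborel" "S \<in> sets borel"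
    using f S by (auto simp: locally_integrable_def)
  have ni: "integrable lborel (\<lambda>y. cmod (f y) * mollifier e (x - y))" for x
    using integrable_norm[OF integrable_conv_test[OF f test_funs_mollifier]]
    by (simp add: norm_mult mollifier_nonneg)
  \<comment> \<open>The inner absolute integral is the mollification of |f|, hence continuous and
    integrable over the bounded set \<open>S\<close>; this is the integrability on the product that
    Fubini asks for.\<close>
  let ?U = "\<lambda>x. \<integral>y. cmod (f y) * mollifier e (x - y) \<partial>lborel"
  have fl: "locally_integrable (\<lambda>y. of_real (cmod (f y)))"
    using f by (auto simp: locally_integrable_def)
  have U: "complex_of_real (?U x) = mollify (\<lambda>y. of_real (cmod (f y))) x" for x
    unfolding conv_def by (simp only: integral_complex_of_real[symmetric] of_real_mult)
  have cU: "continuous_on UNIV ?U"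
  proof -
    have "?U = (\<lambda>x. Re (mollify (\<lambda>y. of_real (cmod (f y))) x))" unfolding U[symmetric] by simp
    then show ?thesis using continuous_on_Re[OF mollify_continuous[OF fl]] by (simp only:)
  qed
  obtain r where r: "S \<subseteq> cball 0 r" using S(1) unfolding bounded_iff by (auto simp: subset_iff)
  have "integrable lborel (\<lambda>x. indicator (cball 0 r) x *\<^sub>R ?U x)"
    by (rule borel_integrable_compact) (auto intro: continuous_on_subset[OF cU])
  then have iU: "integrable lborel (\<lambda>x. indicator S x *\<^sub>R ?U x)"
    by (rule Bochner_Integration.integrable_bound)
      (use r continuous_imp_borel_measurable_lborel[OF cU] in \<open>auto simp: indicator_def subset_iff\<close>)
  have "integrable (lborel \<Otimes>\<^sub>M lborel) (\<lambda>(x, y). indicator S x *\<^sub>R (f y * of_real (mollifier e (x - y))))"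
  proof (rule lborel_pair.Fubini_integrable)
    show "(\<lambda>(x, y). indicator S x *\<^sub>R (f y * of_real (mollifier e (x - y)))) \<in> borel_measurable (lborel \<Otimes>\<^sub>M lborel)"
      by measurable
    show "integrable lborel (\<lambda>x. \<integral>y. norm (case (x, y) of (x, y) \<Rightarrow> indicator S x *\<^sub>R (f y * of_real (mollifier e (x - y)))) \<partial>lborel)"
      using iU by (simp add: norm_mult mollifier_nonneg)
    show "AE x in lborel. integrable lborel (\<lambda>y. case (x, y) of (x, y) \<Rightarrow> indicator S x *\<^sub>R (f y * of_real (mollifier e (x - y))))"
      using integrable_conv_test[OF f test_funs_mollifier] by auto
  qed
  from lborel_pair.Fubini_integral[OF this]
  have "(\<integral>x. indicator S x *\<^sub>R mollify f x \<partial>lborel) =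
      (\<integral>y. \<integral>x. indicator S x *\<^sub>R (f y * of_real (mollifier e (x - y))) \<partial>lborel \<partial>lborel)"
    by (simp add: conv_def)
  also have "\<dots> = (\<integral>y. f y * of_real (\<integral>x. indicator S x * mollifier e (x - y) \<partial>lborel) \<partial>lborel)"
  proof (rule Bochner_Integration.integral_cong)
    fix y
    have "(\<integral>x. indicator S x *\<^sub>R (f y * of_real (mollifier e (x - y))) \<partial>lborel) =
       (\<integral>x. f y * of_real (indicator S x * mollifier e (x - y)) \<partial>lborel)"
      by (simp add: scaleR_conv_of_real mult_ac)
    also have "\<dots> = f y * of_real (\<integral>x. indicator S x * mollifier e (x - y) \<partial>lborel)"
      by (simp only: integral_mult_right_zero integral_complex_of_real)
    finally show "(\<integral>x. indicator S x *\<^sub>R (f y * of_real (mollifier e (x - y))) \<partial>lborel) =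
      f y * of_real (\<integral>x. indicator S x * mollifier e (x - y) \<partial>lborel)" .
  qed simp
  finally show ?thesis .
qed

end

text \<open>Integrals over boxes are enough to identify a function, so no norm convergence of
  mollifications is established. What converges is the mollified indicator, at every point off the
  boundary of the box, a null set.\<close>

lemma mollify_box_tendsto:
  fixes f :: "'a::euclidean_space \<Rightarrow> complex"
  assumes f: "locally_integrable f"
  shows "(\<lambda>j. \<integral>x. indicator (box a b) x *\<^sub>R conv f (\<lambda>x. of_real (mollifier (1 / real (Suc j)) x)) x \<partial>lborel)
    \<longlonglongrightarrow> (\<integral>x. indicator (box a b) x *\<^sub>R f x \<partial>lborel)"
proof -
  define \<rho> :: "nat \<Rightarrow> 'a \<Rightarrow> real" where "\<rho> j = mollifier (1 / real (Suc j))" for j :: nat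
  define c where "c j y = (\<integral>x. indicator (box a b) x * \<rho> j (x - y :: 'a) \<partial>lborel)" for j y
  have [measurable]: "f \<in> borel_measurable lborel" using f by (simp add: locally_integrable_def)
  have [measurable]: "\<rho> j \<in> borel_measurable borel" for j unfolding \<rho>_def by (simp add: measurable_mollifier)
  have pos: "1 / real (Suc j) > 0" for j by simp
  have m: "\<rho> j x \<ge> 0" "norm x \<ge> 1 / real (Suc j) \<Longrightarrow> \<rho> j x = 0"
    "(\<integral>x. \<rho> j (x - y) \<partial>lborel) = 1" "integrable lborel (\<lambda>x. \<rho> j (x - y))" for j x y
    unfolding \<rho>_def using mollifier_nonneg[OF pos] mollifier_eq_0[OF pos]
      integral_mollifier_translate(1)[OF pos] integrable_mollifier_translate(1)[OF pos] by auto
  \<comment> \<open>At a point whose distance to the boundary exceeds the mollification radius, the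
    mollified indicator already equals the indicator.\<close>
  have c_eq: "c j y = (if y \<in> box a b then 1 else 0)" if d: "\<And>x. dist x y < 1 / real (Suc j) \<Longrightarrow> x \<in> box a b \<longleftrightarrow> y \<in> box a b" for j y
  proof -
    have "indicator (box a b) x * \<rho> j (x - y) = (if y \<in> box a b then \<rho> j (x - y) else 0)" for x
      using d[of x] m(2)[of j "x - y"] by (cases "dist x y < 1 / real (Suc j)") (auto simp: dist_norm)
    then have "c j y = (\<integral>x. (if y \<in> box a b then \<rho> j (x - y) else 0) \<partial>lborel)"
      unfolding c_def by (simp only:)
    then show ?thesis using m(3) by simp
  qed
  have lim: "(\<lambda>j. c j y) \<longlonglongrightarrow> indicator (box a b) y" if y: "y \<notin> cbox a b - box a b" for y
  proof -
    have "\<exists>d>0. \<forall>x. dist x y < d \<longrightarrow> x \<in> box a b \<longleftrightarrow> y \<in> box a b"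
    proof (cases "y \<in> box a b")
      case True
      then show ?thesis using open_box[of a b] unfolding open_dist by blast
    next
      case False
      then have "y \<in> - cbox a b" using y by auto
      moreover have "open (- cbox a b)" by (simp add: closed_cbox open_Compl)
      ultimately obtain d where "d > 0" "\<And>x. dist x y < d \<Longrightarrow> x \<in> - cbox a b"
        unfolding open_dist by blast
      then show ?thesis using False box_subset_cbox[of a b] by (intro exI[of _ d]) auto
    qed
    then obtain d where d: "d > 0" "\<And>x. dist x y < d \<Longrightarrow> x \<in> box a b \<longleftrightarrow> y \<in> box a b" by blast
    have "\<forall>\<^sub>F j in sequentially. 1 / real (Suc j) < d"
      using LIMSEQ_Suc[OF lim_1_over_n] d(1) by (rule order_tendstoD(2))
    then have "\<forall>\<^sub>F j in sequentially. indicator (box a b) y = c j y"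
    proof eventually_elim
      case (elim j)
      show ?case by (subst c_eq) (use d(2) elim in \<open>auto simp: indicator_def\<close>)
    qed
    then show ?thesis by (rule Lim_transform_eventually[OF tendsto_const])
  qed
  obtain r where r: "box a b \<subseteq> cball 0 r" using bounded_box[of a b] unfolding bounded_iff by (auto simp: subset_iff)
  have bd: "cmod (f y * of_real (c j y)) \<le> indicat_real (cball 0 (r + 1)) y * cmod (f y)" for j y
  proof (cases "norm y \<le> r + 1")
    case True
    have "\<bar>c j y\<bar> \<le> (\<integral>x. \<rho> j (x - y) \<partial>lborel)"
    proof -
      have "c j y \<le> (\<integral>x. \<rho> j (x - y) \<partial>lborel)"
        unfolding c_def
        by (rule integral_mono_AE[OF integrable_mult_indicator[of _ lborel "\<lambda>x. \<rho> j (x - y)", simplified]])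
          (use m in \<open>auto simp: indicator_def\<close>)
      moreover have "c j y \<ge> 0" unfolding c_def using m(1) by auto
      ultimately show ?thesis by simp
    qed
    then have "\<bar>c j y\<bar> \<le> 1" using m(3) by simp
    then show ?thesis using True by (simp add: norm_mult mult_left_le)
  next
    case False
    have "indicator (box a b) x * \<rho> j (x - y) = 0" for x
    proof (cases "x \<in> box a b")
      case True
      then have "norm (x - y) \<ge> 1" using False r norm_triangle_ineq2[of y x] by (auto simp: norm_minus_commute)
      moreover have "1 / real (Suc j) \<le> 1" by simp
      ultimately have "1 / real (Suc j) \<le> norm (x - y)" by linarith
      then show ?thesis using m(2) by (simp del: of_nat_Suc)
    qed simp
    then have "c j y = 0" unfolding c_def by (simp only: Bochner_Integration.integral_zero)
    then show ?thesis by simp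
  qed
  have "(\<lambda>j. \<integral>y. f y * of_real (c j y) \<partial>lborel) \<longlonglongrightarrow> (\<integral>y. f y * of_real (indicator (box a b) y) \<partial>lborel)"
  proof (rule integral_dominated_convergence[where w="\<lambda>y. indicat_real (cball 0 (r + 1)) y * cmod (f y)"])
    show "(\<lambda>y. f y * of_real (c j y)) \<in> borel_measurable lborel" for j
      unfolding c_def by measurable
    show "integrable lborel (\<lambda>y. indicat_real (cball 0 (r + 1)) y * cmod (f y))"
      using f unfolding locally_integrable_def by blast
    have "cbox a b - box a b \<in> null_sets lborel"
      using negligible_frontier_interval[of a b]
      by (simp add: negligible_iff_null_sets null_sets_completion_iff)
    then have "AE y in lborel. y \<notin> cbox a b - box a b" by (rule AE_not_in)
    then show "AE y in lborel. (\<lambda>j. f y * of_real (c j y)) \<longlonglongrightarrow> f y * of_real (indicator (box a b) y)"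
      by eventually_elim (intro tendsto_intros lim)
  qed (use bd in auto)
  moreover have "(\<integral>x. indicator (box a b) x *\<^sub>R conv f (\<lambda>x. of_real (mollifier (1 / real (Suc j)) x)) x \<partial>lborel)
    = (\<integral>y. f y * of_real (c j y) \<partial>lborel)" for j
    unfolding c_def \<rho>_def by (rule mollify_set_integral[OF pos f bounded_box]) simp
  moreover have "(\<integral>y. f y * of_real (indicator (box a b) y) \<partial>lborel) = (\<integral>x. indicator (box a b) x *\<^sub>R f x \<partial>lborel)"
    by (simp add: scaleR_conv_of_real mult.commute)
  ultimately show ?thesis by simp
qed

text \<open>Boxes are stable under intersection and generate the Borel sets, so vanishing spreads
  from boxes to all Borel sets. The argument is run inside a fixed box \<open>box a b\<close>, where
  \<open>f\<close> is integrable, and countably many boxes cover the space.\<close>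

lemma AE_eq_0_if_box_integrals:
  fixes f :: "'a::euclidean_space \<Rightarrow> complex"
  assumes f: "locally_integrable f"
    and 0: "\<And>a b. (\<integral>x. indicator (box a b) x *\<^sub>R f x \<partial>lborel) = 0"
  shows "AE x in lborel. f x = 0"
proof -
  have [measurable]: "f \<in> borel_measurable lborel" using f by (simp add: locally_integrable_def)
  have "AE x in lborel. indicator (box a b) x *\<^sub>R f x = 0" for a b :: 'a
  proof -
    define F where "F x = indicator (box a b) x *\<^sub>R f x" for x
    obtain r where r: "box a b \<subseteq> cball 0 r" using bounded_box[of a b] unfolding bounded_iff by (auto simp: subset_iff)
    have "integrable lborel (\<lambda>x. indicat_real (cball 0 r) x * cmod (f x))"
      using f by (simp add: locally_integrable_def)
    then have F: "integrable lborel F"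
      unfolding F_def by (rule Bochner_Integration.integrable_bound) (use r in \<open>auto simp: indicator_def subset_iff\<close>)
    have setF: "set_integrable lborel A F" if "A \<in> sets lborel" for A
      unfolding set_integrable_def by (rule integrable_mult_indicator[OF that F])
    have st: "Int_stable (range (\<lambda>(c, d). box c d :: 'a set))"
      by (auto simp: Int_stable_def box_Int_box)
    have cl: "range (\<lambda>(c, d). box c d :: 'a set) \<subseteq> Pow UNIV" by simp
    have sig: "sigma_sets UNIV (range (\<lambda>(c, d). box c d :: 'a set)) = sets lborel"
      by (simp add: borel_eq_box)
    have "(LINT x:A|lborel. F x) = 0" if "A \<in> sigma_sets UNIV (range (\<lambda>(c, d). box c d))" for A
      using st cl that
    proof (induction rule: sigma_sets_induct_disjoint)
      case (basic A)
      then obtain c d where A: "A = box c d" by auto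
      obtain c' d' where cd: "box c d \<inter> box a b = box c' d'" using box_Int_box[of c d a b] by blast
      have "indicator A x *\<^sub>R F x = indicator (box c' d') x *\<^sub>R f x" for x
        unfolding F_def A cd[symmetric] by (simp add: indicator_inter_arith)
      then show ?case using 0[of c' d'] by (simp add: set_lebesgue_integral_def)
    next
      case (compl A)
      then have A: "A \<in> sets lborel" using sig by blast
      have "indicator (UNIV - A) x *\<^sub>R F x = F x - indicator A x *\<^sub>R F x" for x
        by (simp add: indicator_def)
      then have "(LINT x:UNIV - A|lborel. F x) = (\<integral>x. F x \<partial>lborel) - (LINT x:A|lborel. F x)"
        using F setF[OF A] by (simp add: set_lebesgue_integral_def set_integrable_def)
      then show ?case using compl 0[of a b] by (simp add: F_def)
    next
      case (union A)
      then have A: "\<And>i. A i \<in> sets lborel" using sig by blast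
      have "(LINT x:(\<Union>i. A i)|lborel. F x) = (\<Sum>i. LINT x:A i|lborel. F x)"
        by (rule lebesgue_integral_countable_add)
          (use A union(1) setF in \<open>auto simp: disjoint_family_on_def\<close>)
      then show ?case using union by simp
    qed (auto simp: set_lebesgue_integral_def)
    then have "AE x in lborel. F x = 0"
      using sig by (intro sigma_finite_measure.density_zero[OF lborel.sigma_finite_measure_axioms] F) auto
    then show ?thesis by (simp add: F_def)
  qed
  then have "AE x in lborel. \<forall>n::nat. indicator (box (- (real n *\<^sub>R One)) (real n *\<^sub>R One)) x *\<^sub>R f x = 0"
    unfolding AE_all_countable by blast
  then show ?thesis
  proof eventually_elim
    case (elim x)
    obtain n where "x \<in> box (- (real n *\<^sub>R One)) (real n *\<^sub>R One)" using UN_box_eq_UNIV by blast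
    then show ?case using elim by (auto dest!: spec[of _ n])
  qed
qed

section \<open>Essential self-adjointness\<close>

text \<open>The positive part has a corner at 0 which squaring removes; this is all the regularity
  that the energy identity requires of a cutoff.\<close>

lemma DERIV_max_0_sq: "((\<lambda>s. (max 0 s)\<^sup>2) has_real_derivative 2 * max 0 s) (at (s::real))"
proof -
  consider "s > 0" | "s < 0" | "s = 0" by linarith
  then show ?thesis
  proof cases
    case 1
    have "((\<lambda>s. s\<^sup>2) has_real_derivative 2 * max 0 s) (at s)"
      using 1 by (auto intro!: derivative_eq_intros)
    then show ?thesis
      by (rule has_field_derivative_transform_within_open[where S="{0<..}"]) (use 1 in auto)
  next
    case 2
    have "((\<lambda>s. 0) has_real_derivative 2 * max 0 s) (at s)" using 2 by auto
    then show ?thesis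
      by (rule has_field_derivative_transform_within_open[where S="{..<0}"]) (use 2 in auto)
  next
    case 3
    have "((\<lambda>h::real. (max 0 h)\<^sup>2 / h) \<longlongrightarrow> 0) (at 0)"
    proof (rule Lim_null_comparison)
      show "\<forall>\<^sub>F h::real in at 0. norm ((max 0 h)\<^sup>2 / h) \<le> \<bar>h\<bar>"
        by (rule always_eventually) (auto simp: max_def power2_eq_square)
      show "((\<lambda>h::real. \<bar>h\<bar>) \<longlongrightarrow> 0) (at 0)" by (rule tendsto_rabs_zero) (rule tendsto_ident_at)
    qed
    then show ?thesis using 3 by (simp add: has_field_derivative_iff)
  qed
qed

text \<open>An explicit quadratic profile instead of a smooth one: its slope is at most 2 / R, and
  it is at least 3/4 on the ball of half the radius.\<close>

definition cutoff :: "real \<Rightarrow> 'a::euclidean_space \<Rightarrow> real" where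
  "cutoff R x = max 0 (1 - (norm x)\<^sup>2 / R\<^sup>2)"

lemma continuous_cutoff: "continuous_on UNIV (cutoff R)"
  unfolding cutoff_def[abs_def] divide_inverse by (intro continuous_intros)

lemma cutoff_bounds: "0 \<le> cutoff R x" "cutoff R x \<le> 1"
  by (auto simp: cutoff_def)

lemma cutoff_eq_0: "R > 0 \<Longrightarrow> norm x \<ge> R \<Longrightarrow> cutoff R x = 0"
  using power_mono[of R "norm x" 2] by (simp add: cutoff_def)

lemma has_pd_cutoff_sq:
  "has_pd (\<lambda>x. of_real ((cutoff R x)\<^sup>2)) (\<lambda>x. of_real (2 * cutoff R x * (- 2 * (x \<bullet> b) / R\<^sup>2))) b"
  unfolding has_pd_def
proof
  fix x
  have "((\<lambda>t. (norm (x + t *\<^sub>R b))\<^sup>2) has_real_derivative 2 * (x \<bullet> b)) (at 0)"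
    unfolding power2_norm_eq_inner
    by (auto intro!: derivative_eq_intros simp: inner_commute has_real_derivative_iff_has_vector_derivative algebra_simps)
  then have "((\<lambda>t. 1 - (norm (x + t *\<^sub>R b))\<^sup>2 / R\<^sup>2) has_real_derivative - (2 * (x \<bullet> b) / R\<^sup>2)) (at 0)"
    using DERIV_diff[OF DERIV_const DERIV_cdivide] by fastforce
  from has_vector_derivative_of_real[OF DERIV_chain2[OF DERIV_max_0_sq this]]
  show "((\<lambda>t. of_real ((cutoff R (x + t *\<^sub>R b))\<^sup>2)) has_vector_derivative
      of_real (2 * cutoff R x * (- 2 * (x \<bullet> b) / R\<^sup>2))) (at 0)"
    by (simp add: cutoff_def)
qed

text \<open>The real part of the energy identity bounds the gradient energy \<open>A\<close>, the
  imaginary part bounds the cut-off mass by the cross term, and the cross term is at most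
  \<open>s * A + q / s\<close>. The free parameter \<open>s\<close> is there to be balanced against
  the growth of \<open>K\<close> in \<open>R\<close>.\<close>

lemma cutoff_energy_estimate:
  fixes f :: "'a::euclidean_space \<Rightarrow> complex"
  assumes f: "smooth_fun f" "f \<in> L2" "(L2norm f)\<^sup>2 \<le> N" and V: "continuous_on UNIV V"
    and R: "R > 0" and s: "s > 0"
    and K: "K \<ge> 0" "\<And>x. norm x \<le> R \<Longrightarrow> Re z - V x \<le> K"
    and y: "(\<integral>x. cmod (S_op V f x - z * f x) * ((cutoff R x)\<^sup>2 * cmod (f x)) \<partial>lborel) \<le> y"
    and q_def: "q = DIM('a) * (4 / R\<^sup>2) * N"
  shows "\<bar>Im z\<bar> * (\<integral>x. (cutoff R x * cmod (f x))\<^sup>2 \<partial>lborel) \<le> s * (4 * q + 2 * K * N + 2 * y) + q / s + y"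
proof -
  define \<eta> :: "'a \<Rightarrow> real" where "\<eta> = cutoff R"
  define A where "A = (\<Sum>b\<in>Basis. \<integral>x. (\<eta> x * cmod (pd b f x))\<^sup>2 \<partial>lborel)"
  define w where "w = (\<integral>x. (\<eta> x * cmod (f x))\<^sup>2 \<partial>lborel)"
  define B where "B = (\<integral>x. V x * (\<eta> x * cmod (f x))\<^sup>2 \<partial>lborel)"
  define Y where "Y = (\<integral>x. (S_op V f x - z * f x) * (of_real ((\<eta> x)\<^sup>2) * cnj (f x)) \<partial>lborel)"
  have cf: "continuous_on UNIV f" by (rule smooth_fun_continuous[OF f(1)])
  have \<eta>: "continuous_on UNIV \<eta>" "\<And>x. \<eta> x \<ge> 0" "\<And>x. \<eta> x \<le> 1" "\<And>x. norm x > R \<Longrightarrow> \<eta> x = 0"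
    by (simp_all add: \<eta>_def continuous_cutoff cutoff_bounds cutoff_eq_0[OF R])
  have A0: "A \<ge> 0" "w \<ge> 0" unfolding A_def w_def by (auto intro!: sum_nonneg)
  have iD: "integrable lborel (\<lambda>x. (2 / R * cmod (f x))\<^sup>2)"
    using L2_integrable[OF f(2)] unfolding power_mult_distrib by (intro integrable_mult_right)
  have iD_le: "DIM('a) * (\<integral>x. (2 / R * cmod (f x))\<^sup>2 \<partial>lborel) \<le> q"
  proof -
    have "(\<integral>x. (2 / R * cmod (f x))\<^sup>2 \<partial>lborel) = 4 / R\<^sup>2 * (L2norm f)\<^sup>2"
      by (simp add: power_mult_distrib L2norm_sq power_divide)
    also have "\<dots> \<le> 4 / R\<^sup>2 * N" using f(3) by (intro mult_left_mono) auto
    finally show ?thesis unfolding q_def mult.assoc by (intro mult_left_mono) auto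
  qed
  \<comment> \<open>The constant 2 / R bounds each partial derivative of the cutoff on the ball;
    outside, the weight itself vanishes.\<close>
  obtain X where X: "of_real A + (\<integral>x. (of_real (V x) - z) * of_real ((\<eta> x * cmod (f x))\<^sup>2) \<partial>lborel) + X = Y"
    "\<And>s. s > 0 \<Longrightarrow> cmod X \<le> s * A + DIM('a) / s * (\<integral>x. (2 / R * cmod (f x))\<^sup>2 \<partial>lborel)"
  proof (rule energy_identity[OF f(1) V \<eta>(1,2), where D="\<lambda>_. 2 / R" and r=R and A=A and z=z])
    show "has_pd (\<lambda>x. of_real ((\<eta> x)\<^sup>2)) (\<lambda>x. of_real (2 * \<eta> x * (- 2 * (x \<bullet> b) / R\<^sup>2))) b" for b
      unfolding \<eta>_def by (rule has_pd_cutoff_sq)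
    show "continuous_on UNIV (\<lambda>x. 2 * \<eta> x * (- 2 * (x \<bullet> b) / R\<^sup>2))" for b
      using R by (intro continuous_intros \<eta>) auto
    show "\<bar>2 * \<eta> x * (- 2 * (x \<bullet> b) / R\<^sup>2)\<bar> \<le> 2 * (\<eta> x * (2 / R))" if "b \<in> Basis" for b x
    proof (cases "norm x \<le> R")
      case True
      have "\<bar>x \<bullet> b\<bar> \<le> R" using Basis_le_norm[OF that, of x] True by simp
      then have "\<bar>- 2 * (x \<bullet> b) / R\<^sup>2\<bar> \<le> 2 / R"
        using R by (simp add: abs_mult field_simps power2_eq_square)
      then have "2 * \<eta> x * \<bar>- 2 * (x \<bullet> b) / R\<^sup>2\<bar> \<le> 2 * \<eta> x * (2 / R)"
        using \<eta>(2)[of x] by (intro mult_left_mono) auto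
      then show ?thesis using \<eta>(2)[of x] by (simp add: abs_mult)
    qed (use \<eta>(4) in auto)
  qed (use \<eta> iD in \<open>auto simp: A_def Y_def\<close>)
  have X_le: "cmod X \<le> t * A + q / t" if "t > 0" for t
  proof -
    have "DIM('a) / t * (\<integral>x. (2 / R * cmod (f x))\<^sup>2 \<partial>lborel) = DIM('a) * (\<integral>x. (2 / R * cmod (f x))\<^sup>2 \<partial>lborel) / t"
      by simp
    also have "\<dots> \<le> q / t" using iD_le that by (intro divide_right_mono) auto
    finally show ?thesis using X(2)[OF that] by linarith
  qed
  have iw: "integrable lborel (\<lambda>x. (\<eta> x * cmod (f x))\<^sup>2)"
    by (rule integrable_bounded_support[where r=R]) (use \<eta> in \<open>auto intro!: continuous_intros cf\<close>)
  have iB: "integrable lborel (\<lambda>x. V x * (\<eta> x * cmod (f x))\<^sup>2)"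
    by (rule integrable_bounded_support[where r=R]) (use \<eta> in \<open>auto intro!: continuous_intros cf V\<close>)
  have "(\<integral>x. (of_real (V x) - z) * of_real ((\<eta> x * cmod (f x))\<^sup>2) \<partial>lborel) =
      (\<integral>x. of_real (V x * (\<eta> x * cmod (f x))\<^sup>2) - z * of_real ((\<eta> x * cmod (f x))\<^sup>2) \<partial>lborel)"
    by (simp add: algebra_simps)
  also have "\<dots> = of_real B - z * of_real w"
  proof -
    have "integrable lborel (\<lambda>x. complex_of_real (V x * (\<eta> x * cmod (f x))\<^sup>2))"
      "integrable lborel (\<lambda>x. complex_of_real ((\<eta> x * cmod (f x))\<^sup>2))"
      using iB iw by (simp_all only: complex_of_real_integrable_eq)
    then show ?thesis
      by (simp only: Bochner_Integration.integral_diff integral_mult_right_zero integrable_mult_right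
          integral_complex_of_real B_def w_def)
  qed
  finally have id: "of_real A + (of_real B - z * of_real w) + X = Y" using X(1) by simp
  have y_bound: "cmod Y \<le> y"
  proof -
    have "cmod Y \<le> (\<integral>x. cmod ((S_op V f x - z * f x) * (of_real ((\<eta> x)\<^sup>2) * cnj (f x))) \<partial>lborel)"
      unfolding Y_def by (rule integral_norm_bound)
    then show ?thesis using y by (simp add: norm_mult norm_power \<eta>_def)
  qed
  have "w \<le> (L2norm f)\<^sup>2"
    unfolding w_def L2norm_sq
  proof (rule integral_mono[OF iw L2_integrable[OF f(2)]])
    show "(\<eta> x * cmod (f x))\<^sup>2 \<le> (cmod (f x))\<^sup>2" for x
      using \<eta>(2,3)[of x] by (intro power_mono mult_left_le_one_le) auto
  qed
  then have wN: "w \<le> N" using f(3) by simp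
  have "Re z * w - B \<le> K * w"
  proof -
    have "Re z * w - B = (\<integral>x. (Re z - V x) * (\<eta> x * cmod (f x))\<^sup>2 \<partial>lborel)"
      using iw iB by (simp add: w_def B_def left_diff_distrib)
    also have "\<dots> \<le> (\<integral>x. K * (\<eta> x * cmod (f x))\<^sup>2 \<partial>lborel)"
    proof (rule integral_mono)
      show "(Re z - V x) * (\<eta> x * cmod (f x))\<^sup>2 \<le> K * (\<eta> x * cmod (f x))\<^sup>2" for x
        using K(2)[of x] \<eta>(4)[of x] by (cases "norm x \<le> R") (auto intro: mult_right_mono)
    qed (use iw iB in \<open>simp_all add: left_diff_distrib\<close>)
    finally show ?thesis by (simp add: w_def)
  qed
  also have "K * w \<le> K * N" using wN K(1) by (rule mult_left_mono)
  finally have KN: "Re z * w - B \<le> K * N" .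
  have "Re Y = A + (B - Re z * w) + Re X" unfolding id[symmetric] by simp
  then have "A \<le> K * N + cmod X + y"
    using KN abs_Re_le_cmod[of X] abs_Re_le_cmod[of Y] y_bound by linarith
  \<comment> \<open>For t = 1/2 the cross term is at most A / 2 + 2 q, and the A / 2 is absorbed on
    the left.\<close>
  with X_le[of "1/2"] have A: "A \<le> 4 * q + 2 * K * N + 2 * y" by simp
  have "Im Y = - (Im z * w) + Im X" unfolding id[symmetric] by simp
  then have "\<bar>Im z * w\<bar> \<le> cmod X + y"
    using abs_Im_le_cmod[of X] abs_Im_le_cmod[of Y] y_bound by linarith
  then have "\<bar>Im z\<bar> * w \<le> s * A + q / s + y"
    using X_le[OF s] A0 by (simp add: abs_mult)
  also have "s * A \<le> s * (4 * q + 2 * K * N + 2 * y)" using A s by simp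
  finally show ?thesis by (simp add: w_def \<eta>_def)
qed

text \<open>The weak equation is tested with the mollifier centred at \<open>x\<close>.
  Mollification commutes with the Laplacian and with \<open>z\<close>, so the commutator with
  multiplication by \<open>V\<close> is the only error. The pairing is bilinear, without
  conjugation.\<close>

lemma S_op_mollify:
  fixes W :: "'a::euclidean_space \<Rightarrow> complex"
  assumes e: "e > 0" and V: "continuous_on UNIV V" and W: "W \<in> L2"
    and orth: "\<And>\<phi>. \<phi> \<in> test_funs \<Longrightarrow> (\<integral>y. W y * (S_op V \<phi> y - z * \<phi> y) \<partial>lborel) = 0"
  shows "S_op V (mollify e W) x - z * mollify e W x =
      (\<integral>y. W y * (of_real (V x - V y) * of_real (mollifier e (x - y))) \<partial>lborel)"
    and "integrable lborel (\<lambda>y. W y * (of_real (V x - V y) * of_real (mollifier e (x - y))))"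
proof -
  define \<rho> where "\<rho> x = complex_of_real (mollifier e x)" for x :: 'a
  \<comment> \<open>The reflected translate, chosen so that pairing it with \<open>W\<close> gives
    the convolution at \<open>x\<close>.\<close>
  define \<phi> where "\<phi> y = \<rho> (x - y)" for y
  have \<rho>: "\<rho> \<in> test_funs" unfolding \<rho>_def[abs_def] by (rule test_funs_mollifier[OF e])
  have \<phi>: "\<phi> \<in> test_funs" unfolding \<phi>_def[abs_def] by (rule test_funs_reflect[OF \<rho>])
  have Wl: "locally_integrable W" by (rule L2_locally_integrable[OF W])
  obtain r where r: "\<And>x. norm x > r \<Longrightarrow> \<rho> x = 0" using test_funs_support[OF \<rho>] by metis
  have lap\<phi>: "laplacian \<phi> y = laplacian \<rho> (x - y)" for y
    unfolding \<phi>_def[abs_def] by (simp add: laplacian_reflect[OF test_funs_smooth[OF \<rho>]])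
  have i1: "integrable lborel (\<lambda>y. W y * laplacian \<rho> (x - y))"
    by (rule integrable_conv_integrand[OF Wl continuous_on_laplacian[OF test_funs_smooth[OF \<rho>]]
          laplacian_support[OF test_funs_smooth[OF \<rho>] r]])
  have i2: "integrable lborel (\<lambda>y. W y * \<rho> (x - y))"
    by (rule integrable_conv_test[OF Wl \<rho>])
  have i3: "integrable lborel (\<lambda>y. W y * (S_op V \<phi> y - z * \<phi> y))"
    by (intro L2_mult_integrable(2) W L2_diff L2_cmult S_op_L2 V \<phi> test_funs_L2)
  have eq: "W y * (of_real (V x - V y) * \<rho> (x - y)) =
      of_real (V x) * (W y * \<rho> (x - y)) - z * (W y * \<rho> (x - y)) - W y * laplacian \<rho> (x - y)
      - W y * (S_op V \<phi> y - z * \<phi> y)" for y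
    unfolding S_op_def lap\<phi> unfolding \<phi>_def by (simp add: algebra_simps)
  show "integrable lborel (\<lambda>y. W y * (of_real (V x - V y) * of_real (mollifier e (x - y))))"
    unfolding \<rho>_def[symmetric] eq using i1 i2 i3 by simp
  have "(\<integral>y. W y * (of_real (V x - V y) * \<rho> (x - y)) \<partial>lborel) =
      of_real (V x) * conv W \<rho> x - z * conv W \<rho> x - conv W (laplacian \<rho>) x - 0"
    unfolding eq conv_def using i1 i2 i3 orth[OF \<phi>] by simp
  then show "S_op V (mollify e W) x - z * mollify e W x =
      (\<integral>y. W y * (of_real (V x - V y) * of_real (mollifier e (x - y))) \<partial>lborel)"
    unfolding S_op_def \<rho>_def[symmetric] laplacian_conv[OF Wl \<rho>] by simp
qed

text \<open>The commutator involves \<open>V\<close> only within distance \<open>e\<close> of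
  \<open>x\<close>, so it is controlled by the oscillation of \<open>V\<close> there. The
  mollification of |W| appears as the other factor because its norm is bounded uniformly in
  \<open>e\<close>.\<close>

lemma S_op_mollify_bound:
  fixes W :: "'a::euclidean_space \<Rightarrow> complex"
  assumes e: "e > 0" and V: "continuous_on UNIV V" and W: "W \<in> L2"
    and orth: "\<And>\<phi>. \<phi> \<in> test_funs \<Longrightarrow> (\<integral>y. W y * (S_op V \<phi> y - z * \<phi> y) \<partial>lborel) = 0"
    and osc: "\<And>y. dist x y < e \<Longrightarrow> \<bar>V x - V y\<bar> \<le> \<omega>"
  shows "cmod (S_op V (mollify e W) x - z * mollify e W x) \<le> \<omega> * cmod (mollify e (\<lambda>y. of_real (cmod (W y))) x)"
proof -
  let ?W = "\<lambda>y. complex_of_real (cmod (W y))"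
  have i: "integrable lborel (\<lambda>y. cmod (W y) * mollifier e (x - y))"
    using integrable_norm[OF integrable_conv_test[OF L2_locally_integrable[OF W] test_funs_mollifier[OF e]], of x]
    by (simp add: norm_mult mollifier_nonneg[OF e])
  have le: "cmod (W y * (of_real (V x - V y) * of_real (mollifier e (x - y)))) \<le> \<omega> * (cmod (W y) * mollifier e (x - y))" for y
  proof (cases "dist x y < e")
    case True
    have "cmod (W y * (of_real (V x - V y) * of_real (mollifier e (x - y)))) =
        \<bar>V x - V y\<bar> * (cmod (W y) * mollifier e (x - y))"
      by (simp only: norm_mult norm_of_real) (simp add: mollifier_nonneg[OF e])
    also have "\<dots> \<le> \<omega> * (cmod (W y) * mollifier e (x - y))"
      by (intro mult_right_mono osc True) (simp add: mollifier_nonneg[OF e])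
    finally show ?thesis .
  next
    case False
    then show ?thesis using mollifier_eq_0[OF e, of "x - y"] by (simp add: dist_norm)
  qed
  have eq: "S_op V (mollify e W) x - z * mollify e W x =
      (\<integral>y. W y * (of_real (V x - V y) * of_real (mollifier e (x - y))) \<partial>lborel)"
    by (rule S_op_mollify(1)[OF e V W orth])
  have "cmod (S_op V (mollify e W) x - z * mollify e W x) \<le>
      (\<integral>y. cmod (W y * (of_real (V x - V y) * of_real (mollifier e (x - y)))) \<partial>lborel)"
    unfolding eq by (rule integral_norm_bound)
  also have "\<dots> \<le> (\<integral>y. \<omega> * (cmod (W y) * mollifier e (x - y)) \<partial>lborel)"
    using S_op_mollify(2)[OF e V W orth] i by (intro integral_mono le integrable_norm) auto
  also have "\<dots> = \<omega> * (\<integral>y. cmod (W y) * mollifier e (x - y) \<partial>lborel)" by simp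
  also have "(\<integral>y. cmod (W y) * mollifier e (x - y) \<partial>lborel) = cmod (mollify e ?W x)"
  proof -
    have "mollify e ?W x = of_real (\<integral>y. cmod (W y) * mollifier e (x - y) \<partial>lborel)"
      unfolding conv_def by (simp only: integral_complex_of_real[symmetric] of_real_mult)
    then show ?thesis by (simp add: mollifier_nonneg[OF e])
  qed
  finally show ?thesis .
qed

text \<open>The mollifications \<open>g j\<close> solve the equation up to an error that tends to 0
  on each ball, so the cutoff estimate shows that their mass on a fixed ball tends to 0. Box
  integrals carry this over to \<open>W\<close>.\<close>

lemma orthogonal_to_range_imp_AE_0:
  fixes V :: "'a::euclidean_space \<Rightarrow> real" and W :: "'a \<Rightarrow> complex"
  assumes V: "continuous_on UNIV V" "\<And>x. V x \<ge> - c * (1 + norm x) powr (2 * \<alpha>)"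
    and c: "c \<ge> 0" and \<alpha>: "0 \<le> \<alpha>" "\<alpha> < 1"
    and W: "W \<in> L2" and z: "Im z \<noteq> 0"
    and orth: "\<And>\<phi>. \<phi> \<in> test_funs \<Longrightarrow> (\<integral>y. W y * (S_op V \<phi> y - z * \<phi> y) \<partial>lborel) = 0"
  shows "AE x in lborel. W x = 0"
proof (rule AE_eq_0_if_box_integrals[OF L2_locally_integrable[OF W]])
  fix a b :: 'a
  define \<epsilon> where "\<epsilon> j = 1 / real (Suc j)" for j :: nat
  have \<epsilon>: "\<epsilon> j > 0" for j by (simp add: \<epsilon>_def)
  define g where "g j = mollify (\<epsilon> j) W" for j
  define U where "U j = mollify (\<epsilon> j) (\<lambda>y. complex_of_real (cmod (W y)))" for j
  define N where "N = (L2norm W)\<^sup>2"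
  note Wl = L2_locally_integrable[OF W]
  have W': "(\<lambda>y. complex_of_real (cmod (W y))) \<in> L2"
    using W by (auto simp: L2_iff)
  have g: "g j \<in> L2" "smooth_fun (g j)" "(L2norm (g j))\<^sup>2 \<le> N" for j
    unfolding g_def N_def using mollify_L2[OF \<epsilon> W] smooth_fun_conv[OF Wl test_funs_mollifier[OF \<epsilon>]]
    by (auto intro: power_mono)
  have "L2norm (\<lambda>y. complex_of_real (cmod (W y))) = L2norm W" by (simp add: L2norm_def)
  then have U: "U j \<in> L2" "(L2norm (U j))\<^sup>2 \<le> N" for j
    unfolding U_def N_def using mollify_L2[OF \<epsilon> W'] by (auto intro: power_mono)
  have gU: "cmod (g j x) \<le> cmod (U j x)" for j x
  proof -
    have "cmod (g j x) \<le> (\<integral>y. cmod (W y) * mollifier (\<epsilon> j) (x - y) \<partial>lborel)"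
      unfolding g_def by (rule mollify_abs_le[OF \<epsilon> Wl])
    also have "U j x = of_real (\<integral>y. cmod (W y) * mollifier (\<epsilon> j) (x - y) \<partial>lborel)"
      unfolding U_def conv_def by (simp only: integral_complex_of_real[symmetric] of_real_mult)
    then have "(\<integral>y. cmod (W y) * mollifier (\<epsilon> j) (x - y) \<partial>lborel) = cmod (U j x)"
      by (simp add: mollifier_nonneg[OF \<epsilon>])
    finally show ?thesis .
  qed
  have N0: "N \<ge> 0" by (simp add: N_def)
  \<comment> \<open>For R >= 1 one has 1 + R <= 2 R, and 2 to the power 2 \<alpha> is at most
    4.\<close>
  define K where "K R = \<bar>Re z\<bar> + 4 * c * R powr (2 * \<alpha>)" for R
  define q where "q R = DIM('a) * (4 / R\<^sup>2) * N" for R :: real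
  \<comment> \<open>Balances the two main contributions: \<open>s R\<close> times R^(2 \<alpha>),
    from the potential, and R^(-2) / \<open>s R\<close>, from the cutoff, both become R^(\<alpha> -
    1).\<close>
  define s where "s R = R powr (- 1 - \<alpha>)" for R :: real
  define G where "G R = s R * (4 * q R + 2 * K R * N) + q R / s R" for R
  have "(G \<longlongrightarrow> 0) at_top"
  proof (rule Lim_transform_eventually)
    let ?n = "real DIM('a) * N * 4"
    have lim: "((\<lambda>R::real. R powr a) \<longlongrightarrow> 0) at_top" if "a < 0" for a
      by (rule tendsto_neg_powr[OF that filterlim_ident])
    have "((\<lambda>R. 4 * ?n * R powr (- 3 - \<alpha>) + 2 * \<bar>Re z\<bar> * N * R powr (- 1 - \<alpha>)
        + (8 * c * N + ?n) * R powr (\<alpha> - 1)) \<longlongrightarrow>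
        4 * ?n * 0 + 2 * \<bar>Re z\<bar> * N * 0 + (8 * c * N + ?n) * 0) at_top"
      by (intro tendsto_add tendsto_mult tendsto_const lim) (use \<alpha> in auto)
    then show "((\<lambda>R. 4 * ?n * R powr (- 3 - \<alpha>) + 2 * \<bar>Re z\<bar> * N * R powr (- 1 - \<alpha>)
        + (8 * c * N + ?n) * R powr (\<alpha> - 1)) \<longlongrightarrow> 0) at_top" by simp
    show "\<forall>\<^sub>F R in at_top. 4 * ?n * R powr (- 3 - \<alpha>) + 2 * \<bar>Re z\<bar> * N * R powr (- 1 - \<alpha>)
        + (8 * c * N + ?n) * R powr (\<alpha> - 1) = G R"
      using eventually_gt_at_top[of 0]
    proof eventually_elim
      case (elim R)
      have 1: "R powr (- 3 - \<alpha>) = R powr (- 1 - \<alpha>) / R\<^sup>2"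
      proof -
        have "R powr (- 3 - \<alpha>) = R powr ((- 1 - \<alpha>) + (- 2))" by simp
        also have "\<dots> = R powr (- 1 - \<alpha>) * R powr (- 2)" by (rule powr_add)
        finally show ?thesis using elim by (simp add: powr_minus divide_inverse)
      qed
      have 2: "R powr (\<alpha> - 1) = R powr (- 1 - \<alpha>) * R powr (2 * \<alpha>)"
        using elim by (simp add: powr_add[symmetric])
      have 3: "R powr (\<alpha> - 1) = 1 / R\<^sup>2 / R powr (- 1 - \<alpha>)"
        using elim by (simp add: powr_diff powr_minus field_simps power2_eq_square)
      have "G R = 4 * ?n * (R powr (- 1 - \<alpha>) / R\<^sup>2) + 2 * \<bar>Re z\<bar> * N * R powr (- 1 - \<alpha>)
          + 8 * c * N * (R powr (- 1 - \<alpha>) * R powr (2 * \<alpha>)) + ?n * (1 / R\<^sup>2 / R powr (- 1 - \<alpha>))"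
        by (simp add: G_def s_def K_def q_def algebra_simps)
      then show ?case unfolding 1[symmetric] 2[symmetric] 3[symmetric] by (simp add: distrib_right)
    qed
  qed
  have Kbound: "Re z - V x \<le> K R" if "norm x \<le> R" "R \<ge> 1" for x R
  proof -
    have "(1 + norm x) powr (2 * \<alpha>) \<le> (2 * R) powr (2 * \<alpha>)"
      using that \<alpha> by (intro powr_mono2) auto
    also have "\<dots> = 2 powr (2 * \<alpha>) * R powr (2 * \<alpha>)" using that by (simp add: powr_mult)
    also have "\<dots> \<le> 2 powr 2 * R powr (2 * \<alpha>)"
      using \<alpha> by (intro mult_right_mono powr_mono) auto
    finally have "c * (1 + norm x) powr (2 * \<alpha>) \<le> c * (4 * R powr (2 * \<alpha>))"
      using c by (intro mult_left_mono) auto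
    then show ?thesis using V(2)[of x] by (simp add: K_def)
  qed
  \<comment> \<open>The order of choices matters: \<open>R\<close> makes \<open>G R\<close> small,
    then \<omega> is fixed, and uniform continuity of \<open>V\<close> on the ball of radius R + 1
    tells how large \<open>j\<close> must be.\<close>
  have local: "(\<lambda>j. \<integral>x. indicator (cball 0 r) x * (cmod (g j x))\<^sup>2 \<partial>lborel) \<longlonglongrightarrow> 0" for r
  proof (rule LIMSEQ_I)
    fix e :: real assume e: "e > 0"
    \<comment> \<open>\<open>G R\<close> and the mollification error contribute at most
      \<open>d\<close> each, and passing from the cutoff to the indicator of the small ball costs a
      factor 2; the total 4 d is half of |Im z| e.\<close>
    define d where "d = \<bar>Im z\<bar> * e / 8"
    have d: "d > 0" using e z by (simp add: d_def)
    have "\<forall>\<^sub>F R in at_top. G R < d \<and> R \<ge> max 1 (2 * \<bar>r\<bar>)"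
      using order_tendstoD(2)[OF \<open>(G \<longlongrightarrow> 0) at_top\<close> d] eventually_ge_at_top by (rule eventually_conj)
    then obtain R where R: "G R < d" "R \<ge> 1" "R \<ge> 2 * \<bar>r\<bar>"
      unfolding eventually_at_top_linorder by auto
    \<comment> \<open>The error enters as 2 \<omega> N with the factor \<open>s R <= 1\<close> and
      once more as \<omega> N; N + 1 keeps the denominator positive.\<close>
    define \<omega> where "\<omega> = d / (3 * (N + 1))"
    have \<omega>: "\<omega> > 0" "3 * (\<omega> * N) \<le> d"
      using d N0 by (auto simp: \<omega>_def field_simps)
    have "uniformly_continuous_on (cball 0 (R + 1)) V"
      by (rule compact_uniformly_continuous[OF continuous_on_subset[OF V(1)]]) auto
    then obtain \<delta> where \<delta>: "\<delta> > 0"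
      "\<And>x y. x \<in> cball 0 (R + 1) \<Longrightarrow> y \<in> cball 0 (R + 1) \<Longrightarrow> dist y x < \<delta> \<Longrightarrow> dist (V y) (V x) < \<omega>"
      using \<omega>(1) unfolding uniformly_continuous_on_def by blast
    have "\<epsilon> \<longlonglongrightarrow> 0" unfolding \<epsilon>_def by (rule LIMSEQ_Suc[OF lim_1_over_n])
    then have "\<forall>\<^sub>F j in sequentially. \<epsilon> j < min 1 \<delta>"
      using \<delta>(1) by (intro order_tendstoD(2)) auto
    then obtain J where J: "\<And>j. j \<ge> J \<Longrightarrow> \<epsilon> j < min 1 \<delta>"
      unfolding eventually_sequentially by blast
    have "(\<integral>x. indicator (cball 0 r) x * (cmod (g j x))\<^sup>2 \<partial>lborel) < e" if j: "j \<ge> J" for j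
    proof -
      have F: "cmod (S_op V (g j) x - z * g j x) \<le> \<omega> * cmod (U j x)" if x: "norm x \<le> R" for x
        unfolding g_def U_def
      proof (rule S_op_mollify_bound[OF \<epsilon> V(1) W orth])
        fix y assume "dist x y < \<epsilon> j"
        then have xy: "dist x y < \<delta>" "dist x y < 1" using J[OF j] by auto
        then have "norm y \<le> R + 1" using x norm_triangle_ineq2[of y x] by (simp add: dist_norm norm_minus_commute)
        then have "dist (V x) (V y) < \<omega>" using x xy by (intro \<delta>(2)) auto
        then show "\<bar>V x - V y\<bar> \<le> \<omega>" by (simp add: dist_real_def)
      qed
      have cF: "continuous_on UNIV (\<lambda>x. S_op V (g j) x - z * g j x)"
        unfolding S_op_def
        by (intro continuous_intros continuous_on_laplacian smooth_fun_continuous g V(1))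
      have cg: "continuous_on UNIV (g j)" by (rule smooth_fun_continuous[OF g(2)])
      have "(\<integral>x. cmod (S_op V (g j) x - z * g j x) * ((cutoff R x)\<^sup>2 * cmod (g j x)) \<partial>lborel) \<le>
          (\<integral>x. \<omega> * (cmod (U j x))\<^sup>2 \<partial>lborel)"
      proof (rule integral_mono)
        show "integrable lborel (\<lambda>x. cmod (S_op V (g j) x - z * g j x) * ((cutoff R x)\<^sup>2 * cmod (g j x)))"
          by (rule integrable_bounded_support[where r=R])
            (use R in \<open>auto intro!: continuous_intros cF cg continuous_cutoff cutoff_eq_0\<close>)
        show "integrable lborel (\<lambda>x. \<omega> * (cmod (U j x))\<^sup>2)"
          using L2_integrable[OF U(1)] by simp
        fix x
        show "cmod (S_op V (g j) x - z * g j x) * ((cutoff R x)\<^sup>2 * cmod (g j x)) \<le> \<omega> * (cmod (U j x))\<^sup>2"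
        proof (cases "norm x \<le> R")
          case True
          have "(cutoff R x)\<^sup>2 * cmod (g j x) \<le> cmod (U j x)"
            using gU[of j x] cutoff_bounds[of R x]
            by (intro order_trans[OF mult_left_le_one_le]) (auto simp: power_le_one)
          then have "cmod (S_op V (g j) x - z * g j x) * ((cutoff R x)\<^sup>2 * cmod (g j x)) \<le>
              (\<omega> * cmod (U j x)) * cmod (U j x)"
            by (intro mult_mono F True) (use \<omega> in auto)
          then show ?thesis by (simp add: power2_eq_square mult_ac)
        next
          case False
          then have "cutoff R x = 0" using R by (intro cutoff_eq_0) auto
          then show ?thesis using \<omega> by simp
        qed
      qed
      also have "\<dots> = \<omega> * (L2norm (U j))\<^sup>2" by (simp add: L2norm_sq)
      also have "\<dots> \<le> \<omega> * N" using U(2) \<omega>(1) by (intro mult_left_mono) auto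
      finally have y: "(\<integral>x. cmod (S_op V (g j) x - z * g j x) * ((cutoff R x)\<^sup>2 * cmod (g j x)) \<partial>lborel) \<le> \<omega> * N" .
      have s: "s R > 0" "s R \<le> 1"
        using R(2) \<alpha> powr_mono[of "- 1 - \<alpha>" 0 R] by (auto simp: s_def)
      have "\<bar>Im z\<bar> * (\<integral>x. (cutoff R x * cmod (g j x))\<^sup>2 \<partial>lborel) \<le>
          s R * (4 * q R + 2 * K R * N + 2 * (\<omega> * N)) + q R / s R + \<omega> * N"
        by (rule cutoff_energy_estimate[OF g(2,1,3) V(1) _ s(1) _ _ y])
          (use R(2) Kbound c in \<open>auto simp: K_def q_def\<close>)
      also have "\<dots> = G R + s R * (2 * (\<omega> * N)) + \<omega> * N" by (simp add: G_def algebra_simps)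
      also have "s R * (2 * (\<omega> * N)) \<le> 1 * (2 * (\<omega> * N))"
        using s \<omega>(1) N0 by (intro mult_right_mono) auto
      finally have 1: "\<bar>Im z\<bar> * (\<integral>x. (cutoff R x * cmod (g j x))\<^sup>2 \<partial>lborel) < 2 * d"
        using R(1) \<omega>(2) by linarith
      have "(\<integral>x. indicator (cball 0 r) x * (cmod (g j x))\<^sup>2 \<partial>lborel) \<le> (\<integral>x. 2 * (cutoff R x * cmod (g j x))\<^sup>2 \<partial>lborel)"
      proof (rule integral_mono)
        have "integrable lborel (\<lambda>x. indicator (cball 0 r) x *\<^sub>R (cmod (g j x))\<^sup>2)"
          using L2_integrable[OF g(1)] by (intro integrable_mult_indicator) auto
        then show "integrable lborel (\<lambda>x. indicator (cball 0 r) x * (cmod (g j x))\<^sup>2)" by simp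
        show "integrable lborel (\<lambda>x. 2 * (cutoff R x * cmod (g j x))\<^sup>2)"
          by (rule integrable_bounded_support[where r=R])
            (use R in \<open>auto intro!: continuous_intros cg continuous_cutoff cutoff_eq_0\<close>)
        fix x
        show "indicator (cball 0 r) x * (cmod (g j x))\<^sup>2 \<le> 2 * (cutoff R x * cmod (g j x))\<^sup>2"
        proof (cases "norm x \<le> r")
          case True
          then have "norm x \<le> R / 2" using R(3) by simp
          then have "(norm x)\<^sup>2 \<le> (R / 2)\<^sup>2" by (intro power_mono) auto
          then have "(norm x)\<^sup>2 / R\<^sup>2 \<le> 1 / 4" using R(2) by (simp add: field_simps power2_eq_square)
          then have "3 / 4 \<le> cutoff R x" unfolding cutoff_def by linarith
          then have "(3 / 4)\<^sup>2 \<le> (cutoff R x)\<^sup>2" by (intro power_mono) auto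
          then have "1 * (cmod (g j x))\<^sup>2 \<le> (2 * (cutoff R x)\<^sup>2) * (cmod (g j x))\<^sup>2"
            by (intro mult_right_mono) (auto simp: power2_eq_square)
          then show ?thesis using True by (simp add: power_mult_distrib)
        qed simp
      qed
      then have "\<bar>Im z\<bar> * (\<integral>x. indicator (cball 0 r) x * (cmod (g j x))\<^sup>2 \<partial>lborel) \<le>
          \<bar>Im z\<bar> * (\<integral>x. 2 * (cutoff R x * cmod (g j x))\<^sup>2 \<partial>lborel)" by (intro mult_left_mono) auto
      also have "\<dots> = 2 * (\<bar>Im z\<bar> * (\<integral>x. (cutoff R x * cmod (g j x))\<^sup>2 \<partial>lborel))" by simp
      also have "\<dots> < 4 * d" using 1 by simp
      also have "\<dots> < \<bar>Im z\<bar> * e" using d by (simp add: d_def mult.commute)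
      finally show ?thesis using z by (simp add: mult_less_cancel_left)
    qed
    then show "\<exists>J. \<forall>j\<ge>J. norm ((\<integral>x. indicator (cball 0 r) x * (cmod (g j x))\<^sup>2 \<partial>lborel) - 0) < e"
      by (intro exI[of _ J]) auto
  qed
  have "\<exists>r. \<forall>x\<in>box a b. norm x \<le> r" using bounded_box[of a b] unfolding bounded_iff .
  then obtain r where r: "\<And>x. x \<in> box a b \<Longrightarrow> norm x \<le> r" by blast
  \<comment> \<open>Pairing with this indicator turns local square-integral convergence into
    convergence of box integrals by Cauchy-Schwarz.\<close>
  let ?I = "\<lambda>x::'a. complex_of_real (indicator (cball 0 r) x)"
  have I: "?I \<in> L2"
    unfolding L2_iff
  proof
    have "integrable lborel (indicat_real (cball (0::'a) r))"
      using emeasure_bounded_finite[OF bounded_cball, of "0::'a" r] by (intro integrable_real_indicator) auto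
    moreover have "(cmod (?I x))\<^sup>2 = indicator (cball 0 r) x" for x by (simp add: indicator_def)
    ultimately show "integrable lborel (\<lambda>x. (cmod (?I x))\<^sup>2)" by simp
    have [measurable]: "cball (0::'a) r \<in> sets borel" by (rule borel_closed) simp
    have "indicat_real (cball (0::'a) r) \<in> borel_measurable borel" by measurable
    then show "?I \<in> borel_measurable lborel" by simp
  qed
  have "(\<lambda>j. \<integral>x. indicator (box a b) x *\<^sub>R g j x \<partial>lborel) \<longlonglongrightarrow> 0"
  proof (rule Lim_null_comparison)
    have "norm (\<integral>x. indicator (box a b) x *\<^sub>R g j x \<partial>lborel) \<le>
        L2norm ?I * sqrt (\<integral>x. indicator (cball 0 r) x * (cmod (g j x))\<^sup>2 \<partial>lborel)" for j
    proof -
      have m: "(\<lambda>x. ?I x * g j x) \<in> borel_measurable lborel"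
        using L2_measurable[OF I] L2_measurable[OF g(1)[of j]] by (rule borel_measurable_times)
      have L: "(\<lambda>x. ?I x * g j x) \<in> L2"
        by (rule L2_dominated[OF g(1)[of j] m, of 1]) (auto simp: norm_mult indicator_def)
      have "norm (\<integral>x. indicator (box a b) x *\<^sub>R g j x \<partial>lborel) \<le> (\<integral>x. norm (indicator (box a b) x *\<^sub>R g j x) \<partial>lborel)"
        by (rule integral_norm_bound)
      also have "\<dots> \<le> (\<integral>x. cmod (?I x) * cmod (?I x * g j x) \<partial>lborel)"
      proof (rule integral_mono'[OF L2_mult_integrable(1)[OF I L]])
        show "norm (indicator (box a b) x *\<^sub>R g j x) \<le> cmod (?I x) * cmod (?I x * g j x)" for x
          using r[of x] by (auto simp: indicator_def)
      qed simp
      also have "\<dots> \<le> L2norm ?I * L2norm (\<lambda>x. ?I x * g j x)"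
        by (rule L2_Cauchy_Schwarz[OF I L])
      also have "L2norm (\<lambda>x. ?I x * g j x) = sqrt (\<integral>x. indicator (cball 0 r) x * (cmod (g j x))\<^sup>2 \<partial>lborel)"
        unfolding L2norm_def
        by (intro arg_cong[where f=sqrt] Bochner_Integration.integral_cong)
          (auto simp: norm_mult power_mult_distrib indicator_def)
      finally show ?thesis .
    qed
    then show "\<forall>\<^sub>F j in sequentially. norm (\<integral>x. indicator (box a b) x *\<^sub>R g j x \<partial>lborel) \<le>
        L2norm ?I * sqrt (\<integral>x. indicator (cball 0 r) x * (cmod (g j x))\<^sup>2 \<partial>lborel)" by simp
    show "(\<lambda>j. L2norm ?I * sqrt (\<integral>x. indicator (cball 0 r) x * (cmod (g j x))\<^sup>2 \<partial>lborel)) \<longlonglongrightarrow> 0"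
      using tendsto_mult[OF tendsto_const tendsto_real_sqrt[OF local[of r]], of "L2norm ?I"] by simp
  qed
  moreover have "(\<lambda>j. \<integral>x. indicator (box a b) x *\<^sub>R g j x \<partial>lborel) \<longlonglongrightarrow> (\<integral>x. indicator (box a b) x *\<^sub>R W x \<partial>lborel)"
    unfolding g_def \<epsilon>_def by (rule mollify_box_tendsto[OF Wl])
  ultimately show "(\<integral>x. indicator (box a b) x *\<^sub>R W x \<partial>lborel) = 0"
    using LIMSEQ_unique by blast
qed

text \<open>Both sides are continuous along the approximating sequence of test functions, in the
  graph norm.\<close>

lemma op_closure_dissipative:
  assumes V: "continuous_on UNIV V" and uv: "(u, v) \<in> op_closure (S_op V)"
  shows "\<bar>Im z\<bar> * L2norm u \<le> L2norm (\<lambda>x. v x - z * u x)"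
proof -
  obtain \<phi> where \<phi>: "\<And>n. \<phi> n \<in> test_funs" "(\<lambda>n. L2norm (\<lambda>x. \<phi> n x - u x)) \<longlonglongrightarrow> 0"
      "(\<lambda>n. L2norm (\<lambda>x. S_op V (\<phi> n) x - v x)) \<longlonglongrightarrow> 0" and L: "u \<in> L2" "v \<in> L2"
    using uv unfolding op_closure_def by blast
  note \<phi>L = test_funs_L2[OF \<phi>(1)] S_op_L2[OF V \<phi>(1)]
  have "(\<lambda>n. \<bar>Im z\<bar> * L2norm (\<phi> n)) \<longlonglongrightarrow> \<bar>Im z\<bar> * L2norm u"
    by (intro tendsto_mult tendsto_const L2norm_tendsto \<phi> \<phi>L L)
  moreover have "(\<lambda>n. L2norm (\<lambda>x. S_op V (\<phi> n) x - z * \<phi> n x)) \<longlonglongrightarrow> L2norm (\<lambda>x. v x - z * u x)"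
  proof (rule L2norm_tendsto)
    show "(\<lambda>x. S_op V (\<phi> n) x - z * \<phi> n x) \<in> L2" for n by (intro L2_diff L2_cmult \<phi>L)
    show "(\<lambda>x. v x - z * u x) \<in> L2" by (intro L2_diff L2_cmult L)
    show "(\<lambda>n. L2norm (\<lambda>x. S_op V (\<phi> n) x - z * \<phi> n x - (v x - z * u x))) \<longlonglongrightarrow> 0"
    proof (rule tendsto_sandwich[OF _ _ tendsto_const])
      have "(\<lambda>n. L2norm (\<lambda>x. S_op V (\<phi> n) x - v x) + cmod (- z) * L2norm (\<lambda>x. \<phi> n x - u x)) \<longlonglongrightarrow> 0 + cmod (- z) * 0"
        by (intro tendsto_intros \<phi>)
      then show "(\<lambda>n. L2norm (\<lambda>x. S_op V (\<phi> n) x - v x) + cmod (- z) * L2norm (\<lambda>x. \<phi> n x - u x)) \<longlonglongrightarrow> 0" by simp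
      show "\<forall>\<^sub>F n in sequentially. L2norm (\<lambda>x. S_op V (\<phi> n) x - z * \<phi> n x - (v x - z * u x)) \<le>
          L2norm (\<lambda>x. S_op V (\<phi> n) x - v x) + cmod (- z) * L2norm (\<lambda>x. \<phi> n x - u x)"
      proof (rule always_eventually, rule allI)
        fix n
        have "L2norm (\<lambda>x. (S_op V (\<phi> n) x - v x) + (- z) * (\<phi> n x - u x)) \<le>
            L2norm (\<lambda>x. S_op V (\<phi> n) x - v x) + L2norm (\<lambda>x. (- z) * (\<phi> n x - u x))"
          by (intro L2norm_triangle L2_cmult L2_diff \<phi>L L)
        then show "L2norm (\<lambda>x. S_op V (\<phi> n) x - z * \<phi> n x - (v x - z * u x)) \<le>
          L2norm (\<lambda>x. S_op V (\<phi> n) x - v x) + cmod (- z) * L2norm (\<lambda>x. \<phi> n x - u x)"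
          unfolding L2norm_cmult by (simp add: algebra_simps)
      qed
    qed simp
  qed
  ultimately show ?thesis
    by (rule LIMSEQ_le) (use S_op_dissipative[OF V \<phi>(1)] in auto)
qed

text \<open>Dissipativity makes the closure of \<open>S_op V - z\<close> injective with closed
  range, and the orthogonality lemma makes this range dense. Concretely, \<open>g\<close> is
  projected onto the closure of the range and the preimages of the approximating sequence are shown
  to converge.\<close>

theorem nonreal_in_resolvent_set:
  fixes V :: "'a::euclidean_space \<Rightarrow> real"
  assumes V: "continuous_on UNIV V" "\<And>x. V x \<ge> - c * (1 + norm x) powr (2 * \<alpha>)"
    and c: "c \<ge> 0" and \<alpha>: "0 \<le> \<alpha>" "\<alpha> < 1" and z: "Im z \<noteq> 0"
  shows "z \<in> op_resolvent_set (op_closure (S_op V))"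
proof -
  have "\<exists>(u, v)\<in>op_closure (S_op V). AE x in lborel. v x - z * u x = g x" if g: "g \<in> L2" for g
  proof -
    define T where "T \<phi> = (\<lambda>x. S_op V \<phi> x - z * \<phi> x)" for \<phi>
    have TL: "T \<phi> \<in> L2" if "\<phi> \<in> test_funs" for \<phi>
      unfolding T_def by (intro L2_diff L2_cmult S_op_L2 test_funs_L2 V that)
    have T_add: "T (\<lambda>x. \<phi> x + \<psi> x) = (\<lambda>x. T \<phi> x + T \<psi> x)" if "\<phi> \<in> test_funs" "\<psi> \<in> test_funs" for \<phi> \<psi>
      unfolding T_def by (simp add: S_op_add test_funs_smooth that algebra_simps)
    have T_cmult: "T (\<lambda>x. k * \<phi> x) = (\<lambda>x. k * T \<phi> x)" if "\<phi> \<in> test_funs" for \<phi> k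
      unfolding T_def by (simp add: S_op_cmult test_funs_smooth that algebra_simps)
    have 0: "(\<lambda>x::'a. 0) \<in> test_funs" by (simp add: test_funs_iff smooth_fun_const)
    obtain m w where m: "\<And>n. m n \<in> T ` test_funs" and w: "w \<in> L2" "(\<lambda>n. L2norm (\<lambda>x. m n x - w x)) \<longlonglongrightarrow> 0"
      and orth: "\<And>h. h \<in> T ` test_funs \<Longrightarrow> (\<integral>x. (g x - w x) * cnj (h x) \<partial>lborel) = 0"
    proof (rule L2_orthogonal_projection[OF _ _ _ _ g, of "T ` test_funs"])
      show "(\<lambda>x. f x + h x) \<in> T ` test_funs" if fh: "f \<in> T ` test_funs" "h \<in> T ` test_funs" for f h
      proof -
        obtain \<phi> \<psi> where "f = T \<phi>" "h = T \<psi>" "\<phi> \<in> test_funs" "\<psi> \<in> test_funs" using fh by blast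
        then show ?thesis
          by (intro image_eqI[of _ T "\<lambda>x. \<phi> x + \<psi> x"] test_funs_add) (simp_all add: T_add)
      qed
      show "(\<lambda>x. k * f x) \<in> T ` test_funs" if f: "f \<in> T ` test_funs" for f k
      proof -
        obtain \<phi> where "f = T \<phi>" "\<phi> \<in> test_funs" using f by blast
        then show ?thesis
          by (intro image_eqI[of _ T "\<lambda>x. k * \<phi> x"] test_funs_cmult) (simp_all add: T_cmult)
      qed
    qed (use TL 0 in auto)
    have "\<forall>n. \<exists>\<phi>. \<phi> \<in> test_funs \<and> m n = T \<phi>" using m by blast
    from choice[OF this]
    obtain \<phi> where \<phi>: "\<And>n. \<phi> n \<in> test_funs" "\<And>n. m n = T (\<phi> n)" by blast
    note \<phi>L = test_funs_L2[OF \<phi>(1)]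
    \<comment> \<open>Dissipativity applied to differences: convergence of the images
      \<open>m n\<close> makes the preimages a Cauchy sequence.\<close>
    have diff: "\<bar>Im z\<bar> * L2norm (\<lambda>x. \<phi> i x - \<phi> j x) \<le> L2norm (\<lambda>x. m i x - w x) + L2norm (\<lambda>x. m j x - w x)" for i j
    proof -
      have eq: "T (\<lambda>x. \<phi> i x + (-1) * \<phi> j x) = (\<lambda>x. m i x + (-1) * m j x)"
        by (subst T_add) (simp_all only: T_cmult \<phi> test_funs_cmult)
      have "\<bar>Im z\<bar> * L2norm (\<lambda>x. \<phi> i x - \<phi> j x) \<le> L2norm (T (\<lambda>x. \<phi> i x + (-1) * \<phi> j x))"
        unfolding T_def using S_op_dissipative[OF V(1) test_funs_diff[OF \<phi>(1) \<phi>(1)], of z i j] by simp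
      also have "\<dots> = L2norm (\<lambda>x. m i x - m j x)" unfolding eq by simp
      also have "\<dots> \<le> L2norm (\<lambda>x. m i x - w x) + L2norm (\<lambda>x. w x - m j x)"
        by (intro L2norm_triangle_diff w) (simp_all add: \<phi> TL)
      finally show ?thesis by (simp add: L2norm_commute[of w])
    qed
    have C: "\<exists>M. \<forall>i\<ge>M. \<forall>j\<ge>M. L2norm (\<lambda>x. \<phi> i x - \<phi> j x) \<le> e" if e: "e > 0" for e
    proof -
      have "\<forall>\<^sub>F n in sequentially. L2norm (\<lambda>x. m n x - w x) < \<bar>Im z\<bar> * e / 2"
        using e z by (intro order_tendstoD(2)[OF w(2)]) auto
      then obtain M where M: "\<And>n. n \<ge> M \<Longrightarrow> L2norm (\<lambda>x. m n x - w x) < \<bar>Im z\<bar> * e / 2"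
        unfolding eventually_sequentially by blast
      have "L2norm (\<lambda>x. \<phi> i x - \<phi> j x) \<le> e" if "i \<ge> M" "j \<ge> M" for i j
      proof -
        have "\<bar>Im z\<bar> * L2norm (\<lambda>x. \<phi> i x - \<phi> j x) \<le> \<bar>Im z\<bar> * e"
          using diff[of i j] M[OF that(1)] M[OF that(2)] by linarith
        then show ?thesis using z by (simp add: mult_le_cancel_left)
      qed
      then show ?thesis by blast
    qed
    obtain u where u: "u \<in> L2" "(\<lambda>n. L2norm (\<lambda>x. \<phi> n x - u x)) \<longlonglongrightarrow> 0"
      by (rule L2_complete[of \<phi>, OF \<phi>L C])
    define v where "v = (\<lambda>x. w x + z * u x)"
    have v: "v \<in> L2" unfolding v_def by (intro L2_add L2_cmult w u)
    have "(\<lambda>n. L2norm (\<lambda>x. S_op V (\<phi> n) x - v x)) \<longlonglongrightarrow> 0"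
    proof (rule tendsto_sandwich[OF _ _ tendsto_const])
      have "(\<lambda>n. L2norm (\<lambda>x. m n x - w x) + cmod z * L2norm (\<lambda>x. \<phi> n x - u x)) \<longlonglongrightarrow> 0 + cmod z * 0"
        by (intro tendsto_intros w u)
      then show "(\<lambda>n. L2norm (\<lambda>x. m n x - w x) + cmod z * L2norm (\<lambda>x. \<phi> n x - u x)) \<longlonglongrightarrow> 0" by simp
      show "\<forall>\<^sub>F n in sequentially. L2norm (\<lambda>x. S_op V (\<phi> n) x - v x) \<le>
          L2norm (\<lambda>x. m n x - w x) + cmod z * L2norm (\<lambda>x. \<phi> n x - u x)"
      proof (rule always_eventually, rule allI)
        fix n
        have "L2norm (\<lambda>x. (m n x - w x) + z * (\<phi> n x - u x)) \<le>
            L2norm (\<lambda>x. m n x - w x) + L2norm (\<lambda>x. z * (\<phi> n x - u x))"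
          by (intro L2norm_triangle L2_cmult L2_diff \<phi>L w u) (simp add: \<phi> TL)
        then show "L2norm (\<lambda>x. S_op V (\<phi> n) x - v x) \<le>
            L2norm (\<lambda>x. m n x - w x) + cmod z * L2norm (\<lambda>x. \<phi> n x - u x)"
          unfolding L2norm_cmult by (simp add: \<phi>(2) T_def v_def algebra_simps)
      qed
    qed simp
    then have uv: "(u, v) \<in> op_closure (S_op V)"
      unfolding op_closure_def using u v \<phi>(1) by blast
    \<comment> \<open>Conjugation converts orthogonality in the inner product into the bilinear form
      of \<open>orthogonal_to_range_imp_AE_0\<close>, for the same \<open>z\<close>.\<close>
    define W where "W = (\<lambda>x. cnj (g x - w x))"
    have "AE x in lborel. W x = 0"
    proof (rule orthogonal_to_range_imp_AE_0[OF V c \<alpha> _ z])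
      show "W \<in> L2" unfolding W_def by (intro L2_cnj L2_diff g w)
      fix \<psi> :: "'a \<Rightarrow> complex" assume "\<psi> \<in> test_funs"
      then have 0: "(\<integral>x. (g x - w x) * cnj (T \<psi> x) \<partial>lborel) = 0" using orth by blast
      have "(\<integral>y. W y * (S_op V \<psi> y - z * \<psi> y) \<partial>lborel) =
          (\<integral>x. cnj ((g x - w x) * cnj (T \<psi> x)) \<partial>lborel)"
        by (simp add: W_def T_def)
      also have "\<dots> = cnj (\<integral>x. (g x - w x) * cnj (T \<psi> x) \<partial>lborel)" by (rule Bochner_Integration.integral_cnj)
      finally show "(\<integral>y. W y * (S_op V \<psi> y - z * \<psi> y) \<partial>lborel) = 0"
        unfolding 0 by simp
    qed
    then have "AE x in lborel. v x - z * u x = g x"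
      by eventually_elim (simp add: W_def v_def)
    then show ?thesis using uv by blast
  qed
  moreover have "L2norm u \<le> 1 / \<bar>Im z\<bar> * L2norm (\<lambda>x. v x - z * u x)" if "(u, v) \<in> op_closure (S_op V)" for u v
    using op_closure_dissipative[OF V(1) that, of z] z by (simp add: field_simps)
  ultimately show ?thesis unfolding op_resolvent_set_def by blast
qed

section \<open>Exponentially localised quasimodes in one dimension\<close>

lemma has_pd_real:
  assumes "\<And>x. (f has_real_derivative f' x) (at x)"
  shows "has_pd (\<lambda>x. of_real (f x)) (\<lambda>x. of_real (f' x)) (1::real)"
  unfolding has_pd_def
proof
  fix x
  have "((\<lambda>t. f (x + t *\<^sub>R 1)) has_real_derivative f' x) (at 0)"
    using DERIV_chain2[of f "f' x" "\<lambda>t. x + t" 0 1] assms[of x] DERIV_add[OF DERIV_const DERIV_ident, of x 0]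
    by simp
  then show "((\<lambda>t. complex_of_real (f (x + t *\<^sub>R 1))) has_vector_derivative complex_of_real (f' x)) (at 0)"
    by (rule has_vector_derivative_of_real)
qed

text \<open>An exponential weight \<open>\<eta>\<close> with \<open>|\<eta>'| \<le> \<eta>\<close>. It is truncated at \<open>exp T\<close> because the test
  functions approximating the eigenfunction have no uniform decay of their own.\<close>
definition trunc_cosh :: "real \<Rightarrow> real \<Rightarrow> real" where
  "trunc_cosh T t = exp T * cosh t / (exp T + cosh t)"

section \<open>Bounds for the truncated exponential weight\<close>

lemma trunc_cosh_denom_pos: "exp T + cosh t > (0::real)"
  by (intro add_pos_pos) auto

lemma trunc_cosh_pos: "trunc_cosh T t > 0"
  using trunc_cosh_denom_pos[of T t] by (simp add: trunc_cosh_def)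

lemma trunc_cosh_le_cosh: "trunc_cosh T t \<le> cosh t"
  using trunc_cosh_denom_pos[of T t] by (simp add: trunc_cosh_def pos_divide_le_eq algebra_simps)

lemma trunc_cosh_le_exp: "trunc_cosh T t \<le> exp T"
  using trunc_cosh_denom_pos[of T t] by (simp add: trunc_cosh_def pos_divide_le_eq algebra_simps)

text \<open>The weight is half the harmonic mean of \<open>exp T\<close> and \<open>cosh t\<close>,
  hence lies between half their minimum and their minimum.\<close>

lemma trunc_cosh_ge:
  assumes "0 < m" "m \<le> exp T" "m \<le> cosh t"
  shows "m / 2 \<le> trunc_cosh T t"
proof -
  have "m * exp T \<le> exp T * cosh t" "m * cosh t \<le> exp T * cosh t"
    using assms by (auto simp: mult.commute[of _ "exp T"] intro: mult_right_mono)
  then have "m * (exp T + cosh t) \<le> 2 * (exp T * cosh t)" unfolding distrib_left by linarith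
  then show ?thesis using trunc_cosh_denom_pos[of T t] by (simp add: trunc_cosh_def pos_le_divide_eq)
qed

lemma continuous_trunc_cosh: "continuous_on UNIV (trunc_cosh T)"
  unfolding trunc_cosh_def[abs_def]
  using trunc_cosh_denom_pos[of T] by (intro continuous_intros) (auto simp: less_imp_neq[symmetric])

lemma trunc_cosh_deriv:
  "((\<lambda>t. (trunc_cosh T t)\<^sup>2) has_real_derivative
     2 * trunc_cosh T t * ((exp T)\<^sup>2 * sinh t / (exp T + cosh t)\<^sup>2)) (at t)"
proof -
  have "(trunc_cosh T has_real_derivative (exp T)\<^sup>2 * sinh t / (exp T + cosh t)\<^sup>2) (at t)"
    unfolding trunc_cosh_def[abs_def] using trunc_cosh_denom_pos[of T t]
    by (auto intro!: derivative_eq_intros simp: power2_eq_square) (simp add: algebra_simps)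
  then show ?thesis by (auto intro!: derivative_eq_intros)
qed

lemma trunc_cosh_deriv_bound:
  "\<bar>2 * trunc_cosh T t * ((exp T)\<^sup>2 * sinh t / (exp T + cosh t)\<^sup>2)\<bar> \<le> 2 * (trunc_cosh T t * trunc_cosh T t)"
proof -
  let ?d = "exp T + cosh t"
  have d: "?d > 0" by (rule trunc_cosh_denom_pos)
  have "\<bar>sinh t\<bar> \<le> cosh t"
    by (rule power2_le_imp_le) (use cosh_square_eq[of t] in auto)
  then have "exp T * \<bar>sinh t\<bar> \<le> cosh t * ?d"
    using mult_mono[of "exp T" ?d "\<bar>sinh t\<bar>" "cosh t"] by (simp add: mult.commute)
  then have "exp T * (exp T * \<bar>sinh t\<bar>) / ?d\<^sup>2 \<le> exp T * (cosh t * ?d) / ?d\<^sup>2"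
    by (intro divide_right_mono mult_left_mono) auto
  also have "\<dots> = trunc_cosh T t" using d by (simp add: trunc_cosh_def power2_eq_square)
  finally have "\<bar>(exp T)\<^sup>2 * sinh t / ?d\<^sup>2\<bar> \<le> trunc_cosh T t"
    by (simp add: abs_mult power2_eq_square mult.assoc)
  then have "2 * trunc_cosh T t * \<bar>(exp T)\<^sup>2 * sinh t / ?d\<^sup>2\<bar> \<le> 2 * trunc_cosh T t * trunc_cosh T t"
    using trunc_cosh_pos[of T t] by (intro mult_left_mono) auto
  then show ?thesis using trunc_cosh_pos[of T t] by (simp add: abs_mult mult.assoc)
qed

text \<open>An Agmon estimate for approximate eigenfunctions. The constant \<open>C\<close> is
  independent of \<open>T\<close>: truncation caps the squared weight at exp(2 T), which the
  residual exp(- 2 T) compensates exactly.\<close>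

lemma weighted_energy_bound:
  fixes \<phi> :: "real \<Rightarrow> complex"
  assumes V: "continuous_on UNIV V" "\<And>t. V t \<ge> 0" "\<And>t. \<bar>t\<bar> \<ge> t0 \<Longrightarrow> V t \<ge> \<gamma> + 3"
    and \<phi>: "\<phi> \<in> test_funs" "L2norm \<phi> = 1"
    and F: "L2norm (\<lambda>t. S_op V \<phi> t - of_real \<gamma> * \<phi> t) \<le> exp (- 2 * T)"
    and C_def: "C = 1 + (\<bar>\<gamma>\<bar> + 3) * (cosh t0)\<^sup>2"
  shows "(\<integral>t. (trunc_cosh T t * cmod (pd 1 \<phi> t))\<^sup>2 \<partial>lborel) \<le> 2 * C"
    and "(\<integral>t. (trunc_cosh T t * cmod (\<phi> t))\<^sup>2 \<partial>lborel) \<le> C"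
proof -
  define \<eta> where "\<eta> = trunc_cosh T"
  define f where "f = (\<lambda>t. S_op V \<phi> t - of_real \<gamma> * \<phi> t)"
  define A where "A = (\<integral>t. (\<eta> t * cmod (pd 1 \<phi> t))\<^sup>2 \<partial>lborel)"
  define E where "E = (\<integral>t. (\<eta> t * cmod (\<phi> t))\<^sup>2 \<partial>lborel)"
  define Y where "Y = (\<integral>t. f t * (of_real ((\<eta> t)\<^sup>2) * cnj (\<phi> t)) \<partial>lborel)"
  obtain r where r: "\<And>t. norm t > r \<Longrightarrow> \<phi> t = 0" using test_funs_support[OF \<phi>(1)] by metis
  have \<eta>: "continuous_on UNIV \<eta>" "\<And>t. \<eta> t \<ge> 0" "\<And>t. \<eta> t \<le> exp T" "\<And>t. \<eta> t \<le> cosh t"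
    unfolding \<eta>_def
    using continuous_trunc_cosh trunc_cosh_pos less_imp_le trunc_cosh_le_exp trunc_cosh_le_cosh by blast+
  have c\<phi>: "continuous_on UNIV \<phi>" by (rule test_funs_continuous[OF \<phi>(1)])
  have L: "f \<in> L2" "\<phi> \<in> L2" unfolding f_def by (intro L2_diff L2_cmult S_op_L2 test_funs_L2 V(1) \<phi>(1))+
  have iE: "integrable lborel (\<lambda>t. (\<eta> t * cmod (\<phi> t))\<^sup>2)"
    by (rule integrable_bounded_support[where r=r]) (use r in \<open>auto intro!: continuous_intros \<eta> c\<phi>\<close>)
  have iV: "integrable lborel (\<lambda>t. (V t - \<gamma>) * (\<eta> t * cmod (\<phi> t))\<^sup>2)"
    by (rule integrable_bounded_support[where r=r]) (use r in \<open>auto intro!: continuous_intros \<eta> c\<phi> V(1)\<close>)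
  obtain X where X: "of_real A + (\<integral>t. (of_real (V t) - of_real \<gamma>) * of_real ((\<eta> t * cmod (\<phi> t))\<^sup>2) \<partial>lborel) + X = Y"
    "\<And>s. s > 0 \<Longrightarrow> cmod X \<le> s * A + DIM(real) / s * E"
  proof (rule energy_identity[OF test_funs_smooth[OF \<phi>(1)] V(1) \<eta>(1,2), where D=\<eta> and r=r and A=A and z="of_real \<gamma>"])
    show "has_pd (\<lambda>x. of_real ((\<eta> x)\<^sup>2)) (\<lambda>t. of_real (2 * \<eta> t * ((exp T)\<^sup>2 * sinh t / (exp T + cosh t)\<^sup>2))) b"
      if "b \<in> Basis" for b
      using that has_pd_real[OF trunc_cosh_deriv] by (simp add: \<eta>_def)
    show "continuous_on UNIV (\<lambda>t. 2 * \<eta> t * ((exp T)\<^sup>2 * sinh t / (exp T + cosh t)\<^sup>2))" for b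
      using trunc_cosh_denom_pos[of T] by (intro continuous_intros \<eta>) (auto simp: less_imp_neq[symmetric])
    show "\<bar>2 * \<eta> t * ((exp T)\<^sup>2 * sinh t / (exp T + cosh t)\<^sup>2)\<bar> \<le> 2 * (\<eta> t * \<eta> t)" for t b
      unfolding \<eta>_def by (rule trunc_cosh_deriv_bound)
  qed (use r iE in \<open>auto simp: A_def E_def Y_def f_def\<close>)
  have int_eq: "(\<integral>t. (of_real (V t) - of_real \<gamma>) * of_real ((\<eta> t * cmod (\<phi> t))\<^sup>2) \<partial>lborel) =
      complex_of_real (\<integral>t. (V t - \<gamma>) * (\<eta> t * cmod (\<phi> t))\<^sup>2 \<partial>lborel)"
    by (simp only: integral_complex_of_real[symmetric] of_real_mult of_real_diff)
  have "cmod Y \<le> 1"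
  proof -
    have "cmod Y \<le> (\<integral>t. cmod (f t * (of_real ((\<eta> t)\<^sup>2) * cnj (\<phi> t))) \<partial>lborel)"
      unfolding Y_def by (rule integral_norm_bound)
    also have "\<dots> \<le> (\<integral>t. (exp T)\<^sup>2 * (cmod (f t) * cmod (\<phi> t)) \<partial>lborel)"
    proof (rule integral_mono')
      show "integrable lborel (\<lambda>t. (exp T)\<^sup>2 * (cmod (f t) * cmod (\<phi> t)))"
        using L2_mult_integrable(1)[OF L] by simp
      fix t
      have "(\<eta> t)\<^sup>2 * (cmod (f t) * cmod (\<phi> t)) \<le> (exp T)\<^sup>2 * (cmod (f t) * cmod (\<phi> t))"
        using \<eta> by (intro mult_right_mono power_mono) auto
      then show "cmod (f t * (of_real ((\<eta> t)\<^sup>2) * cnj (\<phi> t))) \<le> (exp T)\<^sup>2 * (cmod (f t) * cmod (\<phi> t))"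
        by (simp add: norm_mult norm_power mult_ac)
    qed simp
    also have "\<dots> \<le> (exp T)\<^sup>2 * (L2norm f * L2norm \<phi>)"
      using L2_Cauchy_Schwarz[OF L] by simp
    also have "\<dots> \<le> (exp T)\<^sup>2 * exp (- 2 * T)"
      using F \<phi>(2) by (simp add: f_def)
    also have "\<dots> = 1" by (simp add: exp_double[symmetric] exp_minus)
    finally show ?thesis .
  qed
  moreover have "Re Y = A + (\<integral>t. (V t - \<gamma>) * (\<eta> t * cmod (\<phi> t))\<^sup>2 \<partial>lborel) + Re X"
    unfolding X(1)[symmetric] int_eq by simp
  \<comment> \<open>Half of the gradient energy is kept at the price of 2 E. This is why the
    potential is required to exceed \<gamma> by 3 for large |t|: one \<open>E\<close> is left
    over.\<close>
  moreover have "cmod X \<le> A / 2 + 2 * E" using X(2)[of "1/2"] by simp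
  ultimately have 1: "A / 2 + (\<integral>t. (V t - \<gamma>) * (\<eta> t * cmod (\<phi> t))\<^sup>2 \<partial>lborel) \<le> 1 + 2 * E"
    using abs_Re_le_cmod[of X] abs_Re_le_cmod[of Y] by linarith
  \<comment> \<open>For |t| < t0 the potential may lie below \<gamma>; there the weight is at most
    \<open>cosh t0\<close>, and since \<phi> has norm 1 the loss is a fixed constant.\<close>
  have "3 * E - (\<bar>\<gamma>\<bar> + 3) * (cosh t0)\<^sup>2 \<le> (\<integral>t. (V t - \<gamma>) * (\<eta> t * cmod (\<phi> t))\<^sup>2 \<partial>lborel)"
  proof -
    have "3 * E - (\<bar>\<gamma>\<bar> + 3) * (cosh t0)\<^sup>2 =
        (\<integral>t. 3 * (\<eta> t * cmod (\<phi> t))\<^sup>2 - (\<bar>\<gamma>\<bar> + 3) * (cosh t0)\<^sup>2 * (cmod (\<phi> t))\<^sup>2 \<partial>lborel)"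
      using iE L2_integrable[OF L(2)] \<phi>(2) by (simp add: E_def L2norm_sq[symmetric])
    also have "\<dots> \<le> (\<integral>t. (V t - \<gamma>) * (\<eta> t * cmod (\<phi> t))\<^sup>2 \<partial>lborel)"
    proof (rule integral_mono[OF _ iV])
      show "integrable lborel (\<lambda>t. 3 * (\<eta> t * cmod (\<phi> t))\<^sup>2 - (\<bar>\<gamma>\<bar> + 3) * (cosh t0)\<^sup>2 * (cmod (\<phi> t))\<^sup>2)"
        using iE L2_integrable[OF L(2)] by simp
      fix t
      show "3 * (\<eta> t * cmod (\<phi> t))\<^sup>2 - (\<bar>\<gamma>\<bar> + 3) * (cosh t0)\<^sup>2 * (cmod (\<phi> t))\<^sup>2 \<le> (V t - \<gamma>) * (\<eta> t * cmod (\<phi> t))\<^sup>2"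
      proof (cases "\<bar>t\<bar> \<ge> t0")
        case True
        then have "3 * (\<eta> t * cmod (\<phi> t))\<^sup>2 \<le> (V t - \<gamma>) * (\<eta> t * cmod (\<phi> t))\<^sup>2"
          using V(3)[of t] by (intro mult_right_mono) auto
        moreover have "0 \<le> (\<bar>\<gamma>\<bar> + 3) * (cosh t0)\<^sup>2 * (cmod (\<phi> t))\<^sup>2" by simp
        ultimately show ?thesis by linarith
      next
        case False
        then have "cosh t \<le> cosh t0"
          using cosh_real_nonneg_le_iff[of "\<bar>t\<bar>" "t0"] by simp
        then have "(\<eta> t)\<^sup>2 \<le> (cosh t0)\<^sup>2" using \<eta>(2)[of t] \<eta>(4)[of t] by (intro power_mono) auto
        then have "(\<bar>\<gamma>\<bar> + 3) * (\<eta> t * cmod (\<phi> t))\<^sup>2 \<le> (\<bar>\<gamma>\<bar> + 3) * (cosh t0)\<^sup>2 * (cmod (\<phi> t))\<^sup>2"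
          unfolding power_mult_distrib mult.assoc by (intro mult_left_mono mult_right_mono) auto
        moreover have "(3 - (\<bar>\<gamma>\<bar> + 3)) * (\<eta> t * cmod (\<phi> t))\<^sup>2 \<le> (V t - \<gamma>) * (\<eta> t * cmod (\<phi> t))\<^sup>2"
          using V(2)[of t] by (intro mult_right_mono) auto
        ultimately show ?thesis by (simp only: left_diff_distrib)
      qed
    qed
    finally show ?thesis .
  qed
  then have "A / 2 + E \<le> C" using 1 by (simp add: C_def)
  moreover have "A \<ge> 0" "E \<ge> 0" by (simp_all add: A_def E_def)
  ultimately show "(\<integral>t. (trunc_cosh T t * cmod (pd 1 \<phi> t))\<^sup>2 \<partial>lborel) \<le> 2 * C"
    "(\<integral>t. (trunc_cosh T t * cmod (\<phi> t))\<^sup>2 \<partial>lborel) \<le> C"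
    unfolding A_def E_def \<eta>_def by linarith+
qed

text \<open>Test functions that approximate the eigenfunction in the graph norm nearly solve the
  equation; they can be normalised because their norms tend to that of \<open>u\<close>, which is
  positive.\<close>

lemma eigenvalue_approx:
  fixes V :: "'a::euclidean_space \<Rightarrow> real"
  assumes V: "continuous_on UNIV V" and \<gamma>: "\<gamma> \<in> op_real_eigenvalues (op_closure (S_op V))" and e: "e > 0"
  obtains \<phi> where "\<phi> \<in> test_funs" "L2norm \<phi> = 1" "L2norm (\<lambda>t. S_op V \<phi> t - of_real \<gamma> * \<phi> t) \<le> e"
proof -
  obtain u v where uv: "(u, v) \<in> op_closure (S_op V)" "\<not> (AE x in lborel. u x = 0)"
      "AE x in lborel. v x = of_real \<gamma> * u x"
    using \<gamma> unfolding op_real_eigenvalues_def by blast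
  obtain \<phi> where \<phi>: "\<And>n. \<phi> n \<in> test_funs" "(\<lambda>n. L2norm (\<lambda>x. \<phi> n x - u x)) \<longlonglongrightarrow> 0"
      "(\<lambda>n. L2norm (\<lambda>x. S_op V (\<phi> n) x - v x)) \<longlonglongrightarrow> 0" and L: "u \<in> L2" "v \<in> L2"
    using uv(1) unfolding op_closure_def by blast
  note \<phi>L = test_funs_L2[OF \<phi>(1)] S_op_L2[OF V \<phi>(1)]
  have u0: "L2norm u > 0" using L2norm_eq_0_imp_AE[OF L(1)] uv(2) L2norm_nonneg[of u] by linarith
  have lim1: "(\<lambda>n. L2norm (\<phi> n)) \<longlonglongrightarrow> L2norm u"
    by (rule L2norm_tendsto[OF \<phi>L(1) L(1) \<phi>(2)])
  have lim2: "(\<lambda>n. L2norm (\<lambda>x. S_op V (\<phi> n) x - of_real \<gamma> * \<phi> n x)) \<longlonglongrightarrow> 0"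
  proof (rule tendsto_sandwich[OF _ _ tendsto_const])
    have "(\<lambda>n. L2norm (\<lambda>x. S_op V (\<phi> n) x - v x) + \<bar>\<gamma>\<bar> * L2norm (\<lambda>x. \<phi> n x - u x)) \<longlonglongrightarrow> 0 + \<bar>\<gamma>\<bar> * 0"
      by (intro tendsto_intros \<phi>)
    then show "(\<lambda>n. L2norm (\<lambda>x. S_op V (\<phi> n) x - v x) + \<bar>\<gamma>\<bar> * L2norm (\<lambda>x. \<phi> n x - u x)) \<longlonglongrightarrow> 0" by simp
    show "\<forall>\<^sub>F n in sequentially. L2norm (\<lambda>x. S_op V (\<phi> n) x - of_real \<gamma> * \<phi> n x) \<le>
        L2norm (\<lambda>x. S_op V (\<phi> n) x - v x) + \<bar>\<gamma>\<bar> * L2norm (\<lambda>x. \<phi> n x - u x)"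
    proof (rule always_eventually, rule allI)
      fix n
      have "L2norm (\<lambda>x. S_op V (\<phi> n) x - of_real \<gamma> * \<phi> n x) =
          L2norm (\<lambda>x. (S_op V (\<phi> n) x - v x) + (- of_real \<gamma>) * (\<phi> n x - u x))"
        by (rule L2norm_cong_AE)
          (use uv(3) L2_measurable[OF \<phi>L(1)] L2_measurable[OF \<phi>L(2)] L2_measurable[OF L(1)] L2_measurable[OF L(2)]
            in \<open>auto simp: algebra_simps\<close>)
      also have "\<dots> \<le> L2norm (\<lambda>x. S_op V (\<phi> n) x - v x) + L2norm (\<lambda>x. (- of_real \<gamma>) * (\<phi> n x - u x))"
        by (intro L2norm_triangle L2_cmult L2_diff \<phi>L L)
      finally show "L2norm (\<lambda>x. S_op V (\<phi> n) x - of_real \<gamma> * \<phi> n x) \<le>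
        L2norm (\<lambda>x. S_op V (\<phi> n) x - v x) + \<bar>\<gamma>\<bar> * L2norm (\<lambda>x. \<phi> n x - u x)"
        unfolding L2norm_cmult by simp
    qed
  qed simp
  \<comment> \<open>The residual is required to be small relative to half the norm of
    \<open>u\<close>, so that division by the norm of \<phi> n leaves at most
    \<open>e\<close>.\<close>
  have "\<forall>\<^sub>F n in sequentially. L2norm (\<phi> n) > L2norm u / 2 \<and>
      L2norm (\<lambda>x. S_op V (\<phi> n) x - of_real \<gamma> * \<phi> n x) < e * (L2norm u / 2)"
    using u0 e by (intro eventually_conj order_tendstoD(1)[OF lim1] order_tendstoD(2)[OF lim2]) auto
  then obtain n where n: "L2norm (\<phi> n) > L2norm u / 2"
      "L2norm (\<lambda>x. S_op V (\<phi> n) x - of_real \<gamma> * \<phi> n x) < e * (L2norm u / 2)"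
    using eventually_happens'[OF sequentially_bot] by blast
  define c where "c = L2norm (\<phi> n)"
  have c: "c > 0" using n(1) u0 by (simp add: c_def)
  let ?\<psi> = "\<lambda>x. of_real (1 / c) * \<phi> n x"
  show ?thesis
  proof
    show "?\<psi> \<in> test_funs" by (rule test_funs_cmult[OF \<phi>(1)])
    show "L2norm ?\<psi> = 1" unfolding L2norm_cmult using c by (simp add: c_def norm_divide)
    have "L2norm (\<lambda>t. S_op V ?\<psi> t - of_real \<gamma> * ?\<psi> t) =
        L2norm (\<lambda>t. of_real (1 / c) * (S_op V (\<phi> n) t - of_real \<gamma> * \<phi> n t))"
      by (simp only: S_op_cmult[OF test_funs_smooth[OF \<phi>(1)]] right_diff_distrib mult.left_commute)
    also have "\<dots> = L2norm (\<lambda>t. S_op V (\<phi> n) t - of_real \<gamma> * \<phi> n t) / c"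
      unfolding L2norm_cmult using c by (simp add: norm_divide)
    also have "\<dots> \<le> e"
    proof -
      have "L2norm (\<lambda>t. S_op V (\<phi> n) t - of_real \<gamma> * \<phi> n t) < e * c"
        using n(2) mult_strict_left_mono[OF n(1) e] unfolding c_def by linarith
      then show ?thesis using c by (simp add: pos_divide_le_eq)
    qed
    finally show "L2norm (\<lambda>t. S_op V ?\<psi> t - of_real \<gamma> * ?\<psi> t) \<le> e" .
  qed
qed

text \<open>The indicator of the interval of half-length T - 1 is convolved with a mollifier of
  radius 1. Derivatives fall on the mollifier, so their bounds are the integrals of its absolute
  derivatives and do not depend on \<open>T\<close>.\<close>

lemma smooth_plateau:
  obtains C :: real and \<zeta> :: "real \<Rightarrow> real \<Rightarrow> complex" where "C \<ge> 0" "\<And>T. smooth_fun (\<zeta> T)"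
    "\<And>T t. \<bar>t\<bar> \<le> T - 2 \<Longrightarrow> \<zeta> T t = 1" "\<And>T t. \<bar>t\<bar> \<ge> T \<Longrightarrow> \<zeta> T t = 0"
    "\<And>T t. cmod (\<zeta> T t) \<le> 1" "\<And>T t. cmod (1 - \<zeta> T t) \<le> 1"
    "\<And>T t. cmod (pd 1 (\<zeta> T) t) \<le> C" "\<And>T t. cmod (pd 1 (pd 1 (\<zeta> T)) t) \<le> C"
proof -
  define \<rho> where "\<rho> t = complex_of_real (mollifier 1 t)" for t :: real
  have \<rho>: "\<rho> \<in> test_funs" unfolding \<rho>_def[abs_def] by (rule test_funs_mollifier) simp
  define I where "I T t = complex_of_real (indicator {- (T - 1) .. T - 1} t)" for T t :: real
  define \<zeta> where "\<zeta> T = conv (I T) \<rho>" for T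
  have I: "locally_integrable (I T)" for T
    unfolding locally_integrable_def
  proof (intro conjI allI)
    show "I T \<in> borel_measurable lborel" unfolding I_def[abs_def] by measurable
    have "integrable lborel (\<lambda>x::real. indicat_real (cball 0 r \<inter> {- (T - 1)..T - 1}) x)" for r
      using emeasure_bounded_finite[of "cball 0 r \<inter> {- (T - 1)..T - 1}"]
      by (intro integrable_real_indicator) (auto intro: bounded_subset[OF bounded_cball])
    then show "integrable lborel (\<lambda>x. indicat_real (cball 0 r) x * norm (I T x))" for r
      by (simp add: I_def indicator_inter_arith)
  qed
  have bd: "cmod (conv (I T) k t) \<le> (\<integral>s. cmod (k s) \<partial>lborel)" if k: "k \<in> test_funs" for T k t
  proof -
    obtain r where r: "\<And>x. norm x > r \<Longrightarrow> k x = 0" using test_funs_support[OF k] by metis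
    have ik: "integrable lborel (\<lambda>s. cmod (k s))"
      by (rule integrable_norm, rule integrable_bounded_support[OF test_funs_continuous[OF k] r])
    have ik': "integrable lborel (\<lambda>s. cmod (k (t - s)))"
      using lborel_integrable_real_affine[OF ik, of "-1" t] by simp
    have "cmod (conv (I T) k t) \<le> (\<integral>s. cmod (I T s * k (t - s)) \<partial>lborel)"
      unfolding conv_def by (rule integral_norm_bound)
    also have "\<dots> \<le> (\<integral>s. cmod (k (t - s)) \<partial>lborel)"
      by (rule integral_mono'[OF ik']) (auto simp: I_def norm_mult indicator_def)
    also have "\<dots> = (\<integral>s. cmod (k s) \<partial>lborel)"
      using lborel_integral_real_affine[of "-1" "\<lambda>s. cmod (k s)" t] by simp
    finally show ?thesis .
  qed
  have re: "\<zeta> T t = complex_of_real (\<integral>s. indicator {- (T - 1) .. T - 1} s * mollifier 1 (t - s) \<partial>lborel)" for T t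
    unfolding \<zeta>_def conv_def I_def \<rho>_def by (simp only: integral_complex_of_real[symmetric] of_real_mult)
  define m where "m T t = (\<integral>s. indicator {- (T - 1) .. T - 1} s * mollifier 1 (t - s :: real) \<partial>lborel)" for T t :: real
  have mo: "mollifier 1 (t::real) \<ge> 0" "\<bar>t\<bar> \<ge> 1 \<Longrightarrow> mollifier 1 t = 0" for t
    using mollifier_nonneg[of 1 t] mollifier_eq_0[of 1 t] by auto
  have m01: "0 \<le> m T t" "m T t \<le> 1" for T t
  proof -
    show "0 \<le> m T t" unfolding m_def using mo by simp
    have "m T t \<le> (\<integral>s. mollifier 1 (t - s) \<partial>lborel)"
      unfolding m_def using mo
      by (intro integral_mono' integrable_mollifier_translate) (auto simp: indicator_def)
    then show "m T t \<le> 1" by (simp add: integral_mollifier_translate)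
  qed
  have \<zeta>m: "\<zeta> T t = of_real (m T t)" for T t by (simp add: re m_def)
  show ?thesis
  proof (rule that[of "max (\<integral>s. cmod (pd 1 \<rho> s) \<partial>lborel) (\<integral>s. cmod (pd 1 (pd 1 \<rho>) s) \<partial>lborel)" \<zeta>])
    show "smooth_fun (\<zeta> T)" for T unfolding \<zeta>_def by (rule smooth_fun_conv[OF I \<rho>])
    show "\<zeta> T t = 1" if "\<bar>t\<bar> \<le> T - 2" for T t
    proof -
      have "indicator {- (T - 1) .. T - 1} s * mollifier 1 (t - s) = mollifier 1 (t - s)" for s
        using that mo(2)[of "t - s"] by (cases "\<bar>t - s\<bar> \<ge> 1") (auto simp: indicator_def)
      then show ?thesis unfolding re by (simp only: integral_mollifier_translate[OF zero_less_one]) simp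
    qed
    show "\<zeta> T t = 0" if "\<bar>t\<bar> \<ge> T" for T t
    proof -
      have "indicator {- (T - 1) .. T - 1} s * mollifier 1 (t - s) = 0" for s
        using that mo(2)[of "t - s"] by (cases "\<bar>t - s\<bar> \<ge> 1") (auto simp: indicator_def)
      then show ?thesis by (simp only: re) simp
    qed
    show "cmod (\<zeta> T t) \<le> 1" "cmod (1 - \<zeta> T t) \<le> 1" for T t
    proof -
      have "1 - \<zeta> T t = of_real (1 - m T t)" by (simp add: \<zeta>m)
      then show "cmod (1 - \<zeta> T t) \<le> 1" using m01[of T t] by (simp only: norm_of_real)
      show "cmod (\<zeta> T t) \<le> 1" using m01[of T t] by (simp add: \<zeta>m)
    qed
    show "cmod (pd 1 (\<zeta> T) t) \<le> max (\<integral>s. cmod (pd 1 \<rho> s) \<partial>lborel) (\<integral>s. cmod (pd 1 (pd 1 \<rho>) s) \<partial>lborel)" for T t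
      unfolding \<zeta>_def using bd[OF test_funs_pd[OF \<rho>], of 1 T t] by (simp add: pd_conv[OF I \<rho>] le_max_iff_disj)
    show "cmod (pd 1 (pd 1 (\<zeta> T)) t) \<le> max (\<integral>s. cmod (pd 1 \<rho> s) \<partial>lborel) (\<integral>s. cmod (pd 1 (pd 1 \<rho>) s) \<partial>lborel)" for T t
      unfolding \<zeta>_def using bd[OF test_funs_pd[OF test_funs_pd[OF \<rho>]], of 1 1 T t]
      by (simp add: pd_conv[OF I \<rho>] pd_conv[OF I test_funs_pd[OF \<rho>]] le_max_iff_disj)
  qed (simp add: le_max_iff_disj)
qed

text \<open>Cutting an approximate eigenfunction off at distance \<open>T\<close> creates errors
  only where |t| >= T - 2. There the weight is at least exp(T - 2) / 4, so the weighted energy bound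
  makes every such error a multiple of exp(- T).\<close>

lemma localised_quasimodes:
  fixes V :: "real \<Rightarrow> real"
  assumes V: "continuous_on UNIV V" "\<And>t. V t \<ge> 0" "\<And>t. \<bar>t\<bar> \<ge> t0 \<Longrightarrow> V t \<ge> \<gamma> + 3"
    and \<gamma>: "\<gamma> \<in> op_real_eigenvalues (op_closure (S_op V))"
  obtains C T0 :: real where "C > 0"
    "\<And>T. T \<ge> T0 \<Longrightarrow> \<exists>h\<in>test_funs. (\<forall>t. \<bar>t\<bar> \<ge> T \<longrightarrow> h t = 0) \<and> 1/2 \<le> L2norm h \<and> L2norm h \<le> 1 \<and>
       L2norm (pd 1 h) \<le> C \<and> L2norm (\<lambda>t. S_op V h t - of_real \<gamma> * h t) \<le> C * exp (- T)"
proof -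
  obtain C2 :: real and \<zeta> :: "real \<Rightarrow> real \<Rightarrow> complex" where C2: "C2 \<ge> 0" and \<zeta>: "\<And>T. smooth_fun (\<zeta> T)"
    "\<And>T t. \<bar>t\<bar> \<le> T - 2 \<Longrightarrow> \<zeta> T t = 1" "\<And>T t. \<bar>t\<bar> \<ge> T \<Longrightarrow> \<zeta> T t = 0"
    "\<And>T t. cmod (\<zeta> T t) \<le> 1" "\<And>T t. cmod (1 - \<zeta> T t) \<le> 1"
    "\<And>T t. cmod (pd 1 (\<zeta> T) t) \<le> C2" "\<And>T t. cmod (pd 1 (pd 1 (\<zeta> T)) t) \<le> C2"
    by (rule smooth_plateau) (rule that; assumption)
  define C1 where "C1 = 1 + (\<bar>\<gamma>\<bar> + 3) * (cosh t0)\<^sup>2"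
  have C1: "C1 \<ge> 1" by (simp add: C1_def)
  \<comment> \<open>The first bracket bounds the norm of the derivative of \<open>h\<close>, the
    second the residual; their sum serves for both.\<close>
  define C where "C = (2 * sqrt (2 * C1) + C2) + (1 + 12 * exp 2 * C2 * sqrt (2 * C1))"
  \<comment> \<open>The logarithm makes the removed tail of norm at most 1/2, so that
    \<open>h\<close> keeps half of the norm of \<phi>.\<close>
  define T0 where "T0 = max 2 (ln (8 * exp 2 * sqrt C1))"
  show ?thesis
  proof (rule that[of C T0])
    show "C > 0" using C1 C2 by (auto simp: C_def intro!: add_nonneg_pos add_pos_nonneg)
    fix T assume T: "T \<ge> T0"
    then have T2: "T \<ge> 2" by (simp add: T0_def)
    have Texp: "4 * exp (2 - T) * sqrt C1 \<le> 1 / 2"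
    proof -
      have "8 * exp 2 * sqrt C1 \<le> exp T"
        using T C1 unfolding T0_def by (subst ln_le_cancel_iff[symmetric]) auto
      then show ?thesis by (simp add: exp_diff field_simps)
    qed
    obtain \<phi> where \<phi>: "\<phi> \<in> test_funs" "L2norm \<phi> = 1"
        "L2norm (\<lambda>t. S_op V \<phi> t - of_real \<gamma> * \<phi> t) \<le> exp (- 2 * T)"
      by (rule eigenvalue_approx[OF V(1) \<gamma> exp_gt_zero[of "- 2 * T"]])
    define \<eta> where "\<eta> t = complex_of_real (trunc_cosh T t)" for t
    note en = weighted_energy_bound[OF V \<phi> C1_def]
    have \<eta>1: "cmod (\<eta> t) = trunc_cosh T t" for t using trunc_cosh_pos[of T t] by (simp add: \<eta>_def)
    have \<eta>_half: "1 \<le> 2 * cmod (\<eta> t)" for t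
      using trunc_cosh_ge[of 1 T t] T2 cosh_real_ge_1[of t] by (simp add: \<eta>1)
    have \<eta>_tail: "1 \<le> 4 * exp (2 - T) * cmod (\<eta> t)" if "\<bar>t\<bar> \<ge> T - 2" for t
    proof -
      have "exp (T - 2) / 2 \<le> cosh \<bar>t\<bar>"
      proof -
        have "exp (T - 2) \<le> exp \<bar>t\<bar>" using that by simp
        then have "exp (T - 2) \<le> exp \<bar>t\<bar> + exp (- \<bar>t\<bar>)" using exp_gt_zero[of "- \<bar>t\<bar>"] by linarith
        then show ?thesis unfolding cosh_field_def by simp
      qed
      moreover have "exp (T - 2) / 2 \<le> exp T"
      proof -
        have "exp (T - 2) \<le> exp T" by simp
        then show ?thesis using exp_gt_zero[of "T - 2"] by linarith
      qed
      ultimately have "exp (T - 2) / 4 \<le> trunc_cosh T t"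
        using trunc_cosh_ge[of "exp (T - 2) / 2" T t] by simp
      then have "4 * exp (2 - T) * (exp (T - 2) / 4) \<le> 4 * exp (2 - T) * trunc_cosh T t"
        by (intro mult_left_mono) auto
      then show ?thesis by (simp add: \<eta>1 exp_add[symmetric])
    qed
    have c\<eta>: "continuous_on UNIV \<eta>" unfolding \<eta>_def[abs_def] by (intro continuous_intros continuous_trunc_cosh)
    have \<eta>L: "(\<lambda>t. \<eta> t * f t) \<in> L2" if f: "f \<in> test_funs" for f
    proof -
      obtain r where "\<And>x. norm x > r \<Longrightarrow> f x = 0" using test_funs_support[OF f] by metis
      then show ?thesis
        by (intro L2_bounded_support[where r=r] continuous_intros c\<eta> test_funs_continuous[OF f]) auto
    qed
    define \<phi>' where "\<phi>' = pd 1 \<phi>"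
    have \<phi>': "\<phi>' \<in> test_funs" unfolding \<phi>'_def using test_funs_pd[OF \<phi>(1)] by simp
    have N1: "L2norm (\<lambda>t. \<eta> t * \<phi>' t) \<le> sqrt (2 * C1)"
      using en(1) by (simp add: L2norm_def norm_mult \<eta>1 \<phi>'_def)
    have N2: "L2norm (\<lambda>t. \<eta> t * \<phi> t) \<le> sqrt C1"
      using en(2) by (simp add: L2norm_def norm_mult \<eta>1)
    have N2': "L2norm (\<lambda>t. \<eta> t * \<phi> t) \<le> sqrt (2 * C1)"
      by (rule order_trans[OF N2]) (use C1 in simp)
    define h where "h = (\<lambda>t. \<zeta> T t * \<phi> t)"
    have h: "h \<in> test_funs" unfolding h_def by (rule test_funs_mult(2)[OF \<phi>(1) \<zeta>(1)])
    have s\<phi>: "smooth_fun \<phi>" "smooth_fun \<phi>'" "smooth_fun (\<zeta> T)" "smooth_fun (pd 1 (\<zeta> T))"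
      using test_funs_smooth \<phi>(1) \<phi>' \<zeta>(1) smooth_fun_pd[OF \<zeta>(1)] by auto
    have h': "pd 1 h = (\<lambda>t. \<zeta> T t * \<phi>' t + pd 1 (\<zeta> T) t * \<phi> t)"
      unfolding h_def \<phi>'_def using s\<phi> by (subst pd_mult) auto
    have h'': "pd 1 (pd 1 h) = (\<lambda>t. (\<zeta> T t * pd 1 \<phi>' t + pd 1 (\<zeta> T) t * \<phi>' t)
        + (pd 1 (\<zeta> T) t * \<phi>' t + pd 1 (pd 1 (\<zeta> T)) t * \<phi> t))"
      unfolding h' using s\<phi> by (simp add: pd_add pd_mult smooth_fun_mult \<phi>'_def)
    define f where "f = (\<lambda>t. S_op V \<phi> t - of_real \<gamma> * \<phi> t)"
    \<comment> \<open>Besides the cut-off residual this is the commutator of the second derivative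
      with the plateau; both of its terms carry derivatives of \<open>\<zeta> T\<close> and so live
      on the flanks.\<close>
    have Sh: "S_op V h t - of_real \<gamma> * h t = \<zeta> T t * f t +
        (- (2 * pd 1 (\<zeta> T) t * \<phi>' t) - pd 1 (pd 1 (\<zeta> T)) t * \<phi> t)" for t
      unfolding S_op_def laplacian_eq f_def by (simp add: h'' \<phi>'_def) (simp add: h_def algebra_simps)
    have z': "pd 1 (\<zeta> T) t = 0 \<and> pd 1 (pd 1 (\<zeta> T)) t = 0" if t: "\<bar>t\<bar> < T - 2" for t
    proof -
      have S: "open {- (T - 2) <..< T - 2}" by simp
      have *: "pd 1 (\<zeta> T) s = 0" if "s \<in> {- (T - 2) <..< T - 2}" for s
        by (rule has_pd_locally_const[OF smooth_fun_has_pd[OF \<zeta>(1)] S that]) (use \<zeta>(2) in auto)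
      have "pd 1 (pd 1 (\<zeta> T)) t = 0"
        by (rule has_pd_locally_const[OF smooth_fun_has_pd[OF s\<phi>(4)] S _ *]) (use t in auto)
      moreover have "t \<in> {- (T - 2) <..< T - 2}" using t by auto
      ultimately show ?thesis using * by blast
    qed
    have m: "k \<in> borel_measurable lborel" if "smooth_fun k" for k :: "real \<Rightarrow> complex"
      by (rule continuous_imp_borel_measurable_lborel[OF smooth_fun_continuous[OF that]])
    \<comment> \<open>The device that trades a pointwise comparison with the weight for the weighted
      norms bounded above.\<close>
    have bnd: "L2norm (\<lambda>t. a t * k t) \<le> c * L2norm (\<lambda>t. \<eta> t * k t)"
      if "smooth_fun a" "k \<in> test_funs" "c \<ge> 0" "\<And>t. cmod (a t) \<le> c * cmod (\<eta> t)" for a k c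
    proof -
      have "L2norm (\<lambda>t. a t * k t) \<le> L2norm (\<lambda>t. of_real c * (\<eta> t * k t))"
      proof (rule L2norm_mono)
        show "(\<lambda>t. of_real c * (\<eta> t * k t)) \<in> L2" by (intro L2_cmult \<eta>L that)
        show "(\<lambda>t. a t * k t) \<in> borel_measurable lborel"
          by (intro m smooth_fun_mult test_funs_smooth that)
        show "cmod (a t * k t) \<le> cmod (of_real c * (\<eta> t * k t))" for t
          using mult_right_mono[OF that(4) norm_ge_zero, of t "k t"] that(3)
          by (simp add: norm_mult mult.assoc)
      qed
      then show ?thesis unfolding L2norm_cmult using that(3) by simp
    qed
    have tail: "L2norm (\<lambda>t. a t * k t) \<le> c * (4 * exp (2 - T)) * L2norm (\<lambda>t. \<eta> t * k t)"
      if ak: "smooth_fun a" "k \<in> test_funs" "c \<ge> 0"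
        and a: "\<And>t. \<bar>t\<bar> < T - 2 \<Longrightarrow> a t = 0" "\<And>t. cmod (a t) \<le> c" for a k c
    proof (rule bnd[OF ak(1,2)])
      show "cmod (a t) \<le> c * (4 * exp (2 - T)) * cmod (\<eta> t)" for t
      proof (cases "\<bar>t\<bar> < T - 2")
        case True
        then show ?thesis using a(1) ak(3) by simp
      next
        case False
        then have "c * 1 \<le> c * (4 * exp (2 - T) * cmod (\<eta> t))" using \<eta>_tail ak(3) by (intro mult_left_mono) auto
        then show ?thesis using a(2)[of t] by (simp add: mult.assoc)
      qed
    qed (use ak(3) in simp)
    have LL: "h \<in> L2" "\<phi> \<in> L2" "\<phi>' \<in> L2" "f \<in> L2" unfolding f_def
      by (intro L2_diff L2_cmult S_op_L2 test_funs_L2 V(1) \<phi>(1) h \<phi>')+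
    have P: "(\<lambda>t. a t * k t) \<in> L2" if "smooth_fun a" "k \<in> test_funs" for a k
      by (rule test_funs_L2[OF test_funs_mult(2)[OF that(2,1)]])
    have hle: "L2norm h \<le> 1"
      unfolding \<phi>(2)[symmetric] h_def
    proof (rule L2norm_mono[OF LL(2)])
      show "(\<lambda>t. \<zeta> T t * \<phi> t) \<in> borel_measurable lborel" using L2_measurable[OF LL(1)] by (simp add: h_def)
      show "cmod (\<zeta> T t * \<phi> t) \<le> cmod (\<phi> t)" for t
        using \<zeta>(4)[of T t] by (simp add: norm_mult mult_left_le_one_le)
    qed
    have hge: "1 / 2 \<le> L2norm h"
    proof -
      have sm: "smooth_fun (\<lambda>t. 1 - \<zeta> T t)"
        using smooth_fun_add[OF smooth_fun_const smooth_fun_mult[OF smooth_fun_const \<zeta>(1)], of 1 "-1" T] by simp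
      have "L2norm (\<lambda>t. (1 - \<zeta> T t) * \<phi> t) \<le> 1 * (4 * exp (2 - T)) * L2norm (\<lambda>t. \<eta> t * \<phi> t)"
        by (rule tail[OF sm \<phi>(1)]) (use \<zeta> in auto)
      also have "\<dots> \<le> 1 * (4 * exp (2 - T)) * sqrt C1" by (intro mult_left_mono N2) auto
      also have "\<dots> \<le> 1 / 2" using Texp by simp
      finally have "L2norm (\<lambda>t. (1 - \<zeta> T t) * \<phi> t) \<le> 1 / 2" .
      moreover have "L2norm (\<lambda>t. h t + (1 - \<zeta> T t) * \<phi> t) \<le> L2norm h + L2norm (\<lambda>t. (1 - \<zeta> T t) * \<phi> t)"
        by (intro L2norm_triangle LL P sm \<phi>(1))
      moreover have "(\<lambda>t. h t + (1 - \<zeta> T t) * \<phi> t) = \<phi>" by (simp add: h_def algebra_simps)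
      ultimately show ?thesis using \<phi>(2) by simp
    qed
    have "L2norm (pd 1 h) \<le> 2 * sqrt (2 * C1) + C2"
    proof -
      have "L2norm (\<lambda>t. \<zeta> T t * \<phi>' t) \<le> 2 * L2norm (\<lambda>t. \<eta> t * \<phi>' t)"
        by (rule bnd[OF \<zeta>(1) \<phi>']) (use order_trans[OF \<zeta>(4) \<eta>_half] in auto)
      moreover have "L2norm (\<lambda>t. pd 1 (\<zeta> T) t * \<phi> t) \<le> L2norm (\<lambda>t. of_real C2 * \<phi> t)"
      proof (rule L2norm_mono[OF L2_cmult[OF LL(2)]])
        show "(\<lambda>t. pd 1 (\<zeta> T) t * \<phi> t) \<in> borel_measurable lborel" by (intro m smooth_fun_mult s\<phi>)
        show "cmod (pd 1 (\<zeta> T) t * \<phi> t) \<le> cmod (of_real C2 * \<phi> t)" for t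
          using \<zeta>(6)[of T t] C2 by (simp add: norm_mult mult_right_mono)
      qed
      moreover have "L2norm (pd 1 h) \<le> L2norm (\<lambda>t. \<zeta> T t * \<phi>' t) + L2norm (\<lambda>t. pd 1 (\<zeta> T) t * \<phi> t)"
        unfolding h' by (intro L2norm_triangle P s\<phi> \<phi>' \<phi>(1))
      ultimately show ?thesis using N1 \<phi>(2) C2 unfolding L2norm_cmult by simp
    qed
    moreover have "0 \<le> 12 * exp 2 * C2 * sqrt (2 * C1)" using C1 C2 by simp
    ultimately have hd: "L2norm (pd 1 h) \<le> C" unfolding C_def by linarith
    have hS: "L2norm (\<lambda>t. S_op V h t - of_real \<gamma> * h t) \<le> C * exp (- T)"
    proof -
      let ?a = "\<lambda>t. - (2 * pd 1 (\<zeta> T) t)" and ?b = "\<lambda>t. - pd 1 (pd 1 (\<zeta> T)) t"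
      have sm: "smooth_fun ?a" "smooth_fun ?b"
        using smooth_fun_mult[OF smooth_fun_const s\<phi>(4), of "-2"]
          smooth_fun_mult[OF smooth_fun_const smooth_fun_pd[OF s\<phi>(4)], of 1 "-1"] by auto
      have 1: "L2norm (\<lambda>t. ?a t * \<phi>' t) \<le> (2 * C2) * (4 * exp (2 - T)) * L2norm (\<lambda>t. \<eta> t * \<phi>' t)"
        by (rule tail[OF sm(1) \<phi>']) (use z' C2 \<zeta>(6) in \<open>auto simp: norm_mult\<close>)
      have 2: "L2norm (\<lambda>t. ?b t * \<phi> t) \<le> C2 * (4 * exp (2 - T)) * L2norm (\<lambda>t. \<eta> t * \<phi> t)"
        by (rule tail[OF sm(2) \<phi>(1)]) (use z' C2 \<zeta>(7) in auto)
      have 3: "L2norm (\<lambda>t. \<zeta> T t * f t) \<le> L2norm f"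
      proof (rule L2norm_mono[OF LL(4)])
        show "(\<lambda>t. \<zeta> T t * f t) \<in> borel_measurable lborel"
          using m[OF s\<phi>(3)] L2_measurable[OF LL(4)] by (rule borel_measurable_times)
        show "cmod (\<zeta> T t * f t) \<le> cmod (f t)" for t
          using \<zeta>(4)[of T t] by (simp add: norm_mult mult_left_le_one_le)
      qed
      have fL: "(\<lambda>t. \<zeta> T t * f t) \<in> L2"
        by (rule L2_dominated[OF LL(4), of _ 1])
          (use m[OF s\<phi>(3)] L2_measurable[OF LL(4)] \<zeta>(4) in \<open>auto simp: norm_mult mult_left_le_one_le\<close>)
      have "(\<lambda>t. S_op V h t - of_real \<gamma> * h t) = (\<lambda>t. \<zeta> T t * f t + (?a t * \<phi>' t + ?b t * \<phi> t))"
        unfolding Sh by (simp add: algebra_simps)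
      then have "L2norm (\<lambda>t. S_op V h t - of_real \<gamma> * h t) \<le>
          L2norm (\<lambda>t. \<zeta> T t * f t) + L2norm (\<lambda>t. ?a t * \<phi>' t + ?b t * \<phi> t)"
        by (simp only:) (intro L2norm_triangle fL L2_add P sm \<phi>' \<phi>(1))
      also have "L2norm (\<lambda>t. ?a t * \<phi>' t + ?b t * \<phi> t) \<le> L2norm (\<lambda>t. ?a t * \<phi>' t) + L2norm (\<lambda>t. ?b t * \<phi> t)"
        by (intro L2norm_triangle P sm \<phi>' \<phi>(1))
      also have "L2norm (\<lambda>t. ?a t * \<phi>' t) \<le> (2 * C2) * (4 * exp (2 - T)) * sqrt (2 * C1)"
        by (rule order_trans[OF 1]) (intro mult_left_mono N1, use C2 in simp)
      also have "L2norm (\<lambda>t. ?b t * \<phi> t) \<le> C2 * (4 * exp (2 - T)) * sqrt (2 * C1)"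
        by (rule order_trans[OF 2]) (intro mult_left_mono N2', use C2 in simp)
      also have "L2norm (\<lambda>t. \<zeta> T t * f t) \<le> exp (- T)"
        by (rule order_trans[OF 3], rule order_trans[OF \<phi>(3)[folded f_def]]) (use T2 in simp)
      \<comment> \<open>The 12 is 8 + 4: the first-order commutator term has the factor 2, and each
        tail costs 4 exp(2 - T).\<close>
      also have "exp (- T) + ((2 * C2) * (4 * exp (2 - T)) * sqrt (2 * C1) + C2 * (4 * exp (2 - T)) * sqrt (2 * C1))
          = (1 + 12 * exp 2 * C2 * sqrt (2 * C1)) * exp (- T)"
        by (simp add: exp_diff exp_minus field_simps)
      also have "\<dots> \<le> C * exp (- T)" using C1 C2 by (intro mult_right_mono) (auto simp: C_def)
      finally show ?thesis by simp
    qed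
    have h0: "\<forall>t. \<bar>t\<bar> \<ge> T \<longrightarrow> h t = 0" using \<zeta>(3) by (simp add: h_def)
    show "\<exists>h\<in>test_funs. (\<forall>t. \<bar>t\<bar> \<ge> T \<longrightarrow> h t = 0) \<and> 1/2 \<le> L2norm h \<and> L2norm h \<le> 1 \<and>
       L2norm (pd 1 h) \<le> C \<and> L2norm (\<lambda>t. S_op V h t - of_real \<gamma> * h t) \<le> C * exp (- T)"
      using h h0 hge hle hd hS by blast
  qed
qed

section \<open>WKB quasimodes in the plane\<close>

lemma has_vector_derivative_smooth_compose:
  fixes f :: "real \<Rightarrow> complex"
  assumes f: "smooth_fun f" and g: "(g has_real_derivative g') (at t)"
  shows "((\<lambda>t. f (g t)) has_vector_derivative of_real g' * pd 1 f (g t)) (at t)"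
proof -
  have "((\<lambda>s. f (0 + s *\<^sub>R 1)) has_vector_derivative pd 1 f (0 + g t *\<^sub>R 1)) (at (g t))"
    by (rule has_pd_at[OF smooth_fun_has_pd[OF f]]) simp
  from vector_diff_chain_at[OF g[unfolded has_real_derivative_iff_has_vector_derivative] this]
  show ?thesis by (simp add: o_def scaleR_conv_of_real)
qed

lemma Basis_real_prod: "(Basis :: (real \<times> real) set) = {(1, 0), (0, 1)}"
  by (auto simp: Basis_prod_def)

lemma laplacian_real_prod:
  fixes f :: "real \<times> real \<Rightarrow> complex"
  shows "laplacian f z = pd (1, 0) (pd (1, 0) f) z + pd (0, 1) (pd (0, 1) f) z"
  unfolding laplacian_eq Basis_real_prod by simp

text \<open>After scaling, a(x / n) confines x to the interval from n to 2 n. This keeps away from x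
  = 0, where the real powers are singular, and makes each power of x comparable to that power of
  n.\<close>

definition window :: "(real \<Rightarrow> complex) set" where
  "window = {a \<in> test_funs. \<forall>s. s < 1 \<or> s > 2 \<longrightarrow> a s = 0}"

lemma window_pd:
  assumes "a \<in> window"
  shows "pd 1 a \<in> window"
proof -
  have a: "a \<in> test_funs" "\<And>s. s < 1 \<or> s > 2 \<Longrightarrow> a s = 0" using assms by (auto simp: window_def)
  have S: "open ({..<1} \<union> {2<..} :: real set)" by auto
  have "pd 1 a s = 0" if "s < 1 \<or> s > 2" for s
    by (rule has_pd_locally_const[OF test_funs_has_pd[OF a(1)] S]) (use that a(2) in auto)
  then show ?thesis using test_funs_pd[OF a(1), of 1] by (simp add: window_def)
qed

lemma has_pd_snd:
  "has_pd (\<lambda>z::real \<times> real. of_real (snd z)) (\<lambda>z. 0) (1, 0)"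
  "has_pd (\<lambda>z::real \<times> real. of_real (snd z)) (\<lambda>z. 1) (0, 1)"
proof -
  have "((\<lambda>t. complex_of_real (snd z + t)) has_vector_derivative of_real 1) (at 0)" for z :: "real \<times> real"
    by (rule has_vector_derivative_of_real) (auto intro!: derivative_eq_intros)
  then show "has_pd (\<lambda>z::real \<times> real. of_real (snd z)) (\<lambda>z. 1) (0, 1)"
    by (simp add: has_pd_def)
qed (simp add: has_pd_def)

locale wkb =
  fixes \<alpha> \<kappa> \<nu> n :: real
  assumes n: "n \<ge> 1" and \<alpha>: "0 < \<alpha>" "\<alpha> < 1"
begin

text \<open>An antiderivative of \<kappa> x^\<alpha> + \<nu> x^(-\<alpha>) on x > 0. The square of
  that derivative is \<kappa>^2 x^(2 \<alpha>) + 2 \<kappa> \<nu> + \<nu>^2 x^(-2 \<alpha>), so the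
  two parameters control the two leading orders.\<close>

definition phase :: "real \<Rightarrow> real" where
  "phase x = \<kappa> * (x powr (\<alpha> + 1) / (\<alpha> + 1)) + \<nu> * (x powr (1 - \<alpha>) / (1 - \<alpha>))"

text \<open>The trial function is the case \<beta> = 0. The exponent and both profiles are left free
  because differentiation changes all three; with them the derivatives are again combinations of
  waves, up to factors of the second coordinate.\<close>

definition wave :: "(real \<Rightarrow> complex) \<Rightarrow> real \<Rightarrow> (real \<Rightarrow> complex) \<Rightarrow> real \<times> real \<Rightarrow> complex" where
  "wave a \<beta> f z = a (fst z / n) * of_real (fst z powr \<beta>) * exp (\<i> * of_real (phase (fst z)))
     * f (fst z powr \<alpha> * snd z)"

lemma phase_deriv: "x > 0 \<Longrightarrow> (phase has_real_derivative \<kappa> * x powr \<alpha> + \<nu> * x powr (- \<alpha>)) (at x)"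
  unfolding phase_def[abs_def] using \<alpha>
  by (auto intro!: derivative_eq_intros)

lemma wave_eq_0: "a \<in> window \<Longrightarrow> fst z < n \<or> fst z > 2 * n \<Longrightarrow> wave a \<beta> f z = 0"
  using n by (auto simp: wave_def window_def field_simps)

text \<open>Two overlapping open half-planes cover the plane: for fst z < n the wave vanishes, and
  for fst z > 0 every real power in it is continuous.\<close>

lemma continuous_wave:
  assumes a: "a \<in> window" and f: "smooth_fun f"
  shows "continuous_on UNIV (wave a \<beta> f)"
proof -
  have cf: "continuous_on UNIV f" "continuous_on UNIV a"
    using f a smooth_fun_continuous test_funs_continuous by (auto simp: window_def)
  have "continuous_on {z. fst z < n} (wave a \<beta> f)"
    using wave_eq_0[OF a] by (subst continuous_on_cong[OF refl, where g="\<lambda>_. 0"]) auto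
  moreover have "continuous_on {z. fst z > 0} (wave a \<beta> f)"
  proof -
    have "continuous_on {z. fst z > 0} (\<lambda>z. phase (fst z))"
      unfolding phase_def using \<alpha> by (intro continuous_intros) auto
    then show ?thesis
      unfolding wave_def[abs_def]
      by (intro continuous_on_mult continuous_on_compose2[OF cf(1)] continuous_on_compose2[OF cf(2)]
          continuous_on_exp continuous_on_of_real continuous_on_powr continuous_on_fst continuous_on_snd
          continuous_on_id continuous_on_const continuous_on_divide) (use n in auto)
  qed
  moreover have "open {z::real \<times> real. fst z < n}" "open {z::real \<times> real. fst z > 0}"
    by (intro open_Collect_less continuous_intros)+
  ultimately have "continuous_on ({z. fst z < n} \<union> {z. fst z > 0}) (wave a \<beta> f)"
    by (rule continuous_on_open_Un[rotated 2])
  moreover have "{z::real \<times> real. fst z < n} \<union> {z. fst z > 0} = UNIV" using n by force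
  ultimately show ?thesis by simp
qed

text \<open>The five terms come, in this order, from the window, the power, the two parts of the
  phase, and the chain rule in x^\<alpha> y. The last one leaves a factor y that no wave can
  absorb.\<close>

lemma has_pd_wave_x:
  assumes a: "a \<in> window" and f: "smooth_fun f"
  shows "has_pd (wave a \<beta> f) (\<lambda>z. of_real (1 / n) * wave (pd 1 a) \<beta> f z + of_real \<beta> * wave a (\<beta> - 1) f z
      + (\<i> * of_real \<kappa>) * wave a (\<beta> + \<alpha>) f z + (\<i> * of_real \<nu>) * wave a (\<beta> - \<alpha>) f z
      + of_real \<alpha> * (of_real (snd z) * wave a (\<beta> + \<alpha> - 1) (pd 1 f) z)) (1, 0)"
  unfolding has_pd_def
proof
  fix z :: "real \<times> real"
  obtain x y where z: "z = (x, y)" by (cases z)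
  let ?D = "\<lambda>z. of_real (1 / n) * wave (pd 1 a) \<beta> f z + of_real \<beta> * wave a (\<beta> - 1) f z
      + (\<i> * of_real \<kappa>) * wave a (\<beta> + \<alpha>) f z + (\<i> * of_real \<nu>) * wave a (\<beta> - \<alpha>) f z
      + of_real \<alpha> * (of_real (snd z) * wave a (\<beta> + \<alpha> - 1) (pd 1 f) z)"
  show "((\<lambda>t. wave a \<beta> f (z + t *\<^sub>R (1, 0))) has_vector_derivative ?D z) (at 0)"
  proof (cases "x < n")
    case True
    have "?D z = 0" using wave_eq_0[OF a] wave_eq_0[OF window_pd[OF a]] True by (simp add: z)
    moreover have "((\<lambda>t. wave a \<beta> f (z + t *\<^sub>R (1, 0))) has_vector_derivative 0) (at 0)"
    proof (rule has_vector_derivative_transform_within_open)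
      show "((\<lambda>t::real. 0) has_vector_derivative 0) (at 0)" by simp
      show "open {..<n - x}" "0 \<in> {..<n - x}" using True by auto
    qed (use wave_eq_0[OF a] in \<open>auto simp: z\<close>)
    ultimately show ?thesis by simp
  next
    case False
    then have x: "x > 0" using n by simp
    have sa: "smooth_fun a" using a test_funs_smooth by (auto simp: window_def)
    have 1: "((\<lambda>t. a ((x + t) / n)) has_vector_derivative of_real (1 / n) * pd 1 a ((x + 0) / n)) (at 0)"
      by (rule has_vector_derivative_smooth_compose[OF sa]) (use n in \<open>auto intro!: derivative_eq_intros\<close>)
    have 2: "((\<lambda>t. complex_of_real ((x + t) powr \<beta>)) has_vector_derivative of_real (\<beta> * x powr (\<beta> - 1))) (at 0)"
      by (rule has_vector_derivative_of_real) (use x in \<open>auto intro!: derivative_eq_intros\<close>)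
    have "((\<lambda>t. phase (x + t)) has_real_derivative \<kappa> * x powr \<alpha> + \<nu> * x powr (- \<alpha>)) (at 0)"
      using DERIV_chain2[OF _ DERIV_add[OF DERIV_const DERIV_ident], of phase _ x 0] phase_deriv[OF x] by simp
    from has_vector_derivative_mult_right[OF has_vector_derivative_of_real[OF this], of "\<i>"]
    have "((\<lambda>t. \<i> * of_real (phase (x + t))) has_vector_derivative \<i> * of_real (\<kappa> * x powr \<alpha> + \<nu> * x powr (- \<alpha>))) (at 0)" .
    from field_vector_diff_chain_at[OF this DERIV_exp]
    have 3: "((\<lambda>t. exp (\<i> * of_real (phase (x + t)))) has_vector_derivative
        \<i> * of_real (\<kappa> * x powr \<alpha> + \<nu> * x powr (- \<alpha>)) * exp (\<i> * of_real (phase x))) (at 0)"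
      by (simp add: o_def)
    have 4: "((\<lambda>t. f ((x + t) powr \<alpha> * y)) has_vector_derivative
        of_real (\<alpha> * x powr (\<alpha> - 1) * y) * pd 1 f ((x + 0) powr \<alpha> * y)) (at 0)"
      by (rule has_vector_derivative_smooth_compose[OF f]) (use x in \<open>auto intro!: derivative_eq_intros\<close>)
    have p: "x powr (\<beta> + \<alpha>) = x powr \<beta> * x powr \<alpha>" "x powr (\<beta> - \<alpha>) = x powr \<beta> * x powr (- \<alpha>)"
      "x powr (\<beta> + \<alpha> - 1) = x powr \<beta> * x powr (\<alpha> - 1)"
      by (simp_all only: powr_add[symmetric]) (simp_all add: algebra_simps)
    have "((\<lambda>t. a ((x + t) / n) * of_real ((x + t) powr \<beta>) * exp (\<i> * of_real (phase (x + t))) * f ((x + t) powr \<alpha> * y))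
        has_vector_derivative ?D z) (at 0)"
      by (rule has_vector_derivative_eq_rhs[OF has_vector_derivative_mult[OF has_vector_derivative_mult[OF
              has_vector_derivative_mult[OF 1 2] 3] 4]])
        (simp only: z wave_def p fst_conv snd_conv add_0_right of_real_mult of_real_add, simp add: algebra_simps)
    then show ?thesis by (simp add: z wave_def)
  qed
qed

lemma has_pd_wave_y:
  assumes a: "a \<in> window" and f: "smooth_fun f"
  shows "has_pd (wave a \<beta> f) (wave a (\<beta> + \<alpha>) (pd 1 f)) (0, 1)"
  unfolding has_pd_def
proof
  fix z :: "real \<times> real"
  obtain x y where z: "z = (x, y)" by (cases z)
  have "((\<lambda>t. f (x powr \<alpha> * (y + t))) has_vector_derivative
        of_real (x powr \<alpha>) * pd 1 f (x powr \<alpha> * (y + 0))) (at 0)"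
    by (rule has_vector_derivative_smooth_compose[OF f]) (auto intro!: derivative_eq_intros)
  from has_vector_derivative_mult_right[OF this]
  have "((\<lambda>t. a (x / n) * of_real (x powr \<beta>) * exp (\<i> * of_real (phase x)) * f (x powr \<alpha> * (y + t))) has_vector_derivative
      a (x / n) * of_real (x powr \<beta>) * exp (\<i> * of_real (phase x)) * (of_real (x powr \<alpha>) * pd 1 f (x powr \<alpha> * (y + 0)))) (at 0)" .
  then show "((\<lambda>t. wave a \<beta> f (z + t *\<^sub>R (0, 1))) has_vector_derivative wave a (\<beta> + \<alpha>) (pd 1 f) z) (at 0)"
    by (simp add: z wave_def powr_add mult_ac)
qed

text \<open>Because of that factor y, waves alone are not closed under differentiation; adjoining
  the second coordinate as a generator repairs this.\<close>

lemma smooth_wave: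
  assumes a: "a \<in> window" and f: "smooth_fun f"
  shows "smooth_fun (wave a \<beta> f)"
proof -
  define G where "G = {wave a \<beta> f | a \<beta> f. a \<in> window \<and> smooth_fun f} \<union> {\<lambda>z. of_real (snd z)}"
  have wG: "wave a \<beta> f \<in> fun_alg G" if "a \<in> window" "smooth_fun f" for a \<beta> f
    by (rule fun_alg.gen) (use that in \<open>auto simp: G_def\<close>)
  have sG: "(\<lambda>z. of_real (snd z)) \<in> fun_alg G" by (rule fun_alg.gen) (simp add: G_def)
  show ?thesis
  proof (rule smooth_fun_alg[OF wG[OF a f]])
    fix g assume "g \<in> G"
    then consider a \<beta> f where "g = wave a \<beta> f" "a \<in> window" "smooth_fun f" | "g = (\<lambda>z. of_real (snd z))"
      unfolding G_def by blast
    note cases = this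
    from cases show "continuous_on UNIV g"
      by cases (simp_all add: continuous_wave continuous_on_of_real continuous_on_snd continuous_on_id)
    fix b :: "real \<times> real" assume "b \<in> Basis"
    then consider "b = (1, 0)" | "b = (0, 1)" unfolding Basis_real_prod by blast
    note b = this
    from cases show "\<exists>g'\<in>fun_alg G. has_pd g g' b"
    proof cases
      case (1 a \<beta> f)
      have f': "smooth_fun (pd 1 f)" by (rule smooth_fun_pd[OF 1(3)]) simp
      note w = wG[OF 1(2,3)] wG[OF window_pd[OF 1(2)] 1(3)] wG[OF 1(2) f']
      from b show ?thesis
      proof cases
        case b: 1
        show ?thesis unfolding b 1(1)
          by (rule bexI, rule has_pd_wave_x[OF 1(2,3)])
            (intro fun_alg.add fun_alg.mult fun_alg.const sG w)
      next
        case b: 2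
        show ?thesis unfolding b 1(1)
          by (rule bexI, rule has_pd_wave_y[OF 1(2,3)]) (rule w)
      qed
    next
      case 2
      from b show ?thesis
      proof cases
        case b: 1
        show ?thesis unfolding b 2 by (rule bexI, rule has_pd_snd(1)) (rule fun_alg.const)
      next
        case b: 2
        show ?thesis unfolding b 2 by (rule bexI, rule has_pd_snd(2)) (rule fun_alg.const)
      qed
    qed
  qed
qed

lemma test_funs_wave:
  assumes a: "a \<in> window" and f: "f \<in> test_funs"
  shows "wave a \<beta> f \<in> test_funs"
proof -
  obtain r where r: "r > 0" "\<And>t. norm t > r \<Longrightarrow> f t = 0" using test_funs_support[OF f] by metis
  have "wave a \<beta> f z = 0" if z: "norm z > 2 * n + r" for z
  proof (cases "n \<le> fst z \<and> fst z \<le> 2 * n")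
    case False
    then show ?thesis using wave_eq_0[OF a] by (meson not_le)
  next
    case True
    obtain x y where xy: "z = (x, y)" by (cases z)
    have "norm z \<le> \<bar>x\<bar> + \<bar>y\<bar>" using norm_Pair_le[of x y] by (simp add: xy)
    then have y: "\<bar>y\<bar> > r" using z True n by (simp add: xy)
    \<comment> \<open>On the window |y| is at most |x^\<alpha> y|, so the bounded support of
      \<open>f\<close> bounds y.\<close>
    have "1 \<le> x powr \<alpha>" using True n \<alpha> by (intro ge_one_powr_ge_zero) (auto simp: xy)
    then have "1 * \<bar>y\<bar> \<le> x powr \<alpha> * \<bar>y\<bar>" by (rule mult_right_mono) simp
    then have "norm (x powr \<alpha> * y) > r" using y by (simp add: abs_mult)
    then show ?thesis using r(2) by (simp add: wave_def xy)
  qed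
  then show ?thesis using smooth_wave[OF a test_funs_smooth[OF f]] unfolding test_funs_iff by blast
qed

lemma cmod_wave: "cmod (wave a \<beta> f (x, y)) = cmod (a (x / n)) * x powr \<beta> * cmod (f (x powr \<alpha> * y))"
  by (simp add: wave_def norm_mult)

lemma pd_wave_yy:
  assumes a: "a \<in> window" and f: "smooth_fun f"
  shows "pd (0, 1) (pd (0, 1) (wave a \<beta> f)) = wave a (\<beta> + \<alpha> + \<alpha>) (pd 1 (pd 1 f))"
  unfolding has_pd_imp_pd[OF has_pd_wave_y[OF a f]]
  by (rule has_pd_imp_pd, rule has_pd_wave_y[OF a smooth_fun_pd[OF f]]) simp

text \<open>The terms of order \<open>x\<^sup>2\<^sup>\<alpha>\<close> and \<open>1\<close> of the longitudinal second derivative come from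
  \<open>- phase'\<^sup>2\<close>; all the others are small on the window.\<close>
lemma pd_wave_xx:
  fixes a f :: "real \<Rightarrow> complex"
  defines "k \<equiv> \<i> * complex_of_real \<kappa>" and "v \<equiv> \<i> * complex_of_real \<nu>" and "m \<equiv> complex_of_real (1 / n)"
    and "A \<equiv> complex_of_real \<alpha>"
  assumes a: "a \<in> window" and f: "smooth_fun f"
  shows "pd (1, 0) (pd (1, 0) (wave a 0 f)) (x, y) =
     k * k * wave a (\<alpha> + \<alpha>) f (x, y) + 2 * k * v * wave a 0 f (x, y)
     + (m * (m * wave (pd 1 (pd 1 a)) 0 f (x, y)) + 2 * (m * (k * wave (pd 1 a) \<alpha> f (x, y)))
     + 2 * (m * (v * wave (pd 1 a) (- \<alpha>) f (x, y))) + k * (A * wave a (\<alpha> - 1) f (x, y))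
     - v * (A * wave a (- \<alpha> - 1) f (x, y)) + v * (v * wave a (- \<alpha> - \<alpha>) f (x, y)))
     + (2 * (m * (A * (of_real y * wave (pd 1 a) (\<alpha> - 1) (pd 1 f) (x, y))))
     + 2 * (k * (A * (of_real y * wave a (\<alpha> + \<alpha> - 1) (pd 1 f) (x, y))))
     + 2 * (v * (A * (of_real y * wave a (- 1) (pd 1 f) (x, y))))
     + A * ((A - 1) * (of_real y * wave a (\<alpha> - 1 - 1) (pd 1 f) (x, y))))
     + A * (A * (of_real y * (of_real y * wave a (\<alpha> - 1 + \<alpha> - 1) (pd 1 (pd 1 f)) (x, y))))"
proof -
  have f': "smooth_fun (pd 1 f)" by (rule smooth_fun_pd[OF f]) simp
  note a' = window_pd[OF a]
  \<comment> \<open>For \<beta> = 0 the term that differentiates the power drops out.\<close>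
  have e1: "pd (1, 0) (wave a 0 f) = (\<lambda>z. (m * wave (pd 1 a) 0 f z + k * wave a \<alpha> f z)
      + (v * wave a (- \<alpha>) f z + A * (of_real (snd z) * wave a (\<alpha> - 1) (pd 1 f) z)))"
    unfolding has_pd_imp_pd[OF has_pd_wave_x[OF a f]] by (simp add: k_def v_def m_def A_def add.assoc)
  note D = has_pd_wave_x[folded k_def v_def m_def A_def]
  note d2 = has_pd_add[OF has_pd_add[OF has_pd_cmult[OF D[OF a' f]] has_pd_cmult[OF D[OF a f]]]
      has_pd_add[OF has_pd_cmult[OF D[OF a f]]
        has_pd_cmult[OF has_pd_mult[OF has_pd_snd(1) D[OF a f']]]], of m 0 k \<alpha> v "- \<alpha>" A "\<alpha> - 1"]
  show ?thesis
    unfolding e1 has_pd_imp_pd[OF d2]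
    by (simp add: A_def[symmetric]) (simp add: algebra_simps)
qed

end

section \<open>Size of the longitudinal remainder\<close>

lemma norm_triangle_mono_diff:
  "norm a \<le> r \<Longrightarrow> norm b \<le> s \<Longrightarrow> norm (a - b) \<le> r + s" for a b :: "'a::real_normed_vector"
  using norm_triangle_ineq4[of a b] by linarith

text \<open>Normalise by a + b: a number in the unit interval is at most its \<open>s\<close>-th
  power. This later compares (x^2 + y^2)^\<alpha> with x^(2 \<alpha>).\<close>

lemma powr_add_le_add_powr:
  fixes a b s :: real
  assumes "a \<ge> 0" "b \<ge> 0" "0 < s" "s \<le> 1"
  shows "(a + b) powr s \<le> a powr s + b powr s"
proof (cases "a + b = 0")
  case True
  then show ?thesis using assms by simp
next
  case False
  then have ab: "a + b > 0" using assms by simp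
  have "a / (a + b) \<le> (a / (a + b)) powr s" "b / (a + b) \<le> (b / (a + b)) powr s"
    using powr_mono'[of s 1 "a / (a + b)"] powr_mono'[of s 1 "b / (a + b)"] assms ab by auto
  moreover have "a / (a + b) + b / (a + b) = 1"
    using False by (simp add: add_divide_distrib[symmetric])
  moreover have "(a / (a + b)) powr s = a powr s / (a + b) powr s" "(b / (a + b)) powr s = b powr s / (a + b) powr s"
    using assms by (simp_all add: powr_divide)
  ultimately have "1 \<le> (a powr s + b powr s) / (a + b) powr s"
    unfolding add_divide_distrib by linarith
  then show ?thesis using ab by (simp add: pos_le_divide_eq)
qed

context wkb
begin

lemma cmod_wave_le:
  assumes "\<And>s. cmod (a s) \<le> M"
  shows "cmod (wave a \<beta> f (x, y)) \<le> M * (x powr \<beta> * cmod (f (x powr \<alpha> * y)))"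
  unfolding cmod_wave mult.assoc using assms by (intro mult_right_mono) auto

text \<open>Every remaining term is small: each derivative of the window brings 1 / n, each
  derivative of a power brings 1 / x, and each factor y is traded for T x^(-\<alpha>). The
  coefficients 5 and 3 collect multiplicities, the 5 being 2 * 2 + 1 with the extra 2 from
  x^\<alpha> <= 2 n^\<alpha>.\<close>

lemma longitudinal_remainder_bound:
  fixes x y T M :: real
  defines "t \<equiv> x powr \<alpha> * y" and "\<delta> \<equiv> n powr (\<alpha> - 1)"
  assumes a: "a \<in> window" and f: "smooth_fun f"
    and M: "\<And>s. cmod (a s) \<le> M" "\<And>s. cmod (pd 1 a s) \<le> M" "\<And>s. cmod (pd 1 (pd 1 a) s) \<le> M"
    and x: "n \<le> x" "x \<le> 2 * n" and T: "\<bar>t\<bar> \<le> T"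
  shows "cmod (pd (1, 0) (pd (1, 0) (wave a 0 f)) (x, y)
      - (- of_real (\<kappa>\<^sup>2) * wave a (\<alpha> + \<alpha>) f (x, y) - of_real (2 * \<kappa> * \<nu>) * wave a 0 f (x, y)))
    \<le> M * ((1 + 5 * \<bar>\<kappa>\<bar> + 3 * \<bar>\<nu>\<bar>) * \<delta> + \<nu>\<^sup>2 * n powr (- \<alpha> - \<alpha>)) * cmod (f t)
     + M * ((3 + 2 * \<bar>\<kappa>\<bar> + 2 * \<bar>\<nu>\<bar>) * (T * \<delta>)) * cmod (pd 1 f t)
     + M * (T\<^sup>2 * n powr (- 2)) * cmod (pd 1 (pd 1 f) t)"
proof -
  define k where "k = \<i> * complex_of_real \<kappa>"
  define v where "v = \<i> * complex_of_real \<nu>"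
  define m where "m = complex_of_real (1 / n)"
  define A where "A = complex_of_real \<alpha>"
  define H H1 H2 where "H = cmod (f t)" and "H1 = cmod (pd 1 f t)" and "H2 = cmod (pd 1 (pd 1 f) t)"
  have M0: "M \<ge> 0" using M(1)[of 0] norm_ge_zero order_trans by blast
  have x1: "x \<ge> 1" "x > 0" using x n by auto
  have T0: "T \<ge> 0" using T by simp
  have H0: "H \<ge> 0" "H1 \<ge> 0" "H2 \<ge> 0" by (auto simp: H_def H1_def H2_def)
  have "A - 1 = complex_of_real (\<alpha> - 1)" by (simp add: A_def)
  then have "cmod (A - 1) = \<bar>\<alpha> - 1\<bar>" by (simp only: norm_of_real)
  then have c: "cmod k = \<bar>\<kappa>\<bar>" "cmod v = \<bar>\<nu>\<bar>" "cmod m = 1 / n" "cmod A = \<alpha>" "cmod (A - 1) \<le> 1"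
    using n \<alpha> by (auto simp: k_def v_def m_def A_def norm_mult norm_divide)
  have dn: "1 / n \<le> \<delta>" "0 < 1 / n" "1 / n \<le> 1"
    using n \<alpha> powr_mono[of "-1" "\<alpha> - 1" n] by (auto simp: \<delta>_def powr_minus_divide)
  have B: "x powr s \<le> n powr s'" if "s \<le> s'" "s' \<le> 0" for s s'
  proof -
    have "x powr s \<le> x powr s'" using x1 that by (intro powr_mono) auto
    also have "\<dots> \<le> n powr s'" using x n that by (intro powr_mono2') auto
    finally show ?thesis .
  qed
  have B\<delta>: "x powr s \<le> \<delta>" if "s \<le> \<alpha> - 1" for s unfolding \<delta>_def using that \<alpha> by (intro B) auto
  have B1: "x powr s \<le> 1" if "s \<le> 0" for s using B[of s 0] that n by simp
  \<comment> \<open>The one positive power of x to be estimated here; it is largest at x = 2 n,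
    unlike the negative powers, which are largest at x = n.\<close>
  have B\<alpha>: "1 / n * x powr \<alpha> \<le> 2 * \<delta>"
  proof -
    have "x powr \<alpha> \<le> (2 * n) powr \<alpha>" using x x1 \<alpha> by (intro powr_mono2) auto
    also have "\<dots> = 2 powr \<alpha> * n powr \<alpha>" using n by (simp add: powr_mult)
    also have "\<dots> \<le> 2 * n powr \<alpha>"
      using \<alpha> powr_mono[of \<alpha> 1 2] by (intro mult_right_mono) auto
    finally show ?thesis using n by (simp add: \<delta>_def powr_diff divide_right_mono)
  qed
  have y: "\<bar>y\<bar> \<le> T * x powr (- \<alpha>)"
    using T x1 by (simp add: t_def abs_mult powr_minus field_simps)
  have yB: "\<bar>y\<bar> * x powr s \<le> T * x powr (s - \<alpha>)" for s
  proof -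
    have "\<bar>y\<bar> * x powr s \<le> T * x powr (- \<alpha>) * x powr s" using y by (intro mult_right_mono) auto
    also have "\<dots> = T * x powr (s - \<alpha>)" by (simp add: powr_add[symmetric])
    finally show ?thesis .
  qed
  have W: "cmod (wave b s f (x, y)) \<le> M * (x powr s * H)" "cmod (wave b s (pd 1 f) (x, y)) \<le> M * (x powr s * H1)"
    "cmod (wave b s (pd 1 (pd 1 f)) (x, y)) \<le> M * (x powr s * H2)"
    if "b \<in> {a, pd 1 a, pd 1 (pd 1 a)}" for b s
    unfolding H_def H1_def H2_def t_def using that M by (auto intro!: cmod_wave_le)
  \<comment> \<open>Common pattern of all the estimates below: the coefficient and the power of x
    are bounded together by \<open>q\<close>, while the profile value \<open>h\<close> is carried
    along.\<close>
  have b: "cmod (c * w) \<le> q * (M * h)" if w: "cmod w \<le> M * (r * h)" and q: "cmod c * r \<le> q" and h: "h \<ge> 0"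
    for c w :: complex and q r h
  proof -
    have "cmod (c * w) \<le> cmod c * (M * (r * h))" unfolding norm_mult by (intro mult_left_mono w) auto
    also have "\<dots> = (cmod c * r) * (M * h)" by (simp add: mult_ac)
    also have "\<dots> \<le> q * (M * h)" using M0 h by (intro mult_right_mono q) auto
    finally show ?thesis .
  qed
  have two: "cmod (2 * w) \<le> 2 * q" if "cmod w \<le> q" for w :: complex and q
    using that by (simp add: norm_mult)
  have m1: "\<alpha> * z \<le> z'" if "z \<le> z'" "0 \<le> z" for z z' :: real
    using that \<alpha> mult_left_le_one_le[of z \<alpha>] by linarith
  have P1: "cmod (m * (m * wave (pd 1 (pd 1 a)) 0 f (x, y)) + 2 * (m * (k * wave (pd 1 a) \<alpha> f (x, y)))
     + 2 * (m * (v * wave (pd 1 a) (- \<alpha>) f (x, y))) + k * (A * wave a (\<alpha> - 1) f (x, y))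
     - v * (A * wave a (- \<alpha> - 1) f (x, y)) + v * (v * wave a (- \<alpha> - \<alpha>) f (x, y)))
     \<le> \<delta> * (M * H) + 2 * ((2 * \<bar>\<kappa>\<bar> * \<delta>) * (M * H)) + 2 * ((\<bar>\<nu>\<bar> * \<delta>) * (M * H)) + (\<bar>\<kappa>\<bar> * \<delta>) * (M * H)
       + (\<bar>\<nu>\<bar> * \<delta>) * (M * H) + (\<nu>\<^sup>2 * n powr (- \<alpha> - \<alpha>)) * (M * H)"
  proof (intro norm_triangle_mono norm_triangle_mono_diff)
    show "cmod (m * (m * wave (pd 1 (pd 1 a)) 0 f (x, y))) \<le> \<delta> * (M * H)"
    proof (subst mult.assoc[symmetric], rule b[OF W(1)])
      have "1 / n * (1 / n) \<le> 1 / n * 1" using dn by (intro mult_left_mono) auto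
      then show "cmod (m * m) * x powr 0 \<le> \<delta>" using dn x1 by (simp add: norm_mult c)
    qed (use H0 in auto)
    have "cmod (m * (k * wave (pd 1 a) \<alpha> f (x, y))) \<le> (2 * \<bar>\<kappa>\<bar> * \<delta>) * (M * H)"
    proof (subst mult.assoc[symmetric], rule b[OF W(1)])
      show "cmod (m * k) * x powr \<alpha> \<le> 2 * \<bar>\<kappa>\<bar> * \<delta>"
        using mult_left_mono[OF B\<alpha>, of "\<bar>\<kappa>\<bar>"] by (simp add: norm_mult c)
    qed (use H0 in auto)
    then show "cmod (2 * (m * (k * wave (pd 1 a) \<alpha> f (x, y)))) \<le> 2 * ((2 * \<bar>\<kappa>\<bar> * \<delta>) * (M * H))"
      by (rule two)
    have "cmod (m * (v * wave (pd 1 a) (- \<alpha>) f (x, y))) \<le> (\<bar>\<nu>\<bar> * \<delta>) * (M * H)"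
    proof (subst mult.assoc[symmetric], rule b[OF W(1)])
      have "1 / n * x powr (- \<alpha>) \<le> \<delta> * 1"
        using dn B1[of "- \<alpha>"] \<alpha> by (intro mult_mono) (auto simp: \<delta>_def)
      then show "cmod (m * v) * x powr (- \<alpha>) \<le> \<bar>\<nu>\<bar> * \<delta>"
        using mult_left_mono[of "1 / n * x powr (- \<alpha>)" \<delta> "\<bar>\<nu>\<bar>"] by (simp add: norm_mult c)
    qed (use H0 in auto)
    then show "cmod (2 * (m * (v * wave (pd 1 a) (- \<alpha>) f (x, y)))) \<le> 2 * ((\<bar>\<nu>\<bar> * \<delta>) * (M * H))"
      by (rule two)
    show "cmod (k * (A * wave a (\<alpha> - 1) f (x, y))) \<le> (\<bar>\<kappa>\<bar> * \<delta>) * (M * H)"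
    proof (subst mult.assoc[symmetric], rule b[OF W(1)])
      show "cmod (k * A) * x powr (\<alpha> - 1) \<le> \<bar>\<kappa>\<bar> * \<delta>"
        using m1[OF B\<delta>[of "\<alpha> - 1"]] unfolding norm_mult c mult.assoc by (intro mult_left_mono) auto
    qed (use H0 in auto)
    show "cmod (v * (A * wave a (- \<alpha> - 1) f (x, y))) \<le> (\<bar>\<nu>\<bar> * \<delta>) * (M * H)"
    proof (subst mult.assoc[symmetric], rule b[OF W(1)])
      show "cmod (v * A) * x powr (- \<alpha> - 1) \<le> \<bar>\<nu>\<bar> * \<delta>"
        using m1[OF B\<delta>[of "- \<alpha> - 1"]] \<alpha> unfolding norm_mult c mult.assoc by (intro mult_left_mono) auto
    qed (use H0 in auto)
    show "cmod (v * (v * wave a (- \<alpha> - \<alpha>) f (x, y))) \<le> (\<nu>\<^sup>2 * n powr (- \<alpha> - \<alpha>)) * (M * H)"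
    proof (subst mult.assoc[symmetric], rule b[OF W(1)])
      show "cmod (v * v) * x powr (- \<alpha> - \<alpha>) \<le> \<nu>\<^sup>2 * n powr (- \<alpha> - \<alpha>)"
        using B[of "- \<alpha> - \<alpha>" "- \<alpha> - \<alpha>"] \<alpha> by (simp add: norm_mult c power2_eq_square mult_left_mono)
    qed (use H0 in auto)
  qed
  have yw: "cmod (of_real y * wave b s (pd 1 f) (x, y)) \<le> M * ((\<bar>y\<bar> * x powr s) * H1)"
    if "b \<in> {a, pd 1 a, pd 1 (pd 1 a)}" for b s
    using mult_left_mono[OF W(2)[OF that, of s], of "\<bar>y\<bar>"] by (simp add: norm_mult mult_ac)
  have y\<delta>: "\<bar>y\<bar> * x powr s \<le> T * \<delta>" if "s - \<alpha> \<le> \<alpha> - 1" for s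
    by (rule order_trans[OF yB mult_left_mono[OF B\<delta>[OF that] T0]])
  have P2: "cmod (2 * (m * (A * (of_real y * wave (pd 1 a) (\<alpha> - 1) (pd 1 f) (x, y))))
     + 2 * (k * (A * (of_real y * wave a (\<alpha> + \<alpha> - 1) (pd 1 f) (x, y))))
     + 2 * (v * (A * (of_real y * wave a (- 1) (pd 1 f) (x, y))))
     + A * ((A - 1) * (of_real y * wave a (\<alpha> - 1 - 1) (pd 1 f) (x, y))))
     \<le> 2 * ((T * \<delta>) * (M * H1)) + 2 * ((\<bar>\<kappa>\<bar> * (T * \<delta>)) * (M * H1)) + 2 * ((\<bar>\<nu>\<bar> * (T * \<delta>)) * (M * H1))
       + (T * \<delta>) * (M * H1)"
  proof (intro norm_triangle_mono)
    have "cmod (m * (A * (of_real y * wave (pd 1 a) (\<alpha> - 1) (pd 1 f) (x, y)))) \<le> (T * \<delta>) * (M * H1)"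
    proof (subst mult.assoc[symmetric], rule b[OF yw])
      have "\<bar>y\<bar> * x powr (\<alpha> - 1) \<le> T * 1"
        by (rule order_trans[OF yB mult_left_mono[OF B1 T0]]) simp
      then have "\<alpha> * (\<bar>y\<bar> * x powr (\<alpha> - 1)) \<le> T" by (intro m1) auto
      then have "1 / n * (\<alpha> * (\<bar>y\<bar> * x powr (\<alpha> - 1))) \<le> \<delta> * T"
        using dn \<alpha> by (intro mult_mono) (auto simp: \<delta>_def)
      then show "cmod (m * A) * (\<bar>y\<bar> * x powr (\<alpha> - 1)) \<le> T * \<delta>"
        unfolding norm_mult c by (simp only: mult.assoc mult.commute[of T])
    qed (use H0 in auto)
    then show "cmod (2 * (m * (A * (of_real y * wave (pd 1 a) (\<alpha> - 1) (pd 1 f) (x, y))))) \<le> 2 * ((T * \<delta>) * (M * H1))"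
      by (rule two)
    have "cmod (k * (A * (of_real y * wave a (\<alpha> + \<alpha> - 1) (pd 1 f) (x, y)))) \<le> (\<bar>\<kappa>\<bar> * (T * \<delta>)) * (M * H1)"
    proof (subst mult.assoc[symmetric], rule b[OF yw])
      show "cmod (k * A) * (\<bar>y\<bar> * x powr (\<alpha> + \<alpha> - 1)) \<le> \<bar>\<kappa>\<bar> * (T * \<delta>)"
        using m1[OF y\<delta>[of "\<alpha> + \<alpha> - 1"]] unfolding norm_mult c mult.assoc[of _ \<alpha>] by (intro mult_left_mono) auto
    qed (use H0 in auto)
    then show "cmod (2 * (k * (A * (of_real y * wave a (\<alpha> + \<alpha> - 1) (pd 1 f) (x, y))))) \<le> 2 * ((\<bar>\<kappa>\<bar> * (T * \<delta>)) * (M * H1))"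
      by (rule two)
    have "cmod (v * (A * (of_real y * wave a (- 1) (pd 1 f) (x, y)))) \<le> (\<bar>\<nu>\<bar> * (T * \<delta>)) * (M * H1)"
    proof (subst mult.assoc[symmetric], rule b[OF yw])
      show "cmod (v * A) * (\<bar>y\<bar> * x powr (- 1)) \<le> \<bar>\<nu>\<bar> * (T * \<delta>)"
        using m1[OF y\<delta>[of "- 1"]] \<alpha> unfolding norm_mult c mult.assoc[of _ \<alpha>] by (intro mult_left_mono) auto
    qed (use H0 in auto)
    then show "cmod (2 * (v * (A * (of_real y * wave a (- 1) (pd 1 f) (x, y))))) \<le> 2 * ((\<bar>\<nu>\<bar> * (T * \<delta>)) * (M * H1))"
      by (rule two)
    show "cmod (A * ((A - 1) * (of_real y * wave a (\<alpha> - 1 - 1) (pd 1 f) (x, y)))) \<le> (T * \<delta>) * (M * H1)"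
    proof (subst mult.assoc[symmetric], rule b[OF yw])
      have "cmod (A * (A - 1)) \<le> 1" using c(4,5) \<alpha> unfolding norm_mult by (simp add: mult_le_one)
      then have "cmod (A * (A - 1)) * (\<bar>y\<bar> * x powr (\<alpha> - 1 - 1)) \<le> 1 * (\<bar>y\<bar> * x powr (\<alpha> - 1 - 1))"
        by (intro mult_right_mono) auto
      also have "\<dots> \<le> T * \<delta>" using y\<delta>[of "\<alpha> - 1 - 1"] \<alpha> by simp
      finally show "cmod (A * (A - 1)) * (\<bar>y\<bar> * x powr (\<alpha> - 1 - 1)) \<le> T * \<delta>" .
    qed (use H0 in auto)
  qed
  have P3: "cmod (A * (A * (of_real y * (of_real y * wave a (\<alpha> - 1 + \<alpha> - 1) (pd 1 (pd 1 f)) (x, y)))))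
      \<le> (T\<^sup>2 * n powr (- 2)) * (M * H2)"
  proof (subst mult.assoc[symmetric], rule b)
    show "cmod (of_real y * (of_real y * wave a (\<alpha> - 1 + \<alpha> - 1) (pd 1 (pd 1 f)) (x, y))) \<le>
        M * ((\<bar>y\<bar> * (\<bar>y\<bar> * x powr (\<alpha> - 1 + \<alpha> - 1))) * H2)"
      using mult_left_mono[OF W(3), of a "\<bar>y\<bar> * \<bar>y\<bar>" "\<alpha> - 1 + \<alpha> - 1"] by (simp add: norm_mult mult_ac)
    have "\<bar>y\<bar> * (\<bar>y\<bar> * x powr (\<alpha> - 1 + \<alpha> - 1)) \<le> \<bar>y\<bar> * (T * x powr (\<alpha> - 1 + \<alpha> - 1 - \<alpha>))"
      by (intro mult_left_mono yB) auto
    also have "\<dots> = T * (\<bar>y\<bar> * x powr (\<alpha> - 1 + \<alpha> - 1 - \<alpha>))" by simp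
    also have "\<dots> \<le> T * (T * x powr (\<alpha> - 1 + \<alpha> - 1 - \<alpha> - \<alpha>))"
      using T0 by (intro mult_left_mono yB)
    also have "\<dots> = T\<^sup>2 * x powr (- 2)" by (simp add: power2_eq_square)
    also have "\<dots> \<le> T\<^sup>2 * n powr (- 2)" by (intro mult_left_mono B) auto
    finally have "\<bar>y\<bar> * (\<bar>y\<bar> * x powr (\<alpha> - 1 + \<alpha> - 1)) \<le> T\<^sup>2 * n powr (- 2)" .
    then show "cmod (A * A) * (\<bar>y\<bar> * (\<bar>y\<bar> * x powr (\<alpha> - 1 + \<alpha> - 1))) \<le> T\<^sup>2 * n powr (- 2)"
      unfolding norm_mult c mult.assoc[of \<alpha>] by (intro m1 mult_nonneg_nonneg) (use \<alpha> in auto)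
  qed (use H0 in auto)
  \<comment> \<open>The two terms that are not small; they are subtracted in the claim and cancel
    later against \<lambda> - \<gamma> and \<mu>.\<close>
  have kk: "k * k = - of_real (\<kappa>\<^sup>2)" "2 * k * v = - of_real (2 * \<kappa> * \<nu>)"
    by (simp_all add: k_def v_def complex_eq_iff power2_eq_square)
  have main: "k * k * wave a (\<alpha> + \<alpha>) f (x, y) + 2 * k * v * wave a 0 f (x, y)
      = - of_real (\<kappa>\<^sup>2) * wave a (\<alpha> + \<alpha>) f (x, y) - of_real (2 * \<kappa> * \<nu>) * wave a 0 f (x, y)"
    unfolding kk by simp
  have cancel: "w + p + q + r - w = p + q + r" for w p q r :: complex by simp
  have "cmod (pd (1, 0) (pd (1, 0) (wave a 0 f)) (x, y)
      - (- of_real (\<kappa>\<^sup>2) * wave a (\<alpha> + \<alpha>) f (x, y) - of_real (2 * \<kappa> * \<nu>) * wave a 0 f (x, y)))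
    \<le> (\<delta> * (M * H) + 2 * ((2 * \<bar>\<kappa>\<bar> * \<delta>) * (M * H)) + 2 * ((\<bar>\<nu>\<bar> * \<delta>) * (M * H)) + (\<bar>\<kappa>\<bar> * \<delta>) * (M * H)
       + (\<bar>\<nu>\<bar> * \<delta>) * (M * H) + (\<nu>\<^sup>2 * n powr (- \<alpha> - \<alpha>)) * (M * H))
     + (2 * ((T * \<delta>) * (M * H1)) + 2 * ((\<bar>\<kappa>\<bar> * (T * \<delta>)) * (M * H1)) + 2 * ((\<bar>\<nu>\<bar> * (T * \<delta>)) * (M * H1))
       + (T * \<delta>) * (M * H1)) + (T\<^sup>2 * n powr (- 2)) * (M * H2)"
    using norm_triangle_mono[OF norm_triangle_mono[OF P1 P2] P3]
    unfolding pd_wave_xx[OF a f] main[symmetric] k_def[symmetric] v_def[symmetric] m_def[symmetric] A_def[symmetric] cancel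
    .
  also have "\<dots> = M * ((1 + 5 * \<bar>\<kappa>\<bar> + 3 * \<bar>\<nu>\<bar>) * \<delta> + \<nu>\<^sup>2 * n powr (- \<alpha> - \<alpha>)) * H
     + M * ((3 + 2 * \<bar>\<kappa>\<bar> + 2 * \<bar>\<nu>\<bar>) * (T * \<delta>)) * H1
     + M * (T\<^sup>2 * n powr (- 2)) * H2"
    by (simp add: algebra_simps)
  finally show ?thesis unfolding H_def H1_def H2_def .
qed

text \<open>Tonelli and, for fixed x > 0, the substitution t = x^\<alpha> y with Jacobian
  x^(-\<alpha>). The hypothesis on \<open>w\<close> restricts to the x for which this is
  done.\<close>

lemma nn_integral_sheared:
  fixes w G :: "real \<Rightarrow> real"
  assumes [measurable]: "w \<in> borel_measurable borel" "G \<in> borel_measurable borel"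
    and w: "\<And>x. w x \<ge> 0" "\<And>x. x \<le> 0 \<Longrightarrow> w x = 0"
  shows "(\<integral>\<^sup>+z. ennreal (w (fst z) * G (fst z powr \<alpha> * snd z)) \<partial>lborel) =
    (\<integral>\<^sup>+x. ennreal (w x * x powr (- \<alpha>)) \<partial>lborel) * (\<integral>\<^sup>+t. ennreal (G t) \<partial>lborel)"
proof -
  have "(\<integral>\<^sup>+z. ennreal (w (fst z) * G (fst z powr \<alpha> * snd z)) \<partial>lborel) =
      (\<integral>\<^sup>+x. \<integral>\<^sup>+y. ennreal (w x * G (x powr \<alpha> * y)) \<partial>lborel \<partial>lborel)"
    by (subst lborel_prod[symmetric], subst lborel.nn_integral_fst[symmetric]) auto
  also have "\<dots> = (\<integral>\<^sup>+x. ennreal (w x * x powr (- \<alpha>)) * (\<integral>\<^sup>+t. ennreal (G t) \<partial>lborel) \<partial>lborel)"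
  proof (rule nn_integral_cong)
    fix x
    show "(\<integral>\<^sup>+y. ennreal (w x * G (x powr \<alpha> * y)) \<partial>lborel) =
        ennreal (w x * x powr (- \<alpha>)) * (\<integral>\<^sup>+t. ennreal (G t) \<partial>lborel)"
    proof (cases "x > 0")
      case True
      let ?c = "x powr \<alpha>"
      have c: "?c > 0" using True by simp
      have "(\<integral>\<^sup>+t. ennreal (G t) \<partial>lborel) = ennreal ?c * (\<integral>\<^sup>+y. ennreal (G (?c * y)) \<partial>lborel)"
        using nn_integral_real_affine[of "\<lambda>t. ennreal (G t)" ?c 0] c by simp
      then have "ennreal (w x * x powr (- \<alpha>)) * (\<integral>\<^sup>+t. ennreal (G t) \<partial>lborel) =
          ennreal (w x * x powr (- \<alpha>)) * ennreal ?c * (\<integral>\<^sup>+y. ennreal (G (?c * y)) \<partial>lborel)"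
        by (simp add: mult.assoc)
      also have "ennreal (w x * x powr (- \<alpha>)) * ennreal ?c = ennreal (w x)"
        using w(1)[of x] True by (simp add: ennreal_mult[symmetric] powr_minus)
      also have "ennreal (w x) * (\<integral>\<^sup>+y. ennreal (G (?c * y)) \<partial>lborel) = (\<integral>\<^sup>+y. ennreal (w x * G (?c * y)) \<partial>lborel)"
        by (subst nn_integral_cmult[symmetric]) (auto simp: ennreal_mult' w(1))
      finally show ?thesis ..
    qed (use w(2)[of x] in simp)
  qed
  also have "\<dots> = (\<integral>\<^sup>+x. ennreal (w x * x powr (- \<alpha>)) \<partial>lborel) * (\<integral>\<^sup>+t. ennreal (G t) \<partial>lborel)"
    by (rule nn_integral_multc) measurable
  finally show ?thesis .
qed

text \<open>The factor n^(1 - \<alpha>) is the size of the integral of x^(-\<alpha>) over the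
  window; the 1/2 under the root is a lower bound for 2^(-\<alpha>). The residual bound has the same
  power of n, so it cancels in the comparison.\<close>

lemma L2norm_wave_ge:
  assumes a: "a \<in> window" and h: "h \<in> test_funs"
  shows "sqrt (n powr (1 - \<alpha>) / 2) * L2norm a * L2norm h \<le> L2norm (wave a 0 h)"
proof -
  note aL = test_funs_L2[of a] and hL = test_funs_L2[OF h] and wL = test_funs_L2[OF test_funs_wave[OF a h]]
  have at: "a \<in> test_funs" using a by (simp add: window_def)
  note [measurable] = L2_measurable[OF aL[OF at], simplified] L2_measurable[OF hL, simplified]
  let ?w = "\<lambda>x. (cmod (a (x / n)))\<^sup>2"
  have w0: "?w x = 0" if "x < n \<or> x > 2 * n" for x
    using a that n by (auto simp: window_def field_simps)
  have "(\<integral>\<^sup>+z. ennreal ((cmod (wave a 0 h z))\<^sup>2) \<partial>lborel) =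
      (\<integral>\<^sup>+z. ennreal (?w (fst z) * (cmod (h (fst z powr \<alpha> * snd z)))\<^sup>2) \<partial>lborel)"
  proof (rule nn_integral_cong)
    fix z :: "real \<times> real"
    obtain x y where z: "z = (x, y)" by (cases z)
    have "(cmod (wave a 0 h z))\<^sup>2 = ?w (fst z) * (cmod (h (fst z powr \<alpha> * snd z)))\<^sup>2"
    proof (cases "x < n")
      case True
      then show ?thesis using wave_eq_0[OF a] w0[of x] by (simp add: z)
    next
      case False
      then have "x powr 0 = 1" using n by simp
      then show ?thesis unfolding z cmod_wave by (simp add: power_mult_distrib)
    qed
    then show "ennreal ((cmod (wave a 0 h z))\<^sup>2) = ennreal (?w (fst z) * (cmod (h (fst z powr \<alpha> * snd z)))\<^sup>2)" by simp
  qed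
  also have "\<dots> = (\<integral>\<^sup>+x. ennreal (?w x * x powr (- \<alpha>)) \<partial>lborel) * (\<integral>\<^sup>+t. ennreal ((cmod (h t))\<^sup>2) \<partial>lborel)"
    by (rule nn_integral_sheared) (use w0 n in auto)
  also have "(\<integral>\<^sup>+t. ennreal ((cmod (h t))\<^sup>2) \<partial>lborel) = ennreal ((L2norm h)\<^sup>2)"
    by (subst nn_integral_eq_integral) (auto simp: L2norm_sq L2_integrable[OF hL])
  finally have eq: "ennreal ((L2norm (wave a 0 h))\<^sup>2) =
      (\<integral>\<^sup>+x. ennreal (?w x * x powr (- \<alpha>)) \<partial>lborel) * ennreal ((L2norm h)\<^sup>2)"
    by (subst (asm) nn_integral_eq_integral) (auto simp: L2norm_sq L2_integrable[OF wL])
  have "ennreal (n powr (1 - \<alpha>) / 2 * (L2norm a)\<^sup>2) = (\<integral>\<^sup>+x. ennreal (?w x * (n powr (- \<alpha>) / 2)) \<partial>lborel)"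
  proof -
    have "(\<integral>\<^sup>+s. ennreal ((cmod (a s))\<^sup>2) \<partial>lborel) = ennreal ((L2norm a)\<^sup>2)"
      by (subst nn_integral_eq_integral) (auto simp: L2norm_sq L2_integrable[OF aL[OF at]])
    moreover have "(\<integral>\<^sup>+x. ennreal (?w x) \<partial>lborel) = ennreal n * (\<integral>\<^sup>+s. ennreal ((cmod (a s))\<^sup>2) \<partial>lborel)"
      using nn_integral_real_affine[of "\<lambda>x. ennreal (?w x)" n 0] n by simp
    ultimately have "(\<integral>\<^sup>+x. ennreal (?w x) \<partial>lborel) = ennreal (n * (L2norm a)\<^sup>2)"
      using n by (simp add: ennreal_mult)
    moreover have "(\<integral>\<^sup>+x. ennreal (?w x * (n powr (- \<alpha>) / 2)) \<partial>lborel) =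
        (\<integral>\<^sup>+x. ennreal (?w x) \<partial>lborel) * ennreal (n powr (- \<alpha>) / 2)"
    proof -
      have "ennreal (?w x * (n powr (- \<alpha>) / 2)) = ennreal (?w x) * ennreal (n powr (- \<alpha>) / 2)" for x
        by (rule ennreal_mult'') simp
      then show ?thesis by (simp only:) (rule nn_integral_multc, measurable)
    qed
    ultimately have "(\<integral>\<^sup>+x. ennreal (?w x * (n powr (- \<alpha>) / 2)) \<partial>lborel) =
        ennreal (n * (L2norm a)\<^sup>2) * ennreal (n powr (- \<alpha>) / 2)"
      by (simp only:)
    also have "\<dots> = ennreal (n * (L2norm a)\<^sup>2 * (n powr (- \<alpha>) / 2))"
      by (rule ennreal_mult''[symmetric]) simp
    also have "n * (L2norm a)\<^sup>2 * (n powr (- \<alpha>) / 2) = n powr (1 - \<alpha>) / 2 * (L2norm a)\<^sup>2"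
      using n by (simp add: powr_diff powr_minus field_simps)
    finally show ?thesis ..
  qed
  also have "\<dots> \<le> (\<integral>\<^sup>+x. ennreal (?w x * x powr (- \<alpha>)) \<partial>lborel)"
  proof (intro nn_integral_mono ennreal_leI)
    fix x
    show "?w x * (n powr (- \<alpha>) / 2) \<le> ?w x * x powr (- \<alpha>)"
    proof (cases "x < n \<or> x > 2 * n")
      case True
      then show ?thesis using w0 by simp
    next
      case False
      have "2 powr (- 1) = (1 / 2 :: real)" by (simp add: powr_minus)
      then have "1 / 2 \<le> 2 powr (- \<alpha>)" using powr_mono[of "- 1" "- \<alpha>" 2] \<alpha> by linarith
      then have "n powr (- \<alpha>) / 2 \<le> 2 powr (- \<alpha>) * n powr (- \<alpha>)"
        using mult_right_mono[of "1 / 2" "2 powr (- \<alpha>)" "n powr (- \<alpha>)"] by simp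
      also have "\<dots> = (2 * n) powr (- \<alpha>)" using n by (simp add: powr_mult)
      also have "\<dots> \<le> x powr (- \<alpha>)" using False n \<alpha> by (intro powr_mono2') auto
      finally show ?thesis by (intro mult_left_mono) auto
    qed
  qed
  finally have "ennreal (n powr (1 - \<alpha>) / 2 * (L2norm a)\<^sup>2) * ennreal ((L2norm h)\<^sup>2) \<le> ennreal ((L2norm (wave a 0 h))\<^sup>2)"
    unfolding eq by (rule mult_right_mono) simp
  then have "n powr (1 - \<alpha>) / 2 * (L2norm a)\<^sup>2 * (L2norm h)\<^sup>2 \<le> (L2norm (wave a 0 h))\<^sup>2"
    by (simp add: ennreal_mult[symmetric])
  then have "(sqrt (n powr (1 - \<alpha>) / 2) * L2norm a * L2norm h)\<^sup>2 \<le> (L2norm (wave a 0 h))\<^sup>2"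
    by (simp add: power_mult_distrib)
  then show ?thesis by (rule power2_le_imp_le) simp
qed

text \<open>The matching upper bound, for a function dominated on the window by a function of t
  alone; x^(-\<alpha>) is at most n^(-\<alpha>) on an interval of length n.\<close>

lemma L2norm_sheared_le:
  assumes R: "R \<in> L2" and g: "g \<in> L2"
    and le: "\<And>x y. n \<le> x \<Longrightarrow> x \<le> 2 * n \<Longrightarrow> cmod (R (x, y)) \<le> cmod (g (x powr \<alpha> * y))"
    and 0: "\<And>x y. x < n \<or> x > 2 * n \<Longrightarrow> R (x, y) = 0"
  shows "L2norm R \<le> sqrt (n powr (1 - \<alpha>)) * L2norm g"
proof -
  note [measurable] = L2_measurable[OF g, simplified]
  let ?w = "indicat_real {n..2 * n}"
  have "ennreal ((L2norm R)\<^sup>2) = (\<integral>\<^sup>+z. ennreal ((cmod (R z))\<^sup>2) \<partial>lborel)"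
    by (subst nn_integral_eq_integral) (auto simp: L2norm_sq L2_integrable[OF R])
  also have "\<dots> \<le> (\<integral>\<^sup>+z. ennreal (?w (fst z) * (cmod (g (fst z powr \<alpha> * snd z)))\<^sup>2) \<partial>lborel)"
  proof (intro nn_integral_mono ennreal_leI)
    fix z :: "real \<times> real"
    show "(cmod (R z))\<^sup>2 \<le> ?w (fst z) * (cmod (g (fst z powr \<alpha> * snd z)))\<^sup>2"
      using le[of "fst z" "snd z"] 0[of "fst z" "snd z"]
      by (auto simp: indicator_def power_mono not_le)
  qed
  also have "\<dots> = (\<integral>\<^sup>+x. ennreal (?w x * x powr (- \<alpha>)) \<partial>lborel) * (\<integral>\<^sup>+t. ennreal ((cmod (g t))\<^sup>2) \<partial>lborel)"
    by (rule nn_integral_sheared) (use n in auto)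
  also have "(\<integral>\<^sup>+t. ennreal ((cmod (g t))\<^sup>2) \<partial>lborel) = ennreal ((L2norm g)\<^sup>2)"
    by (subst nn_integral_eq_integral) (auto simp: L2norm_sq L2_integrable[OF g])
  also have "(\<integral>\<^sup>+x. ennreal (?w x * x powr (- \<alpha>)) \<partial>lborel) \<le> ennreal (n powr (1 - \<alpha>))"
  proof -
    have "(\<integral>\<^sup>+x. ennreal (?w x * x powr (- \<alpha>)) \<partial>lborel) \<le> (\<integral>\<^sup>+x. ennreal (n powr (- \<alpha>)) * indicator {n..2 * n} x \<partial>lborel)"
    proof (rule nn_integral_mono)
      fix x
      have "x powr (- \<alpha>) \<le> n powr (- \<alpha>)" if "x \<ge> n" using that n \<alpha> by (intro powr_mono2') auto
      then show "ennreal (?w x * x powr (- \<alpha>)) \<le> ennreal (n powr (- \<alpha>)) * indicator {n..2 * n} x"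
        by (auto simp: indicator_def intro: ennreal_leI)
    qed
    also have "\<dots> = ennreal (n powr (- \<alpha>)) * ennreal n" using n by (simp add: nn_integral_cmult)
    also have "\<dots> = ennreal (n powr (1 - \<alpha>))"
      using n by (simp add: ennreal_mult[symmetric] powr_diff powr_minus divide_inverse mult.commute)
    finally show ?thesis .
  qed
  finally have "ennreal ((L2norm R)\<^sup>2) \<le> ennreal (n powr (1 - \<alpha>) * (L2norm g)\<^sup>2)"
    by (simp add: ennreal_mult'' mult_right_mono)
  then have "(L2norm R)\<^sup>2 \<le> (sqrt (n powr (1 - \<alpha>)) * L2norm g)\<^sup>2" by (simp add: power_mult_distrib)
  then show ?thesis by (rule power2_le_imp_le) simp
qed

end

section \<open>The residual of the wave\<close>

context wkb
begin

text \<open>After the cancellations prescribed by the equations for \<kappa> and \<nu>, three errors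
  remain: the longitudinal remainder, x^(2 \<alpha>) times the one-dimensional residual
  \<open>F\<close>, and the difference between x^(2 \<alpha>) and (x^2 + y^2)^\<alpha>.\<close>

lemma residual_bound:
  fixes x y T M p \<gamma> lam \<mu> :: real and a h :: "real \<Rightarrow> complex"
  defines "t \<equiv> x powr \<alpha> * y" and "\<psi> \<equiv> wave a 0 h"
    and "V \<equiv> \<lambda>z. \<bar>fst z * snd z\<bar> powr p - lam * ((fst z)\<^sup>2 + (snd z)\<^sup>2) powr \<alpha>"
    and "F \<equiv> \<lambda>t. S_op (\<lambda>t. \<bar>t\<bar> powr p) h t - of_real \<gamma> * h t"
  assumes p: "p > 0" "\<alpha> * (p + 2) = p" and \<kappa>: "\<kappa>\<^sup>2 = lam - \<gamma>" "2 * \<kappa> * \<nu> = \<mu>"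
    and a: "a \<in> window" and h: "smooth_fun h"
    and M: "\<And>s. cmod (a s) \<le> M" "\<And>s. cmod (pd 1 a s) \<le> M" "\<And>s. cmod (pd 1 (pd 1 a) s) \<le> M"
    and x: "n \<le> x" "x \<le> 2 * n" and T: "\<bar>t\<bar> \<le> T" "1 \<le> T"
  shows "cmod (S_op V \<psi> (x, y) - of_real \<mu> * \<psi> (x, y))
    \<le> (M * ((1 + 5 * \<bar>\<kappa>\<bar> + 3 * \<bar>\<nu>\<bar>) * n powr (\<alpha> - 1) + \<nu>\<^sup>2 * n powr (- \<alpha> - \<alpha>))
         + M * (T\<^sup>2 * n powr (- 2)) * (T powr p + \<bar>\<gamma>\<bar>) + M * (\<bar>lam\<bar> * (T\<^sup>2 * n powr (- 2 * \<alpha>\<^sup>2)))) * cmod (h t)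
     + (M * ((3 + 2 * \<bar>\<kappa>\<bar> + 2 * \<bar>\<nu>\<bar>) * (T * n powr (\<alpha> - 1)))) * cmod (pd 1 h t)
     + (M * (T\<^sup>2 * n powr (- 2)) + M * (2 * n) powr (2 * \<alpha>)) * cmod (F t)"
proof -
  have M0: "M \<ge> 0" using M(1)[of 0] norm_ge_zero order_trans by blast
  have x0: "x > 0" "x \<ge> 1" using x n by auto
  define c where "c = a (x / n) * exp (\<i> * of_real (phase x))"
  define X2 where "X2 = x powr (\<alpha> + \<alpha>)"
  define Q where "Q = (x\<^sup>2 + y\<^sup>2) powr \<alpha>"
  have c: "cmod c \<le> M" using M(1) by (simp add: c_def norm_mult)
  have W: "wave a \<beta> f (x, y) = c * of_real (x powr \<beta>) * f t" for \<beta> f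
    by (simp add: wave_def c_def t_def mult_ac)
  define h2 where "h2 = pd 1 (pd 1 h) t"
  \<comment> \<open>The approximate eigenvalue equation eliminates the second derivative of
    \<open>h\<close>, so that only \<open>h\<close>, its first derivative and \<open>F\<close>
    remain in the bound.\<close>
  have h2: "h2 = of_real (\<bar>t\<bar> powr p - \<gamma>) * h t - F t"
    unfolding F_def S_op_def laplacian_eq h2_def by (simp add: algebra_simps)
  define D where "D = pd (1, 0) (pd (1, 0) \<psi>) (x, y)
      - (- of_real (\<kappa>\<^sup>2) * wave a (\<alpha> + \<alpha>) h (x, y) - of_real (2 * \<kappa> * \<nu>) * wave a 0 h (x, y))"
  \<comment> \<open>The relation \<open>\<alpha> * (p + 2) = p\<close> says p = 2 \<alpha> +
    \<alpha> p: of x^p, the part x^(\<alpha> p) turns |y|^p into |t|^p and x^(2 \<alpha>) is left in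
    front.\<close>
  have Vxy: "V (x, y) = X2 * \<bar>t\<bar> powr p - lam * Q"
  proof -
    have "\<bar>x * y\<bar> powr p = x powr p * \<bar>y\<bar> powr p" using x0 by (simp add: abs_mult powr_mult)
    also have "x powr p = x powr (\<alpha> + \<alpha>) * x powr (\<alpha> * p)"
      using p(2) by (simp add: powr_add[symmetric] algebra_simps)
    also have "x powr (\<alpha> + \<alpha>) * x powr (\<alpha> * p) * \<bar>y\<bar> powr p = X2 * \<bar>t\<bar> powr p"
      using x0 by (simp add: X2_def t_def abs_mult powr_mult powr_powr)
    finally show ?thesis by (simp add: V_def Q_def)
  qed
  \<comment> \<open>The |t|^p terms cancel between potential and transversal derivative, \<kappa>^2
    + \<gamma> gives \<lambda> x^(2 \<alpha>), and 2 \<kappa> \<nu> removes \<mu>.\<close>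
  have "S_op V \<psi> (x, y) - of_real \<mu> * \<psi> (x, y) = - D + (c * of_real X2 * F t + c * h t * of_real (lam * (X2 - Q)))"
  proof -
    have "S_op V \<psi> (x, y) - of_real \<mu> * \<psi> (x, y) = - D
        + (of_real (\<kappa>\<^sup>2) * wave a (\<alpha> + \<alpha>) h (x, y) - wave a (\<alpha> + \<alpha>) (pd 1 (pd 1 h)) (x, y)
         + of_real (V (x, y)) * wave a 0 h (x, y))"
      unfolding S_op_def laplacian_real_prod \<psi>_def D_def
      using pd_wave_yy[OF a h, of 0] \<kappa>(2) by (simp add: algebra_simps)
    also have "of_real (\<kappa>\<^sup>2) * wave a (\<alpha> + \<alpha>) h (x, y) - wave a (\<alpha> + \<alpha>) (pd 1 (pd 1 h)) (x, y)
         + of_real (V (x, y)) * wave a 0 h (x, y) =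
         c * of_real X2 * F t + c * h t * of_real (lam * (X2 - Q))"
      unfolding W X2_def[symmetric] h2_def[symmetric] h2 Vxy \<kappa>(1) using x0 by (simp add: algebra_simps)
    finally show ?thesis .
  qed
  then have "cmod (S_op V \<psi> (x, y) - of_real \<mu> * \<psi> (x, y)) \<le>
      cmod D + (cmod (c * of_real X2 * F t) + cmod (c * h t * of_real (lam * (X2 - Q))))"
    using norm_triangle_mono[OF order_refl norm_triangle_ineq, of "- D"] by (simp only: norm_minus_cancel)
  moreover have "cmod D \<le> M * ((1 + 5 * \<bar>\<kappa>\<bar> + 3 * \<bar>\<nu>\<bar>) * n powr (\<alpha> - 1) + \<nu>\<^sup>2 * n powr (- \<alpha> - \<alpha>)) * cmod (h t)
     + M * ((3 + 2 * \<bar>\<kappa>\<bar> + 2 * \<bar>\<nu>\<bar>) * (T * n powr (\<alpha> - 1))) * cmod (pd 1 h t)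
     + M * (T\<^sup>2 * n powr (- 2)) * ((T powr p + \<bar>\<gamma>\<bar>) * cmod (h t) + cmod (F t))"
  proof -
    have "cmod h2 \<le> \<bar>\<bar>t\<bar> powr p - \<gamma>\<bar> * cmod (h t) + cmod (F t)"
      unfolding h2 by (rule order_trans[OF norm_triangle_ineq4]) (simp add: norm_mult del: of_real_diff)
    also have "\<bar>\<bar>t\<bar> powr p - \<gamma>\<bar> \<le> T powr p + \<bar>\<gamma>\<bar>"
      using powr_mono2[of p "\<bar>t\<bar>" T] T p by (intro order_trans[OF abs_triangle_ineq4]) auto
    finally have "cmod h2 \<le> (T powr p + \<bar>\<gamma>\<bar>) * cmod (h t) + cmod (F t)" by (simp add: mult_right_mono)
    then have "M * (T\<^sup>2 * n powr (- 2)) * cmod h2 \<le> M * (T\<^sup>2 * n powr (- 2)) * ((T powr p + \<bar>\<gamma>\<bar>) * cmod (h t) + cmod (F t))"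
      using M0 by (intro mult_left_mono) auto
    then show ?thesis
      using longitudinal_remainder_bound[OF a h M x T(1)[unfolded t_def]]
      unfolding D_def \<psi>_def h2_def t_def by linarith
  qed
  moreover have "cmod (c * of_real X2 * F t) \<le> M * (2 * n) powr (2 * \<alpha>) * cmod (F t)"
  proof -
    have "X2 \<le> (2 * n) powr (2 * \<alpha>)" using x x0 \<alpha> powr_mono2[of "2 * \<alpha>" x "2 * n"] by (simp add: X2_def)
    then have "cmod c * X2 \<le> M * (2 * n) powr (2 * \<alpha>)" using c M0 by (intro mult_mono) (auto simp: X2_def)
    then show ?thesis by (simp add: norm_mult X2_def mult_right_mono)
  qed
  moreover have "cmod (c * h t * of_real (lam * (X2 - Q))) \<le> M * (\<bar>lam\<bar> * (T\<^sup>2 * n powr (- 2 * \<alpha>\<^sup>2))) * cmod (h t)"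
  proof -
    have X2': "X2 = (x\<^sup>2) powr \<alpha>" using x0 by (simp add: X2_def powr_powr flip: powr_numeral)
    have "X2 \<le> Q" unfolding X2' Q_def using \<alpha> by (intro powr_mono2) auto
    moreover have "Q \<le> X2 + (y\<^sup>2) powr \<alpha>"
      unfolding Q_def X2' using \<alpha> by (intro powr_add_le_add_powr) auto
    \<comment> \<open>Since y = t x^(-\<alpha>), raising y^2 to the power \<alpha> gives |t|^(2
      \<alpha>) x^(-2 \<alpha>^2); as T >= 1, the first factor is at most T^2.\<close>
    moreover have "(y\<^sup>2) powr \<alpha> \<le> T\<^sup>2 * n powr (- 2 * \<alpha>\<^sup>2)"
    proof -
      have "y = t * x powr (- \<alpha>)" using x0 by (simp add: t_def powr_minus)
      then have y2: "y\<^sup>2 = t\<^sup>2 * x powr (- 2 * \<alpha>)" using x0 by (simp add: power_mult_distrib powr_power)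
      have "t\<^sup>2 \<le> T\<^sup>2" using T by (simp add: abs_le_square_iff[symmetric])
      then have "(t\<^sup>2) powr \<alpha> \<le> (T\<^sup>2) powr \<alpha>" using \<alpha> by (intro powr_mono2) auto
      also have "\<dots> \<le> (T\<^sup>2) powr 1" using T \<alpha> by (intro powr_mono) auto
      finally have 1: "(t\<^sup>2) powr \<alpha> \<le> T\<^sup>2" using T by simp
      have "(x powr (- 2 * \<alpha>)) powr \<alpha> = x powr (- 2 * \<alpha>\<^sup>2)"
        by (simp add: powr_powr power2_eq_square mult.assoc)
      also have "\<dots> \<le> n powr (- 2 * \<alpha>\<^sup>2)" using x n by (intro powr_mono2') auto
      finally have "(t\<^sup>2) powr \<alpha> * (x powr (- 2 * \<alpha>)) powr \<alpha> \<le> T\<^sup>2 * n powr (- 2 * \<alpha>\<^sup>2)"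
        using 1 by (intro mult_mono) auto
      then show ?thesis unfolding y2 using x0 by (simp add: powr_mult)
    qed
    ultimately have "\<bar>X2 - Q\<bar> \<le> T\<^sup>2 * n powr (- 2 * \<alpha>\<^sup>2)" by linarith
    then have "cmod c * (\<bar>lam\<bar> * \<bar>X2 - Q\<bar>) \<le> M * (\<bar>lam\<bar> * (T\<^sup>2 * n powr (- 2 * \<alpha>\<^sup>2)))"
      using c M0 by (intro mult_mono mult_left_mono) auto
    then have "cmod c * (\<bar>lam\<bar> * \<bar>X2 - Q\<bar>) * cmod (h t) \<le> M * (\<bar>lam\<bar> * (T\<^sup>2 * n powr (- 2 * \<alpha>\<^sup>2))) * cmod (h t)"
      by (rule mult_right_mono) simp
    then show ?thesis by (simp only: norm_mult norm_of_real abs_mult mult_ac)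
  qed
  ultimately show ?thesis by (simp only: distrib_right distrib_left mult.assoc)
qed

text \<open>The pointwise bound depends on (x, y) only through t, apart from constants in n, so it
  can be integrated in the sheared variable.\<close>

lemma residual_L2_bound:
  fixes T M p \<gamma> lam \<mu> :: real and a h :: "real \<Rightarrow> complex"
  defines "V \<equiv> \<lambda>z. \<bar>fst z * snd z\<bar> powr p - lam * ((fst z)\<^sup>2 + (snd z)\<^sup>2) powr \<alpha>"
    and "F \<equiv> \<lambda>t. S_op (\<lambda>t. \<bar>t\<bar> powr p) h t - of_real \<gamma> * h t"
    and "c1 \<equiv> M * ((1 + 5 * \<bar>\<kappa>\<bar> + 3 * \<bar>\<nu>\<bar>) * n powr (\<alpha> - 1) + \<nu>\<^sup>2 * n powr (- \<alpha> - \<alpha>))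
         + M * (T\<^sup>2 * n powr (- 2)) * (T powr p + \<bar>\<gamma>\<bar>) + M * (\<bar>lam\<bar> * (T\<^sup>2 * n powr (- 2 * \<alpha>\<^sup>2)))"
    and "c2 \<equiv> M * ((3 + 2 * \<bar>\<kappa>\<bar> + 2 * \<bar>\<nu>\<bar>) * (T * n powr (\<alpha> - 1)))"
    and "c3 \<equiv> M * (T\<^sup>2 * n powr (- 2)) + M * (2 * n) powr (2 * \<alpha>)"
  assumes p: "p > 0" "\<alpha> * (p + 2) = p" and \<kappa>: "\<kappa>\<^sup>2 = lam - \<gamma>" "2 * \<kappa> * \<nu> = \<mu>"
    and a: "a \<in> window" and h: "h \<in> test_funs" "\<And>t. \<bar>t\<bar> \<ge> T \<Longrightarrow> h t = 0"
    and M: "\<And>s. cmod (a s) \<le> M" "\<And>s. cmod (pd 1 a s) \<le> M" "\<And>s. cmod (pd 1 (pd 1 a) s) \<le> M"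
    and T: "1 \<le> T" and V: "continuous_on UNIV V" "continuous_on UNIV (\<lambda>t::real. \<bar>t\<bar> powr p)"
  shows "L2norm (\<lambda>z. S_op V (wave a 0 h) z - of_real \<mu> * wave a 0 h z)
    \<le> sqrt (n powr (1 - \<alpha>)) * (c1 * L2norm h + c2 * L2norm (pd 1 h) + c3 * L2norm F)"
proof -
  have M0: "M \<ge> 0" using M(1)[of 0] norm_ge_zero order_trans by blast
  have c0: "c1 \<ge> 0" "c2 \<ge> 0" "c3 \<ge> 0" using M0 T unfolding c1_def c2_def c3_def by auto
  have h': "pd 1 h \<in> test_funs" using test_funs_pd[OF h(1)] by simp
  have L: "h \<in> L2" "pd 1 h \<in> L2" "F \<in> L2"
    unfolding F_def by (intro test_funs_L2 h h' L2_diff L2_cmult S_op_L2 V)+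
  \<comment> \<open>Absolute values are taken before adding, so that the modulus of \<open>g\<close>
    is exactly the pointwise bound.\<close>
  define N where "N f t = complex_of_real (cmod (f t))" for f :: "real \<Rightarrow> complex" and t
  have N: "N f \<in> L2" "L2norm (N f) = L2norm f" if "f \<in> L2" for f
    using that unfolding N_def[abs_def] L2_iff L2norm_def by auto
  define g where "g = (\<lambda>t. of_real c1 * N h t + of_real c2 * N (pd 1 h) t + of_real c3 * N F t)"
  have g: "g \<in> L2" unfolding g_def by (intro L2_add L2_cmult N L)
  have cg: "cmod (g t) = c1 * cmod (h t) + c2 * cmod (pd 1 h t) + c3 * cmod (F t)" for t
  proof -
    have "g t = of_real (c1 * cmod (h t) + c2 * cmod (pd 1 h t) + c3 * cmod (F t))"
      by (simp add: g_def N_def)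
    then show ?thesis using c0 by (simp only: norm_of_real) simp
  qed
  have \<psi>: "wave a 0 h \<in> test_funs" by (rule test_funs_wave[OF a h(1)])
  have "L2norm (\<lambda>z. S_op V (wave a 0 h) z - of_real \<mu> * wave a 0 h z) \<le> sqrt (n powr (1 - \<alpha>)) * L2norm g"
  proof (rule L2norm_sheared_le[OF _ g])
    show "(\<lambda>z. S_op V (wave a 0 h) z - of_real \<mu> * wave a 0 h z) \<in> L2"
      by (intro L2_diff L2_cmult S_op_L2 test_funs_L2 \<psi> V)
    show "cmod (S_op V (wave a 0 h) (x, y) - of_real \<mu> * wave a 0 h (x, y)) \<le> cmod (g (x powr \<alpha> * y))"
      if x: "n \<le> x" "x \<le> 2 * n" for x y
    proof (cases "\<bar>x powr \<alpha> * y\<bar> \<le> T")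
      case True
      show ?thesis
        unfolding cg c1_def c2_def c3_def F_def V_def
        by (rule residual_bound[OF p \<kappa> a test_funs_smooth[OF h(1)] M x True T])
    next
      \<comment> \<open>Beyond \<open>T\<close> the pointwise bound is applied with |t| itself in
        the role of \<open>T\<close>; all three factors vanish there, so the residual is 0.\<close>
      case False
      let ?t = "x powr \<alpha> * y"
      have S: "open {t::real. \<bar>t\<bar> > T}" by (intro open_Collect_less continuous_intros)
      have h1: "pd 1 h t = 0" if "\<bar>t\<bar> > T" for t
        by (rule has_pd_locally_const[OF test_funs_has_pd[OF h(1)] S]) (use that h(2) in auto)
      have h2: "pd 1 (pd 1 h) t = 0" if "\<bar>t\<bar> > T" for t
        by (rule has_pd_locally_const[OF test_funs_has_pd[OF h'] S]) (use that h1 in auto)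
      have "h ?t = 0" "pd 1 h ?t = 0" "S_op (\<lambda>t. \<bar>t\<bar> powr p) h ?t = 0"
        using False h(2) h1 h2 by (auto simp: S_op_def laplacian_eq)
      then have "cmod (S_op V (wave a 0 h) (x, y) - of_real \<mu> * wave a 0 h (x, y)) \<le> 0"
        using residual_bound[OF p \<kappa> a test_funs_smooth[OF h(1)] M x order_refl, of y] False T
        unfolding V_def by simp
      then show ?thesis using norm_ge_zero order_trans by blast
    qed
    show "S_op V (wave a 0 h) (x, y) - of_real \<mu> * wave a 0 h (x, y) = 0" if "x < n \<or> x > 2 * n" for x y
    proof -
      have w: "wave b \<beta> f (x, y) = 0" if "b \<in> window" for b \<beta> f
        using wave_eq_0[OF that] \<open>x < n \<or> x > 2 * n\<close> by simp
      note ws = w[OF a] w[OF window_pd[OF a]] w[OF window_pd[OF window_pd[OF a]]]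
      show ?thesis
        unfolding S_op_def laplacian_real_prod pd_wave_xx[OF a test_funs_smooth[OF h(1)]]
          pd_wave_yy[OF a test_funs_smooth[OF h(1)]] ws by simp
    qed
  qed
  also have "\<dots> \<le> sqrt (n powr (1 - \<alpha>)) * (c1 * L2norm h + c2 * L2norm (pd 1 h) + c3 * L2norm F)"
  proof (rule mult_left_mono)
    have "L2norm g \<le> L2norm (\<lambda>t. of_real c1 * N h t + of_real c2 * N (pd 1 h) t) + L2norm (\<lambda>t. of_real c3 * N F t)"
      unfolding g_def by (intro L2norm_triangle L2_add L2_cmult N L)
    also have "L2norm (\<lambda>t. of_real c1 * N h t + of_real c2 * N (pd 1 h) t) \<le>
        L2norm (\<lambda>t. of_real c1 * N h t) + L2norm (\<lambda>t. of_real c2 * N (pd 1 h) t)"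
      by (intro L2norm_triangle L2_cmult N L)
    finally show "L2norm g \<le> c1 * L2norm h + c2 * L2norm (pd 1 h) + c3 * L2norm F"
      unfolding L2norm_cmult using c0 N(2)[OF L(1)] N(2)[OF L(2)] N(2)[OF L(3)] by simp
  qed simp
  finally show ?thesis .
qed

end

section \<open>Assembling the singular sequence and the spectrum\<close>

lemma continuous_abs_powr:
  fixes p :: real
  assumes "p > 0" "continuous_on UNIV g"
  shows "continuous_on UNIV (\<lambda>x. \<bar>g x\<bar> powr p)"
  by (rule continuous_on_powr') (use assms in \<open>auto intro!: continuous_intros\<close>)

lemma exists_window:
  obtains a and M :: real where "a \<in> window" "L2norm a > 0" "\<And>s. cmod (a s) \<le> M" "\<And>s. cmod (pd 1 a s) \<le> M"
    "\<And>s. cmod (pd 1 (pd 1 a) s) \<le> M"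
proof -
  define a where "a s = complex_of_real (bump (3/2) (1/2) s)" for s :: real
  have at: "a \<in> test_funs" unfolding a_def[abs_def] by (rule test_funs_bump) simp
  have "a s = 0" if "s < 1 \<or> s > 2" for s
    using that bump_eq_0_iff[of "1/2" "3/2" s] by (auto simp: a_def)
  then have a: "a \<in> window" using at by (simp add: window_def)
  have "L2norm a \<noteq> 0"
  proof
    assume "L2norm a = 0"
    then have "AE s in lborel. a s = 0" by (rule L2norm_eq_0_imp_AE[OF test_funs_L2[OF at]])
    then have "(\<integral>s. bump (3/2) (1/2) (s::real) \<partial>lborel) = 0"
      by (intro integral_eq_zero_AE) (auto simp: a_def)
    then show False using bump_integral_pos[of "1/2" "3/2 :: real"] by simp
  qed
  then have pos: "L2norm a > 0" using L2norm_nonneg[of a] by linarith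
  have bd: "\<exists>B. \<forall>s. cmod (f s) \<le> B" if "f \<in> test_funs" for f :: "real \<Rightarrow> complex"
    using test_funs_support[OF that] bounded_support_imp_bounded[OF test_funs_continuous[OF that]] by metis
  have a': "pd 1 a \<in> test_funs" "pd 1 (pd 1 a) \<in> test_funs" using test_funs_pd[OF at] test_funs_pd[OF test_funs_pd[OF at]] by auto
  obtain B0 B1 B2 where "\<And>s. cmod (a s) \<le> B0" "\<And>s. cmod (pd 1 a s) \<le> B1" "\<And>s. cmod (pd 1 (pd 1 a) s) \<le> B2"
    using bd[OF at] bd[OF a'(1)] bd[OF a'(2)] by blast
  then show ?thesis
    by (intro that[OF a pos, of "max B0 (max B1 B2)"]) (auto simp: le_max_iff_disj)
qed

theorem theorem2p1:
  fixes p \<gamma> lam :: real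
  assumes "p \<ge> 1"
    and "\<gamma> \<in> op_real_eigenvalues (op_closure (H_op p))"
    and "\<forall>\<mu>\<in>op_real_eigenvalues (op_closure (H_op p)). \<gamma> \<le> \<mu>"
    and "lam > \<gamma>"
  shows "op_spectrum (op_closure (L_op p lam)) = \<real>"
proof -
  define \<alpha> where "\<alpha> = p / (p + 2)"
  define V where "V = (\<lambda>z::real \<times> real. \<bar>fst z * snd z\<bar> powr p - lam * ((fst z)\<^sup>2 + (snd z)\<^sup>2) powr \<alpha>)"
  have p: "p > 0" "\<alpha> * (p + 2) = p" using assms(1) by (auto simp: \<alpha>_def)
  have \<alpha>: "0 < \<alpha>" "\<alpha> < 1" using assms(1) by (auto simp: \<alpha>_def)
  have L: "L_op p lam = S_op V" by (auto simp: L_op_def S_op_def V_def \<alpha>_def fun_eq_iff)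
  have H: "H_op p = S_op (\<lambda>t. \<bar>t\<bar> powr p)" by (auto simp: H_op_def S_op_def fun_eq_iff)
  have cV1: "continuous_on UNIV (\<lambda>t::real. \<bar>t\<bar> powr p)"
    by (rule continuous_abs_powr[OF p(1)]) (rule continuous_on_id)
  have "continuous_on UNIV (\<lambda>z::real \<times> real. \<bar>(fst z)\<^sup>2 + (snd z)\<^sup>2\<bar> powr \<alpha>)"
    by (rule continuous_abs_powr[OF \<alpha>(1)]) (intro continuous_intros)
  then have c2: "continuous_on UNIV (\<lambda>z::real \<times> real. ((fst z)\<^sup>2 + (snd z)\<^sup>2) powr \<alpha>)" by simp
  have cV: "continuous_on UNIV V"
    unfolding V_def
    by (intro continuous_on_diff continuous_on_mult[OF continuous_on_const c2] continuous_abs_powr[OF p(1)]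
        continuous_on_mult continuous_on_fst continuous_on_snd continuous_on_id)
  \<comment> \<open>The growth exponent 2 \<alpha> is below 2, as the cutoff argument requires;
    |xy|^p only helps.\<close>
  have V_ge: "V z \<ge> - \<bar>lam\<bar> * (1 + norm z) powr (2 * \<alpha>)" for z
  proof -
    have "(fst z)\<^sup>2 + (snd z)\<^sup>2 = (norm z)\<^sup>2" by (cases z) (simp add: norm_Pair)
    then have "((fst z)\<^sup>2 + (snd z)\<^sup>2) powr \<alpha> = norm z powr (2 * \<alpha>)"
      by (cases "norm z = 0") (simp_all add: powr_powr flip: powr_numeral)
    also have "\<dots> \<le> (1 + norm z) powr (2 * \<alpha>)" using \<alpha> by (intro powr_mono2) auto
    finally have "\<bar>lam\<bar> * ((fst z)\<^sup>2 + (snd z)\<^sup>2) powr \<alpha> \<le> \<bar>lam\<bar> * (1 + norm z) powr (2 * \<alpha>)"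
      by (intro mult_left_mono) auto
    moreover have "lam * ((fst z)\<^sup>2 + (snd z)\<^sup>2) powr \<alpha> \<le> \<bar>lam\<bar> * ((fst z)\<^sup>2 + (snd z)\<^sup>2) powr \<alpha>"
      by (intro mult_right_mono) auto
    moreover have "\<bar>fst z * snd z\<bar> powr p \<ge> 0" by simp
    ultimately show ?thesis unfolding V_def by linarith
  qed
  have nonreal: "z \<in> op_resolvent_set (op_closure (S_op V))" if "Im z \<noteq> 0" for z
    by (rule nonreal_in_resolvent_set[OF cV V_ge _ _ \<alpha>(2) that]) (use \<alpha> in auto)
  \<comment> \<open>The a priori estimate in the definition of the resolvent set is the condition
    that fails: waves violate it for every constant \<open>C\<close>.\<close>
  have real: "of_real \<mu> \<notin> op_resolvent_set (op_closure (S_op V))" for \<mu>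
  proof
    assume "of_real \<mu> \<in> op_resolvent_set (op_closure (S_op V))"
    then obtain C where "\<And>u v. (u, v) \<in> op_closure (S_op V) \<Longrightarrow> L2norm u \<le> C * L2norm (\<lambda>x. v x - of_real \<mu> * u x)"
      unfolding op_resolvent_set_def by blast
    then have C: "L2norm \<psi> \<le> C * L2norm (\<lambda>x. S_op V \<psi> x - of_real \<mu> * \<psi> x)" if "\<psi> \<in> test_funs" for \<psi>
      using op_closure_S_op_test[OF cV that] by blast
    define \<kappa> where "\<kappa> = sqrt (lam - \<gamma>)"
    define \<nu> where "\<nu> = \<mu> / (2 * \<kappa>)"
    have \<kappa>: "\<kappa>\<^sup>2 = lam - \<gamma>" "2 * \<kappa> * \<nu> = \<mu>" using assms(4) by (auto simp: \<kappa>_def \<nu>_def)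
    obtain a and M :: real where a: "a \<in> window" "L2norm a > 0" and M: "\<And>s. cmod (a s) \<le> M" "\<And>s. cmod (pd 1 a s) \<le> M"
      "\<And>s. cmod (pd 1 (pd 1 a) s) \<le> M"
      by (rule exists_window) (rule that; assumption)
    \<comment> \<open>For |t| >= 1 and p >= 1 the power dominates |t|, which yields an explicit
      radius beyond which the gap 3 holds.\<close>
    have V1: "\<bar>t\<bar> powr p \<ge> \<gamma> + 3" if "\<bar>t\<bar> \<ge> max 1 (\<gamma> + 3)" for t
      using powr_mono[of 1 p "\<bar>t\<bar>"] that assms(1) by simp
    obtain B T0 :: real where B: "B > 0" and quasi: "\<And>T. T \<ge> T0 \<Longrightarrow> \<exists>h\<in>test_funs. (\<forall>t. \<bar>t\<bar> \<ge> T \<longrightarrow> h t = 0) \<and>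
       1/2 \<le> L2norm h \<and> L2norm h \<le> 1 \<and> L2norm (pd 1 h) \<le> B \<and>
       L2norm (\<lambda>t. S_op (\<lambda>t. \<bar>t\<bar> powr p) h t - of_real \<gamma> * h t) \<le> B * exp (- T)"
    proof (rule localised_quasimodes[OF cV1 _ _ assms(2)[unfolded H]])
      show "\<bar>t\<bar> powr p \<ge> 0" for t :: real by (rule powr_ge_zero)
      show "\<bar>t\<bar> powr p \<ge> \<gamma> + 3" if "\<bar>t\<bar> \<ge> max 1 (\<gamma> + 3)" for t :: real
        using that by (rule V1)
    qed (rule that; assumption)
    define c1 where "c1 n = M * ((1 + 5 * \<bar>\<kappa>\<bar> + 3 * \<bar>\<nu>\<bar>) * n powr (\<alpha> - 1) + \<nu>\<^sup>2 * n powr (- \<alpha> - \<alpha>))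
         + M * ((2 * ln n)\<^sup>2 * n powr (- 2)) * ((2 * ln n) powr p + \<bar>\<gamma>\<bar>)
         + M * (\<bar>lam\<bar> * ((2 * ln n)\<^sup>2 * n powr (- 2 * \<alpha>\<^sup>2)))" for n
    define c2 where "c2 n = M * ((3 + 2 * \<bar>\<kappa>\<bar> + 2 * \<bar>\<nu>\<bar>) * ((2 * ln n) * n powr (\<alpha> - 1)))" for n
    define c3 where "c3 n = M * ((2 * ln n)\<^sup>2 * n powr (- 2)) + M * (2 * n) powr (2 * \<alpha>)" for n
    \<comment> \<open>The residual bound with T = 2 ln n and without the factor n^((1 - \<alpha>) /
      2), which it shares with the norm of the wave.\<close>
    define D where "D n = c1 n + c2 n * B + c3 n * (B * exp (- (2 * ln n)))" for n
    have "(D \<longlongrightarrow> 0) at_top"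
    proof -
      have l1: "((\<lambda>n. n powr (\<alpha> - 1)) \<longlongrightarrow> 0) at_top" using \<alpha> by real_asymp
      have l2: "((\<lambda>n. n powr (- \<alpha> - \<alpha>)) \<longlongrightarrow> 0) at_top" using \<alpha> by real_asymp
      have l3: "((\<lambda>n::real. (2 * ln n)\<^sup>2 * n powr (- 2)) \<longlongrightarrow> 0) at_top" by real_asymp
      have l4: "((\<lambda>n. (2 * ln n)\<^sup>2 * n powr (- 2) * (2 * ln n) powr p) \<longlongrightarrow> 0) at_top" using p(1) by real_asymp
      have l5: "((\<lambda>n. (2 * ln n)\<^sup>2 * n powr (- s)) \<longlongrightarrow> 0) at_top" if "s > 0" for s :: real using that by real_asymp
      have l6: "((\<lambda>n. 2 * ln n * n powr (\<alpha> - 1)) \<longlongrightarrow> 0) at_top" using \<alpha> by real_asymp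
      \<comment> \<open>The decisive term: the residual of \<open>h\<close>, amplified by x^(2
        \<alpha>). With T = 2 ln n it is of order n^(2 \<alpha> - 2), which decays since \<alpha> <
        1.\<close>
      have l7: "((\<lambda>n. (2 * n) powr (2 * \<alpha>) * exp (- (2 * ln n))) \<longlongrightarrow> 0) at_top" using \<alpha> by real_asymp
      have l8: "((\<lambda>n. exp (- (2 * ln n))) \<longlongrightarrow> (0::real)) at_top" by real_asymp
      have "((\<lambda>n. M * ((1 + 5 * \<bar>\<kappa>\<bar> + 3 * \<bar>\<nu>\<bar>) * n powr (\<alpha> - 1) + \<nu>\<^sup>2 * n powr (- \<alpha> - \<alpha>))
         + (M * ((2 * ln n)\<^sup>2 * n powr (- 2) * (2 * ln n) powr p) + M * \<bar>\<gamma>\<bar> * ((2 * ln n)\<^sup>2 * n powr (- 2)))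
         + M * (\<bar>lam\<bar> * ((2 * ln n)\<^sup>2 * n powr (- (2 * \<alpha>\<^sup>2))))
         + M * ((3 + 2 * \<bar>\<kappa>\<bar> + 2 * \<bar>\<nu>\<bar>) * (2 * ln n * n powr (\<alpha> - 1))) * B
         + (M * ((2 * ln n)\<^sup>2 * n powr (- 2)) * (B * exp (- (2 * ln n)))
         + M * B * ((2 * n) powr (2 * \<alpha>) * exp (- (2 * ln n))))) \<longlongrightarrow>
         M * ((1 + 5 * \<bar>\<kappa>\<bar> + 3 * \<bar>\<nu>\<bar>) * 0 + \<nu>\<^sup>2 * 0) + (M * 0 + M * \<bar>\<gamma>\<bar> * 0) + M * (\<bar>lam\<bar> * 0)
         + M * ((3 + 2 * \<bar>\<kappa>\<bar> + 2 * \<bar>\<nu>\<bar>) * 0) * B + (M * 0 * (B * 0) + M * B * 0)) at_top"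
        using \<alpha> by (intro tendsto_add tendsto_mult tendsto_const l1 l2 l3 l4 l5 l6 l7 l8) auto
      then show ?thesis
        unfolding D_def[abs_def] c1_def c2_def c3_def by (simp add: algebra_simps)
    qed
    \<comment> \<open>Chosen so that (|C| + 1) times the common factor times \<open>d\<close> equals
      the lower bound for the norm of the wave, which makes the strict inequality contradictory.
      Replacing C by |C| + 1 makes it positive.\<close>
    moreover define d where "d = L2norm a / (2 * sqrt 2 * (\<bar>C\<bar> + 1))"
    moreover have "d > 0" using a(2) by (simp add: d_def)
    ultimately have ev: "\<forall>\<^sub>F n in at_top. D n < d" using order_tendstoD(2) by blast
    have "filterlim (\<lambda>n::real. 2 * ln n) at_top at_top" by real_asymp
    then have "\<forall>\<^sub>F n in at_top. 2 * ln n \<ge> max T0 1" unfolding filterlim_at_top by blast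
    with ev have "\<forall>\<^sub>F n in at_top. D n < d \<and> 2 * ln n \<ge> max T0 1 \<and> n \<ge> (1::real)"
      using eventually_ge_at_top by (intro eventually_conj)
    then obtain n where large: "D n < d" "2 * ln n \<ge> T0" "2 * ln n \<ge> 1" "n \<ge> 1"
      using eventually_happens'[OF trivial_limit_at_top_linorder] by fastforce
    interpret wkb \<alpha> \<kappa> \<nu> n by unfold_locales (use large \<alpha> in auto)
    obtain h where h: "h \<in> test_funs" "\<And>t. \<bar>t\<bar> \<ge> 2 * ln n \<Longrightarrow> h t = 0" "1/2 \<le> L2norm h" "L2norm h \<le> 1"
      "L2norm (pd 1 h) \<le> B"
      "L2norm (\<lambda>t. S_op (\<lambda>t. \<bar>t\<bar> powr p) h t - of_real \<gamma> * h t) \<le> B * exp (- (2 * ln n))"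
      using quasi[OF large(2)] by blast
    have M0: "M \<ge> 0" using M(1)[of 0] norm_ge_zero order_trans by blast
    have c0: "c1 n \<ge> 0" "c2 n \<ge> 0" "c3 n \<ge> 0" using M0 large by (auto simp: c1_def c2_def c3_def)
    let ?q = "sqrt (n powr (1 - \<alpha>))"
    have q: "?q > 0" using large by simp
    define r where "r = L2norm (\<lambda>z. S_op V (wave a 0 h) z - of_real \<mu> * wave a 0 h z)"
    have "r \<le> ?q * (c1 n * L2norm h + c2 n * L2norm (pd 1 h)
        + c3 n * L2norm (\<lambda>t. S_op (\<lambda>t. \<bar>t\<bar> powr p) h t - of_real \<gamma> * h t))"
      unfolding r_def V_def c1_def c2_def c3_def
      by (rule residual_L2_bound[OF p \<kappa> a(1) h(1,2) M large(3) cV[unfolded V_def] cV1])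
    also have "\<dots> \<le> ?q * (c1 n * 1 + c2 n * B + c3 n * (B * exp (- (2 * ln n))))"
      using h c0 by (intro mult_left_mono add_mono) auto
    finally have r: "r \<le> ?q * D n" by (simp add: D_def)
    have r0: "r \<ge> 0" by (simp add: r_def)
    have "sqrt (n powr (1 - \<alpha>) / 2) * L2norm a * (1/2) \<le> sqrt (n powr (1 - \<alpha>) / 2) * L2norm a * L2norm h"
      using h(3) by (intro mult_left_mono) auto
    also have "\<dots> \<le> L2norm (wave a 0 h)" by (rule L2norm_wave_ge[OF a(1) h(1)])
    also have "\<dots> \<le> C * r" unfolding r_def by (rule C[OF test_funs_wave[OF a(1) h(1)]])
    also have "\<dots> \<le> (\<bar>C\<bar> + 1) * (?q * D n)" using r r0 by (intro mult_mono) auto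
    also have "\<dots> < (\<bar>C\<bar> + 1) * (?q * d)" using large(1) q by (intro mult_strict_left_mono) auto
    also have "\<dots> = ?q * L2norm a / (2 * sqrt 2)"
    proof -
      have "K * (u * (v / (w * K))) = u * v / w" if "K > 0" for K u v w :: real using that by simp
      from this[of "\<bar>C\<bar> + 1"] show ?thesis unfolding d_def by simp
    qed
    finally show False by (simp add: real_sqrt_divide field_simps)
  qed
  have "z \<in> op_spectrum (op_closure (S_op V)) \<longleftrightarrow> z \<in> \<real>" for z
  proof (cases "Im z = 0")
    case True
    then have z: "z = of_real (Re z)" by (simp add: complex_eq_iff)
    then have "z \<in> \<real>" by (metis Reals_of_real)
    moreover have "z \<notin> op_resolvent_set (op_closure (S_op V))" using real[of "Re z"] z by simp
    ultimately show ?thesis by (simp add: op_spectrum_def)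
  next
    case False
    then show ?thesis using nonreal by (auto simp: op_spectrum_def complex_is_Real_iff)
  qed
  then show ?thesis unfolding L by blast
qed

end
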